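(* Let $(\mathcal{A},{}_{\pi_1}(E_1)_B,\mathcal{D}_1)$, $(\mathcal{B},{}_{\pi_2}(E_2)_C,\mathcal{D}_2)$, and $(\mathcal{A},{}_{\pi}E_C,\mathcal{D})$ be half-closed modules, where $E:=E_1\widehat\otimes_BE_2$ and $\pi=\pi_1\widehat\otimes1$, and suppose that $\pi_1$ is essential. Assume that for all $\psi$ in a dense subspace $\mathcal{E}_1$ of $\operatorname{Dom}\mathcal{D}_1$ we have $$\widetilde T_\psi:=\begin{pmatrix}0&T_\psi\\ T_\psi^*&0\end{pmatrix}\in\operatorname{Lip}(\mathcal{D}\oplus\mathcal{D}_2).$$ Then for any $\psi\in\pi_1(A)\cdot E_1$, the graded commutator $[F_{\mathcal{D}}\oplus F_{\mathcal{D}_2},\widetilde T_\psi]$ is compact on $E\oplus E_2$.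
   Context: $A$, $B$, $C$ are $\mathbb{Z}_2$-graded $\sigma$-unital $C^*$-algebras. The graded commutator is $[S,T]:=ST-(-1)^{\deg S\cdot\deg T}TS$ on homogeneous operators. For a densely defined operator $\mathcal{D}$ on a Hilbert $B$-module $E$, $\operatorname{Lip}(\mathcal{D}):=\{T\in\operatorname{End}_B(E): T\operatorname{Dom}\mathcal{D}\subset\operatorname{Dom}\mathcal{D},\ [\mathcal{D},T]\text{ is bounded on }\operatorname{Dom}\mathcal{D}\}$ and $\operatorname{Lip}^*(\mathcal{D}):=\{T\in\operatorname{Lip}(\mathcal{D}): T\operatorname{Dom}\mathcal{D}^*\subset\operatorname{Dom}\mathcal{D}\}$. A half-closed $A$-$B$-module $(\mathcal{A},{}_\pi E_B,\mathcal{D})$ consists of a $\mathbb{Z}_2$-graded countably generated right Hilbert $B$-module $E$, an odd regular symmetric operator $\mathcal{D}$ on $E$, a ($\mathbb{Z}_2$-graded) $*$-homomorphism $\pi\colon A\to\operatorname{End}_B(E)$ and a dense $*$-subalgebra $\mathcal{A}\subset A$ such that $\pi(\mathcal{A})\subset\operatorname{Lip}^*(\mathcal{D})$ and $\pi(a)(1+\mathcal{D}^*\mathcal{D})^{-1}$ is compact for all $a\in A$. The bounded transform is $F_{\mathcal{D}}:=\mathcal{D}(1+\mathcal{D}^*\mathcal{D})^{-\frac12}$. "Essential" means that $\pi_1(A)E_1$ is dense in $E_1$. $E_1\widehat\otimes_BE_2$ is the graded internal tensor product (over $\pi_2$). For $\psi\in E_1$, $T_\psi\colon E_2\to E$ is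 $T_\psi\eta=\psi\widehat\otimes\eta$, with adjoint $T_\psi^*(\xi\widehat\otimes\eta)=\pi_2(\langle\psi|\xi\rangle)\eta$; $\widetilde T_\psi$ acts on $E\oplus E_2$. Compact means in $\operatorname{End}^0_C(E\oplus E_2)$. *)

theory Defs
  imports "HOL-Analysis.Analysis"
begin

section \<open>Complex vector spaces and graded C*-algebras\<close>

class scaleC = scaleR +
  fixes scaleC :: "complex \<Rightarrow> 'a \<Rightarrow> 'a"  (infixr \<open>*\<^sub>C\<close> 75)
  assumes scaleR_scaleC: "scaleR r = scaleC (complex_of_real r)"

class complex_vector = scaleC + ab_group_add +
  assumes scaleC_add_right: "c *\<^sub>C (x + y) = c *\<^sub>C x + c *\<^sub>C y"
    and scaleC_add_left: "(c + d) *\<^sub>C x = c *\<^sub>C x + d *\<^sub>C x"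
    and scaleC_scaleC: "c *\<^sub>C d *\<^sub>C x = (c * d) *\<^sub>C x"
    and scaleC_one: "1 *\<^sub>C x = x"
begin

subclass real_vector
  by standard (simp_all add: scaleR_scaleC scaleC_add_right scaleC_add_left scaleC_scaleC scaleC_one)

end

instantiation prod :: (complex_vector, complex_vector) complex_vector
begin

definition scaleC_prod_def: "scaleC c p = (c *\<^sub>C fst p, c *\<^sub>C snd p)"

instance
  by standard
    (auto simp: scaleC_prod_def scaleR_prod_def scaleR_scaleC fun_eq_iff scaleC_add_right
      scaleC_add_left scaleC_scaleC scaleC_one prod_eq_iff)

end

abbreviation csubspace :: "'a::complex_vector set \<Rightarrow> bool"
  where "csubspace \<equiv> module.subspace scaleC"

abbreviation cspan :: "'a::complex_vector set \<Rightarrow> 'a set"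
  where "cspan \<equiv> module.span scaleC"

text \<open>C*-algebras are not assumed to be unital.\<close>

class cstar_algebra = complex_vector + real_normed_algebra + complete_space +
  fixes star :: "'a \<Rightarrow> 'a"
  assumes scaleC_mult_left: "(c *\<^sub>C x) * y = c *\<^sub>C (x * y)"
    and scaleC_mult_right: "x * (c *\<^sub>C y) = c *\<^sub>C (x * y)"
    and norm_scaleC: "norm (c *\<^sub>C x) = cmod c * norm x"
    and star_add: "star (x + y) = star x + star y"
    and star_scaleC: "star (c *\<^sub>C x) = cnj c *\<^sub>C star x"
    and star_mult: "star (x * y) = star y * star x"
    and star_star: "star (star x) = x"
    and cstar_identity: "norm (star x * x) = (norm x)\<^sup>2"

text \<open>
  A \<open>\<int>\<^sub>2\<close>-grading is given by its grading automorphism, which is \<open>(-1)\<^sup>i\<close> on the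
  homogeneous elements of degree \<open>i\<close>; the summands of the grading are its eigenspaces.
\<close>

class graded_cstar_algebra = cstar_algebra +
  fixes grade :: "'a \<Rightarrow> 'a"
  assumes grade_add: "grade (x + y) = grade x + grade y"
    and grade_scaleC: "grade (c *\<^sub>C x) = c *\<^sub>C grade x"
    and grade_mult: "grade (x * y) = grade x * grade y"
    and grade_star: "grade (star x) = star (grade x)"
    and grade_grade: "grade (grade x) = x"

definition positive_element :: "'a::cstar_algebra \<Rightarrow> bool"
  where "positive_element x \<longleftrightarrow> (\<exists>y. x = star y * y)"

text \<open>Existence of a countable approximate unit.\<close>

definition sigma_unital :: "'a::cstar_algebra itself \<Rightarrow> bool"
  where "sigma_unital _ \<longleftrightarrow> (\<exists>u :: nat \<Rightarrow> 'a.
    (\<forall>n. positive_element (u n) \<and> norm (u n) \<le> 1 \<and> positive_element (u (Suc n) - u n)) \<and>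
    (\<forall>a. (\<lambda>n. u n * a) \<longlonglongrightarrow> a \<and> (\<lambda>n. a * u n) \<longlonglongrightarrow> a))"

definition dense_star_subalgebra :: "'a::cstar_algebra set \<Rightarrow> bool"
  where "dense_star_subalgebra S \<longleftrightarrow> csubspace S \<and> (\<forall>x\<in>S. \<forall>y\<in>S. x * y \<in> S) \<and>
    (\<forall>x\<in>S. star x \<in> S) \<and> closure S = UNIV"


section \<open>Graded Hilbert modules\<close>

text \<open>
  The right action, the algebra-valued inner product (linear in the second variable) and the
  grading operator of a module whose underlying vector space is the type \<open>'e\<close>. The type carries
  no topology: the one in use is always that of the norm \<open>hnorm\<close> of the inner product.
\<close>

record ('e, 'b) hmodule =
  act :: "'e \<Rightarrow> 'b \<Rightarrow> 'e"
  ip :: "'e \<Rightarrow> 'e \<Rightarrow> 'b"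
  gr :: "'e \<Rightarrow> 'e"

definition hnorm :: "('e::complex_vector, 'b::cstar_algebra) hmodule \<Rightarrow> 'e \<Rightarrow> real"
  where "hnorm E x = sqrt (norm (ip E x x))"

definition hlim :: "('e::complex_vector, 'b::cstar_algebra) hmodule \<Rightarrow> (nat \<Rightarrow> 'e) \<Rightarrow> 'e \<Rightarrow> bool"
  where "hlim E s x \<longleftrightarrow> (\<lambda>n. hnorm E (s n - x)) \<longlonglongrightarrow> 0"

definition hdense :: "('e::complex_vector, 'b::cstar_algebra) hmodule \<Rightarrow> 'e set \<Rightarrow> bool"
  where "hdense E S \<longleftrightarrow> (\<forall>x. \<forall>\<epsilon>>0. \<exists>y\<in>S. hnorm E (x - y) < \<epsilon>)"

locale graded_hilbert_module =
  fixes E :: "('e::complex_vector, 'b::graded_cstar_algebra) hmodule"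
  assumes act_add_left: "act E (x + y) b = act E x b + act E y b"
    and act_add_right: "act E x (b + b') = act E x b + act E x b'"
    and act_scaleC_left: "act E (c *\<^sub>C x) b = c *\<^sub>C act E x b"
    and act_scaleC_right: "act E x (c *\<^sub>C b) = c *\<^sub>C act E x b"
    and act_mult: "act E x (b * b') = act E (act E x b) b'"
    and ip_add_right: "ip E x (y + z) = ip E x y + ip E x z"
    and ip_scaleC_right: "ip E x (c *\<^sub>C y) = c *\<^sub>C ip E x y"
    and ip_act_right: "ip E x (act E y b) = ip E x y * b"
    and ip_star: "star (ip E x y) = ip E y x"
    and ip_positive: "positive_element (ip E x x)"
    and ip_definite: "ip E x x = 0 \<Longrightarrow> x = 0"
    and complete: "(\<And>\<epsilon>. \<epsilon> > 0 \<Longrightarrow> \<exists>N. \<forall>m\<ge>N. \<forall>n\<ge>N. hnorm E (s m - s n) < \<epsilon>) \<Longrightarrow> \<exists>x. hlim E s x"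
    and gr_add: "gr E (x + y) = gr E x + gr E y"
    and gr_scaleC: "gr E (c *\<^sub>C x) = c *\<^sub>C gr E x"
    and gr_act: "gr E (act E x b) = act E (gr E x) (grade b)"
    and gr_ip: "ip E (gr E x) (gr E y) = grade (ip E x y)"
    and gr_gr: "gr E (gr E x) = x"

definition countably_generated :: "('e::complex_vector, 'b::cstar_algebra) hmodule \<Rightarrow> bool"
  where "countably_generated E \<longleftrightarrow> (\<exists>X. countable X \<and> hdense E (cspan {act E x b | x b. x \<in> X}))"

definition dsum_module ::
  "('e, 'b::plus) hmodule \<Rightarrow> ('f, 'b) hmodule \<Rightarrow> ('e \<times> 'f, 'b) hmodule"
  where "dsum_module E F =
    \<lparr>act = (\<lambda>(x, y) b. (act E x b, act F y b)),
     ip = (\<lambda>(x, y) (x', y'). ip E x x' + ip F y y'),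
     gr = (\<lambda>(x, y). (gr E x, gr F y))\<rparr>"


section \<open>Adjointable and compact operators\<close>

definition adjointable ::
  "('e, 'b) hmodule \<Rightarrow> ('f, 'b) hmodule \<Rightarrow> ('e \<Rightarrow> 'f) \<Rightarrow> bool"
  where "adjointable E F T \<longleftrightarrow> (\<exists>S. \<forall>x y. ip F (T x) y = ip E x (S y))"

definition adj :: "('e, 'b) hmodule \<Rightarrow> ('f, 'b) hmodule \<Rightarrow> ('e \<Rightarrow> 'f) \<Rightarrow> 'f \<Rightarrow> 'e"
  where "adj E F T = (THE S. \<forall>x y. ip F (T x) y = ip E x (S y))"

definition positive_op :: "('e, 'b) hmodule \<Rightarrow> ('e \<Rightarrow> 'e) \<Rightarrow> bool"
  where "positive_op E T \<longleftrightarrow> (\<exists>R. adjointable E E R \<and> T = adj E E R \<circ> R)"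

definition sqrt_op :: "('e, 'b) hmodule \<Rightarrow> ('e \<Rightarrow> 'e) \<Rightarrow> 'e \<Rightarrow> 'e"
  where "sqrt_op E T = (THE S. positive_op E S \<and> S \<circ> S = T)"

text \<open>
  The linear span of the rank one operators \<open>\<theta>\<^sub>x\<^sub>,\<^sub>y z = x\<langle>y|z\<rangle>\<close>, and its closure in the
  operator norm of \<open>End E\<close>.
\<close>

definition finite_rank_ops :: "('e::complex_vector, 'b) hmodule \<Rightarrow> ('e \<Rightarrow> 'e) set"
  where "finite_rank_ops E = {\<lambda>z. \<Sum>i<n. act E (x i) (ip E (y i) z) | (n::nat) x y. True}"

definition compact_op :: "('e::complex_vector, 'b::cstar_algebra) hmodule \<Rightarrow> ('e \<Rightarrow> 'e) \<Rightarrow> bool"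
  where "compact_op E T \<longleftrightarrow> adjointable E E T \<and>
    (\<forall>\<epsilon>>0. \<exists>S\<in>finite_rank_ops E. \<forall>x. hnorm E (T x - S x) \<le> \<epsilon> * hnorm E x)"

text \<open>
  Homogeneous components of an operator, and the graded commutator
  \<open>[S,T] = ST - (-1)^(deg S * deg T) TS\<close> of homogeneous operators, extended bilinearly to all operators.
  A partial operator \<open>D\<close> enters as \<open>\<lambda>x. the (D x)\<close>; if \<open>Dom D\<close> is a graded subspace that \<open>T\<close>
  preserves, then on \<open>Dom D\<close> only values of \<open>D\<close> at points of \<open>Dom D\<close> occur.
\<close>

definition homogeneous_part ::
  "('e::complex_vector, 'b) hmodule \<Rightarrow> nat \<Rightarrow> ('e \<Rightarrow> 'e) \<Rightarrow> 'e \<Rightarrow> 'e"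
  where "homogeneous_part E i T x = (1/2) *\<^sub>R (T x + (-1) ^ i *\<^sub>R gr E (T (gr E x)))"

definition graded_commutator ::
  "('e::complex_vector, 'b) hmodule \<Rightarrow> ('e \<Rightarrow> 'e) \<Rightarrow> ('e \<Rightarrow> 'e) \<Rightarrow> 'e \<Rightarrow> 'e"
  where "graded_commutator E S T x = (\<Sum>i<2. \<Sum>j<2.
    homogeneous_part E i S (homogeneous_part E j T x) -
    (-1) ^ (i * j) *\<^sub>R homogeneous_part E j T (homogeneous_part E i S x))"


section \<open>Unbounded operators\<close>

text \<open>An unbounded operator is a partial function, with \<open>dom\<close> as its domain.\<close>

definition linear_op ::
  "('e::complex_vector, 'b) hmodule \<Rightarrow> ('f::complex_vector, 'b) hmodule \<Rightarrow> ('e \<rightharpoonup> 'f) \<Rightarrow> bool"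
  where "linear_op E F D \<longleftrightarrow> csubspace (dom D) \<and> (\<forall>x\<in>dom D. \<forall>b. act E x b \<in> dom D) \<and>
    (\<forall>x\<in>dom D. \<forall>y\<in>dom D. the (D (x + y)) = the (D x) + the (D y)) \<and>
    (\<forall>x\<in>dom D. \<forall>c. the (D (c *\<^sub>C x)) = c *\<^sub>C the (D x)) \<and>
    (\<forall>x\<in>dom D. \<forall>b. the (D (act E x b)) = act F (the (D x)) b)"

definition closed_op ::
  "('e::complex_vector, 'b::cstar_algebra) hmodule \<Rightarrow> ('f::complex_vector, 'b) hmodule \<Rightarrow>
   ('e \<rightharpoonup> 'f) \<Rightarrow> bool"
  where "closed_op E F D \<longleftrightarrow> (\<forall>s x y. (\<forall>n. s n \<in> dom D) \<and> hlim E s x \<and>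
    hlim F (\<lambda>n. the (D (s n))) y \<longrightarrow> D x = Some y)"

definition adj_op ::
  "('e, 'b) hmodule \<Rightarrow> ('f, 'b) hmodule \<Rightarrow> ('e \<rightharpoonup> 'f) \<Rightarrow> ('f \<rightharpoonup> 'e)"
  where "adj_op E F D = (\<lambda>y.
    if \<exists>z. \<forall>x\<in>dom D. ip F (the (D x)) y = ip E x z
    then Some (THE z. \<forall>x\<in>dom D. ip F (the (D x)) y = ip E x z) else None)"

definition symmetric_op :: "('e, 'b) hmodule \<Rightarrow> ('e \<rightharpoonup> 'e) \<Rightarrow> bool"
  where "symmetric_op E D \<longleftrightarrow> (\<forall>x\<in>dom D. \<forall>y\<in>dom D. ip E (the (D x)) y = ip E x (the (D y)))"

definition odd_op :: "('e::complex_vector, 'b) hmodule \<Rightarrow> ('e \<rightharpoonup> 'e) \<Rightarrow> bool"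
  where "odd_op E D \<longleftrightarrow> (\<forall>x\<in>dom D. gr E x \<in> dom D \<and> the (D (gr E x)) = - gr E (the (D x)))"

text \<open>The graph of \<open>1 + D\<^sup>* D\<close>.\<close>

definition one_plus_adj_comp ::
  "('e::complex_vector, 'b) hmodule \<Rightarrow> ('e \<rightharpoonup> 'e) \<Rightarrow> ('e \<rightharpoonup> 'e)"
  where "one_plus_adj_comp E D = (\<lambda>x.
    if x \<in> dom D \<and> the (D x) \<in> dom (adj_op E E D)
    then Some (x + the (adj_op E E D (the (D x)))) else None)"

definition regular_op :: "('e::complex_vector, 'b::cstar_algebra) hmodule \<Rightarrow> ('e \<rightharpoonup> 'e) \<Rightarrow> bool"
  where "regular_op E D \<longleftrightarrow> linear_op E E D \<and> hdense E (dom D) \<and> closed_op E E D \<and>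
    hdense E (dom (adj_op E E D)) \<and> hdense E (ran (one_plus_adj_comp E D))"

text \<open>
  The everywhere defined operator \<open>(1 + D\<^sup>* D)\<^sup>-\<^sup>1\<close>; for regular \<open>D\<close>, \<open>1 + D\<^sup>* D\<close> is a bijection
  from its domain onto the whole module.
\<close>

definition resolvent_op :: "('e::complex_vector, 'b) hmodule \<Rightarrow> ('e \<rightharpoonup> 'e) \<Rightarrow> 'e \<Rightarrow> 'e"
  where "resolvent_op E D x = (THE y. one_plus_adj_comp E D y = Some x)"

text \<open>\<open>(1 + D\<^sup>* D)\<^sup>-\<^sup>1\<^sup>/\<^sup>2\<close> is the positive square root of \<open>(1 + D\<^sup>* D)\<^sup>-\<^sup>1\<close>; its range is \<open>Dom D\<close>.\<close>

definition bounded_transform :: "('e::complex_vector, 'b) hmodule \<Rightarrow> ('e \<rightharpoonup> 'e) \<Rightarrow> 'e \<Rightarrow> 'e"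
  where "bounded_transform E D x = the (D (sqrt_op E (resolvent_op E D) x))"

definition Lip ::
  "('e::complex_vector, 'b::cstar_algebra) hmodule \<Rightarrow> ('e \<rightharpoonup> 'e) \<Rightarrow> ('e \<Rightarrow> 'e) set"
  where "Lip E D = {T. adjointable E E T \<and> T ` dom D \<subseteq> dom D \<and>
    (\<exists>K. \<forall>x\<in>dom D. hnorm E (graded_commutator E (\<lambda>x. the (D x)) T x) \<le> K * hnorm E x)}"

definition Lip_star ::
  "('e::complex_vector, 'b::cstar_algebra) hmodule \<Rightarrow> ('e \<rightharpoonup> 'e) \<Rightarrow> ('e \<Rightarrow> 'e) set"
  where "Lip_star E D = {T \<in> Lip E D. T ` dom (adj_op E E D) \<subseteq> dom D}"

definition dsum_op :: "('e \<rightharpoonup> 'e) \<Rightarrow> ('f \<rightharpoonup> 'f) \<Rightarrow> ('e \<times> 'f \<rightharpoonup> 'e \<times> 'f)"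
  where "dsum_op D D' = (\<lambda>(x, y).
    if x \<in> dom D \<and> y \<in> dom D' then Some (the (D x), the (D' y)) else None)"


section \<open>Half-closed modules\<close>

definition graded_representation ::
  "('e::complex_vector, 'b) hmodule \<Rightarrow> ('a::graded_cstar_algebra \<Rightarrow> 'e \<Rightarrow> 'e) \<Rightarrow> bool"
  where "graded_representation E \<pi> \<longleftrightarrow>
    (\<forall>a. adjointable E E (\<pi> a)) \<and>
    (\<forall>a b x. \<pi> (a + b) x = \<pi> a x + \<pi> b x) \<and>
    (\<forall>c a x. \<pi> (c *\<^sub>C a) x = c *\<^sub>C \<pi> a x) \<and>
    (\<forall>a b. \<pi> (a * b) = \<pi> a \<circ> \<pi> b) \<and>
    (\<forall>a. \<pi> (star a) = adj E E (\<pi> a)) \<and>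
    (\<forall>a x. \<pi> (grade a) x = gr E (\<pi> a (gr E x)))"

locale half_closed_module = graded_hilbert_module E
  for \<A> :: "'a::graded_cstar_algebra set"
    and \<pi> :: "'a \<Rightarrow> 'e::complex_vector \<Rightarrow> 'e"
    and E :: "('e, 'b::graded_cstar_algebra) hmodule"
    and D :: "'e \<rightharpoonup> 'e" +
  assumes countably_generated: "countably_generated E"
    and regular: "regular_op E D"
    and symmetric: "symmetric_op E D"
    and odd: "odd_op E D"
    and representation: "graded_representation E \<pi>"
    and dense_subalgebra: "dense_star_subalgebra \<A>"
    and lipschitz: "\<pi> ` \<A> \<subseteq> Lip_star E D"
    and locally_compact: "compact_op E (\<pi> a \<circ> resolvent_op E D)"

text \<open>
  The subspace \<open>\<pi>(A)\<cdot>E\<close>, as a linear span. (By the Cohen factorisation theorem, the set of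
  products \<open>\<pi>(a)\<xi>\<close> is already a closed linear subspace.)
\<close>

definition range_span :: "('a \<Rightarrow> 'e \<Rightarrow> 'e) \<Rightarrow> 'e::complex_vector set"
  where "range_span \<pi> = cspan {\<pi> a \<xi> | a \<xi>. True}"

definition essential ::
  "('e::complex_vector, 'b::cstar_algebra) hmodule \<Rightarrow> ('a \<Rightarrow> 'e \<Rightarrow> 'e) \<Rightarrow> bool"
  where "essential E \<pi> \<longleftrightarrow> hdense E (range_span \<pi>)"


section \<open>The graded internal tensor product\<close>

text \<open>
  \<open>E\<close>, together with \<open>tens \<psi> \<eta> = \<psi> \<otimes> \<eta>\<close>, is the completion of the algebraic
  tensor product of \<open>E1\<close> and \<open>E2\<close> over \<open>B\<close> (modulo null vectors) in the inner product
  \<open>\<langle>\<psi> \<otimes> \<eta> | \<psi>' \<otimes> \<eta>'\<rangle> = \<langle>\<eta> | \<pi>2(\<langle>\<psi> | \<psi>'\<rangle>) \<eta>'\<rangle>\<close>: these conditions determine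
  \<open>E\<close> up to a unique unitary that is compatible with \<open>tens\<close>. The completion depends on the values
  \<open>E1\<close>, \<open>E2\<close> and \<open>\<pi>2\<close>, so that no type constructor can provide it.
\<close>

locale graded_internal_tensor_product =
  E: graded_hilbert_module E
  for E1 :: "('e1::complex_vector, 'b::graded_cstar_algebra) hmodule"
    and \<pi>2 :: "'b \<Rightarrow> 'e2::complex_vector \<Rightarrow> 'e2"
    and E2 :: "('e2, 'c::graded_cstar_algebra) hmodule"
    and tens :: "'e1 \<Rightarrow> 'e2 \<Rightarrow> 'e::complex_vector"
    and E :: "('e, 'c) hmodule" +
  assumes tens_add_left: "tens (\<psi> + \<psi>') \<eta> = tens \<psi> \<eta> + tens \<psi>' \<eta>"
    and tens_add_right: "tens \<psi> (\<eta> + \<eta>') = tens \<psi> \<eta> + tens \<psi> \<eta>'"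
    and tens_scaleC_left: "tens (c *\<^sub>C \<psi>) \<eta> = c *\<^sub>C tens \<psi> \<eta>"
    and tens_scaleC_right: "tens \<psi> (c *\<^sub>C \<eta>) = c *\<^sub>C tens \<psi> \<eta>"
    and tens_balanced: "tens (act E1 \<psi> b) \<eta> = tens \<psi> (\<pi>2 b \<eta>)"
    and tens_act: "act E (tens \<psi> \<eta>) k = tens \<psi> (act E2 \<eta> k)"
    and tens_ip: "ip E (tens \<psi> \<eta>) (tens \<psi>' \<eta>') = ip E2 \<eta> (\<pi>2 (ip E1 \<psi> \<psi>') \<eta>')"
    and tens_gr: "gr E (tens \<psi> \<eta>) = tens (gr E1 \<psi>) (gr E2 \<eta>)"
    and tens_dense: "hdense E (cspan {tens \<psi> \<eta> | \<psi> \<eta>. True})"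

text \<open>The creation operator \<open>T\<^sub>\<psi>\<close> is \<open>tens \<psi>\<close>.\<close>

definition creation_annihilation ::
  "('e2, 'c) hmodule \<Rightarrow> ('e1 \<Rightarrow> 'e2 \<Rightarrow> 'e) \<Rightarrow> ('e, 'c) hmodule \<Rightarrow> 'e1 \<Rightarrow> 'e \<times> 'e2 \<Rightarrow> 'e \<times> 'e2"
  where "creation_annihilation E2 tens E \<psi> = (\<lambda>(\<xi>, \<eta>). (tens \<psi> \<eta>, adj E2 E (tens \<psi>) \<xi>))"

end

theory Submission
  imports Defs
begin

text \<open>
  Let \<open>D\<close> be regular, \<open>F = D (1 + D\<^sup>* D)\<^sup>-\<^sup>1\<^sup>/\<^sup>2\<close> and \<open>G = (1 + D\<^sup>* D)\<^sup>-\<^sup>1\<^sup>/\<^sup>2\<close>. If \<open>S\<close> preserves \<open>Dom D\<close> and the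
  closure \<open>X\<close> of \<open>[D, S]\<close> is bounded, then \<open>V = S - G\<^sup>-\<^sup>1 S G\<close> satisfies \<open>[F, S] = F V + X G\<close> and a Sylvester
  equation \<open>G V + V G = W G\<close>. Iterating \<open>V = (1 - G) V (1 - G) + (W - G V) G\<close> expands \<open>V\<close> into a series that
  converges in norm, because \<open>\<parallel>G (1 - G)\<^sup>n\<parallel> \<le> 1/(n+1)\<close>, and each of its terms ends with \<open>G\<close>. Hence \<open>[F, S] b\<close> is
  compact as soon as \<open>G b\<close> is; this replaces the usual integral formula for \<open>F\<close>.

  On \<open>E \<oplus> E\<^sub>2\<close>, the operator of \<open>\<psi> = \<pi>\<^sub>1(a) \<phi> b\<close> is \<open>m T m\<^sup>*\<close>, where \<open>T\<close> is the operator of \<open>\<phi>\<close> and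
  \<open>m = \<pi>(a) \<oplus> \<pi>\<^sub>2(b\<^sup>*)\<close>. In \<open>[F, m T m\<^sup>*] = [F, m] T m\<^sup>* \<plusminus> m [F, T] m\<^sup>* \<plusminus> m T [F, m\<^sup>*]\<close> the first two terms are of
  the above form. The adjoint of the last one is of this form for \<open>D\<^sup>*\<close> in place of \<open>D\<close>; here
  \<open>\<pi>(\<A>) \<subseteq> Lip\<^sup>*\<close> makes \<open>m (1 + D D\<^sup>*)\<^sup>-\<^sup>1\<^sup>/\<^sup>2\<close> compact. The elements \<open>\<pi>\<^sub>1(a) \<phi> b\<close> with \<open>\<phi> \<in> \<E>\<^sub>1\<close> are total
  in \<open>\<pi>\<^sub>1(A) E\<^sub>1\<close>, on which the commutator depends continuously.
\<close>

section \<open>C*-algebra preliminaries\<close>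

text \<open>Since \<open>D\<close> is only symmetric, \<open>F\<close> need not be self-adjoint, and
  a compactness hypothesis on \<open>G b\<close> can be absorbed only at the right end of a product.
  The term with \<open>[F, ma]\<close>, \<open>ma\<close> the adjoint of \<open>m\<close>, has its
  absorbing factors on the left; passing to its adjoint is what brings in the adjoint of
  \<open>D\<close>. The factor \<open>b\<close> in the vectors is there because \<open>m\<close>
  must make the resolvent compact on \<open>E2\<close> as well, where only the image of
  \<open>\<pi>2\<close> does so. Algebra elements are taken as products of two: one factor makes a
  resolvent root compact, the other maps the domain of the adjoint of \<open>D\<close> into that of
  \<open>D\<close>. Gradings cause no case distinction: for odd \<open>F\<close> the graded
  commutator with \<open>T\<close> is \<open>F T - T' F\<close>, where \<open>T'\<close> is the
  conjugate of \<open>T\<close> by the grading operator, so the analytic part works with pairs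
  \<open>S\<close>, \<open>S'\<close>. The series needs two factors \<open>G\<close> per term, as
  one alone gives only the rate \<open>1/(n+1)\<close>, which is not summable. Order and square
  roots are built from norm estimates and a polynomial iteration, and polynomials in
  \<open>1 - G\<close> take the place of functional calculus.\<close>

lemma scaleC_zero_right [simp]: "c *\<^sub>C (0::'a::complex_vector) = 0"
  using scaleC_add_right[of c 0 0] by simp

lemma scaleC_zero_left [simp]: "0 *\<^sub>C (x::'a::complex_vector) = 0"
  using scaleC_add_left[of 0 0 x] by simp

lemma scaleC_minus_right [simp]: "c *\<^sub>C (- x) = - (c *\<^sub>C (x::'a::complex_vector))"
  using scaleC_add_right[of c x "-x"] by (simp add: eq_neg_iff_add_eq_0 add.commute)

lemma scaleC_minus_left [simp]: "(- c) *\<^sub>C x = - (c *\<^sub>C (x::'a::complex_vector))"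
  using scaleC_add_left[of c "-c" x] by (simp add: eq_neg_iff_add_eq_0 add.commute)

lemma scaleC_diff_right: "c *\<^sub>C (x - y) = c *\<^sub>C x - c *\<^sub>C (y::'a::complex_vector)"
  using scaleC_add_right[of c x "-y"] by simp

lemma scaleC_scaleR_commute: "c *\<^sub>C r *\<^sub>R x = r *\<^sub>R c *\<^sub>C (x::'a::complex_vector)"
  by (simp add: scaleR_scaleC scaleC_scaleC mult.commute)

lemma scaleC_module: "module (scaleC :: complex \<Rightarrow> 'a::complex_vector \<Rightarrow> 'a)"
  by unfold_locales (simp_all add: scaleC_add_right scaleC_add_left scaleC_scaleC scaleC_one)

lemmas csubspaceI = module.subspaceI[OF scaleC_module]
lemmas csubspace_0 = module.subspace_0[OF scaleC_module]
lemmas csubspace_add = module.subspace_add[OF scaleC_module]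
lemmas csubspace_scale = module.subspace_scale[OF scaleC_module]
lemmas csubspace_diff = module.subspace_diff[OF scaleC_module]
lemmas cspan_induct = module.span_induct_alt[OF scaleC_module, consumes 1, case_names base step]

context cstar_algebra
begin

lemma star_zero [simp]: "star 0 = 0"
  using star_add[of 0 0] by simp

end

lemma star_scaleR: "star (r *\<^sub>R x) = r *\<^sub>R star (x::'a::cstar_algebra)"
  by (simp add: scaleR_scaleC star_scaleC)

lemma norm_star [simp]: "norm (star x) = norm (x::'a::cstar_algebra)"
proof -
  have le: "norm x \<le> norm (star x)" for x :: 'a
  proof (cases "x = 0")
    case False
    have "norm x * norm x \<le> norm (star x) * norm x"
      using norm_mult_ineq[of "star x" x] by (simp add: cstar_identity power2_eq_square)
    then show ?thesis using False by simp
  qed simp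
  show ?thesis using le[of x] le[of "star x"] by (simp add: star_star)
qed

lemma bounded_linear_star: "bounded_linear (star :: 'a::cstar_algebra \<Rightarrow> 'a)"
  by (intro bounded_linear_intro[where K=1]) (simp_all add: star_add star_scaleR)

section \<open>The square root iteration\<close>

text \<open>The iterates converge to the solution \<open>y\<close> of \<open>2 y = k + y\<^sup>2\<close>, that is \<open>(1 - y)\<^sup>2 = 1 - k\<close>. They are
  polynomials in \<open>k\<close> with nonnegative coefficients, so that the real case \<open>k = 1\<close> majorises the rest.\<close>

primrec sqrt_iter :: "'a::real_algebra \<Rightarrow> nat \<Rightarrow> 'a" where
  "sqrt_iter k 0 = 0"
| "sqrt_iter k (Suc n) = (1/2) *\<^sub>R (k + sqrt_iter k n * sqrt_iter k n)"

text \<open>The difference of squares is split without commutativity, as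
  \<open>y (y - y0) + (y - y0) y0\<close>, so that the increments satisfy a recursion dominated in
  norm by that of the scalar sequence.\<close>

lemma sqrt_iter_diff:
  "sqrt_iter k (Suc (Suc n)) - sqrt_iter k (Suc n) = (1/2) *\<^sub>R
    (sqrt_iter k (Suc n) * (sqrt_iter k (Suc n) - sqrt_iter k n) +
     (sqrt_iter k (Suc n) - sqrt_iter k n) * sqrt_iter k n)"
proof -
  define y y0 where "y = sqrt_iter k (Suc n)" and "y0 = sqrt_iter k n"
  have "sqrt_iter k (Suc (Suc n)) - y = (1/2) *\<^sub>R (k + y * y) - (1/2) *\<^sub>R (k + y0 * y0)"
    by (simp add: y_def y0_def)
  also have "\<dots> = (1/2) *\<^sub>R (y * (y - y0) + (y - y0) * y0)"
    by (simp only: scaleR_right_diff_distrib[symmetric]) (simp add: algebra_simps)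
  finally show ?thesis unfolding y_def y0_def .
qed

abbreviation sqrt_majorant :: "nat \<Rightarrow> real" where "sqrt_majorant \<equiv> sqrt_iter 1"

lemma sqrt_majorant_nonneg: "0 \<le> sqrt_majorant n"
  by (induction n) auto

lemma sqrt_majorant_le_1: "sqrt_majorant n \<le> 1"
proof (induction n)
  case (Suc n)
  then show ?case using mult_le_one[of "sqrt_majorant n" "sqrt_majorant n"] sqrt_majorant_nonneg[of n] by simp
qed simp

lemma sqrt_majorant_incseq: "incseq sqrt_majorant"
proof (rule incseq_SucI)
  show "sqrt_majorant n \<le> sqrt_majorant (Suc n)" for n
  proof (induction n)
    case (Suc n)
    then show ?case
      using mult_mono[OF Suc Suc] sqrt_majorant_nonneg[of n] sqrt_majorant_nonneg[of "Suc n"]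
      by (subst (2) sqrt_iter.simps) (subst sqrt_iter.simps, simp)
  qed simp
qed

lemma sqrt_majorant_Cauchy:
  assumes "0 < \<epsilon>" obtains N where "\<And>m n. N \<le> m \<Longrightarrow> N \<le> n \<Longrightarrow> \<bar>sqrt_majorant m - sqrt_majorant n\<bar> < \<epsilon>"
proof -
  have "convergent sqrt_majorant"
    using incseq_convergent[OF sqrt_majorant_incseq] sqrt_majorant_le_1 convergentI by metis
  then have "Cauchy sqrt_majorant" by (simp add: Cauchy_convergent_iff)
  then show ?thesis using that assms unfolding Cauchy_def dist_real_def by blast
qed

lemma sqrt_majorant_diff:
  "sqrt_majorant (Suc (Suc n)) - sqrt_majorant (Suc n) =
    (1/2) * (sqrt_majorant (Suc n) * (sqrt_majorant (Suc n) - sqrt_majorant n) +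
     (sqrt_majorant (Suc n) - sqrt_majorant n) * sqrt_majorant n)"
  using sqrt_iter_diff[of "1::real" n] by simp

lemma norm_sqrt_iter:
  fixes k :: "'a::real_normed_algebra"
  assumes "norm k \<le> 1"
  shows "norm (sqrt_iter k n) \<le> sqrt_majorant n"
proof (induction n)
  case (Suc n)
  have "norm (k + sqrt_iter k n * sqrt_iter k n) \<le> 1 + sqrt_majorant n * sqrt_majorant n"
    by (rule norm_triangle_le, rule add_mono[OF assms], rule order_trans[OF norm_mult_ineq])
       (intro mult_mono Suc, auto simp: sqrt_majorant_nonneg)
  then show ?case by simp
qed simp

text \<open>Increments are compared because they telescope: the Cauchy property is then inherited
  from a bounded increasing real sequence. This covers norm exactly 1, where the iteration map need
  not be a strict contraction.\<close>

lemma norm_sqrt_iter_diff: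
  fixes k :: "'a::real_normed_algebra"
  assumes k: "norm k \<le> 1"
  shows "norm (sqrt_iter k (Suc n) - sqrt_iter k n) \<le> sqrt_majorant (Suc n) - sqrt_majorant n"
proof (induction n)
  case 0 then show ?case using k by simp
next
  case (Suc n)
  define y y0 t t0 where "y = sqrt_iter k (Suc n)" and "y0 = sqrt_iter k n"
    and "t = sqrt_majorant (Suc n)" and "t0 = sqrt_majorant n"
  have b: "norm y \<le> t" "norm y0 \<le> t0" "norm (y - y0) \<le> t - t0" "0 \<le> t" "0 \<le> t0" "t0 \<le> t"
    using norm_sqrt_iter[OF k, of "Suc n"] norm_sqrt_iter[OF k, of n] Suc sqrt_majorant_nonneg[of n]
      sqrt_majorant_nonneg[of "Suc n"] incseq_SucD[OF sqrt_majorant_incseq, of n]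
    unfolding y_def y0_def t_def t0_def by (simp_all del: sqrt_iter.simps)
  have "norm (y * (y - y0) + (y - y0) * y0) \<le> t * (t - t0) + (t - t0) * t0"
    by (rule norm_triangle_le, intro add_mono; rule order_trans[OF norm_mult_ineq])
       (use b in \<open>auto intro!: mult_mono\<close>)
  then show ?case
    unfolding sqrt_iter_diff[of k] sqrt_majorant_diff norm_scaleR unfolding y_def y0_def t_def t0_def by simp
qed

text \<open>Formally \<open>(1 - y)^2 = 1 - h\<close>, written without a unit. Only the norm and the
  self-adjointness of \<open>h\<close> enter, so it is available before any order on the algebra has
  been constructed.\<close>

lemma cstar_quasi_sqrt:
  fixes h :: "'a::cstar_algebra"
  assumes h: "norm h \<le> 1" "star h = h"
  obtains y where "star y = y" "2 *\<^sub>R y - y * y = h"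
proof -
  have inc: "norm (sqrt_iter h (n + m) - sqrt_iter h n) \<le> sqrt_majorant (n + m) - sqrt_majorant n" for n m
  proof (induction m)
    case (Suc m)
    have "norm (sqrt_iter h (n + Suc m) - sqrt_iter h n)
      \<le> norm (sqrt_iter h (Suc (n + m)) - sqrt_iter h (n + m)) + norm (sqrt_iter h (n + m) - sqrt_iter h n)"
      using norm_triangle_ineq[of "sqrt_iter h (Suc (n + m)) - sqrt_iter h (n + m)" "sqrt_iter h (n + m) - sqrt_iter h n"]
      by (simp del: sqrt_iter.simps)
    then show ?case using Suc norm_sqrt_iter_diff[OF h(1), of "n + m"] by (simp del: sqrt_iter.simps)
  qed simp
  have "Cauchy (sqrt_iter h)"
  proof (rule CauchyI')
    fix \<epsilon> :: real assume "0 < \<epsilon>"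
    then obtain N where N: "\<And>m n. N \<le> m \<Longrightarrow> N \<le> n \<Longrightarrow> \<bar>sqrt_majorant m - sqrt_majorant n\<bar> < \<epsilon>"
      using sqrt_majorant_Cauchy by blast
    show "\<exists>M. \<forall>m\<ge>M. \<forall>n>m. dist (sqrt_iter h m) (sqrt_iter h n) < \<epsilon>"
    proof (intro exI[of _ N] allI impI)
      fix m n assume mn: "N \<le> m" "m < n"
      then have "norm (sqrt_iter h n - sqrt_iter h m) \<le> sqrt_majorant n - sqrt_majorant m"
        using inc[of m "n - m"] by simp
      moreover have "sqrt_majorant n - sqrt_majorant m < \<epsilon>"
        using N[of n m] mn by simp
      ultimately show "dist (sqrt_iter h m) (sqrt_iter h n) < \<epsilon>" by (simp add: dist_norm norm_minus_commute)
    qed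
  qed
  then obtain y where y: "sqrt_iter h \<longlonglongrightarrow> y" using Cauchy_convergent convergent_def by blast
  have "(\<lambda>n. sqrt_iter h (Suc n)) \<longlonglongrightarrow> (1/2) *\<^sub>R (h + y * y)"
    unfolding sqrt_iter.simps by (intro tendsto_intros y)
  then have "y = (1/2) *\<^sub>R (h + y * y)" using LIMSEQ_Suc[OF y] LIMSEQ_unique by blast
  then have eq: "2 *\<^sub>R y = h + y * y" by (metis scaleR_2 scaleR_half_double scaleR_right_distrib)
  have "star (sqrt_iter h n) = sqrt_iter h n" for n
    by (induction n) (simp_all add: star_scaleR star_add star_mult h)
  then have "sqrt_iter h \<longlonglongrightarrow> star y"
    using bounded_linear.tendsto[OF bounded_linear_star y] by simp
  then have "star y = y" using y LIMSEQ_unique by blast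
  then show ?thesis using eq that by simp
qed

section \<open>The algebra of linear endomorphisms\<close>

text \<open>Turning linear maps into a type lets operator identities be computed with the ring
  classes. Norm bounds and adjoints depend on the value of the module record and therefore remain
  predicates.\<close>

typedef (overloaded) 'e endo = "{f :: 'e::complex_vector \<Rightarrow> 'e.
    (\<forall>x y. f (x + y) = f x + f y) \<and> (\<forall>c x. f (c *\<^sub>C x) = c *\<^sub>C f x)}"
  morphisms app Endo
  by (rule exI[of _ "\<lambda>x. x"]) simp

notation app (infixr "\<cdot>" 75)

setup_lifting type_definition_endo

lemma endo_eqI: "(\<And>x. S \<cdot> x = T \<cdot> x) \<Longrightarrow> S = T"
  by transfer auto

lemma app_add [simp]: "T \<cdot> (x + y) = T \<cdot> x + T \<cdot> y"
  by transfer auto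

lemma app_scaleC [simp]: "T \<cdot> (c *\<^sub>C x) = c *\<^sub>C T \<cdot> x"
  by transfer auto

lemma app_scaleR [simp]: "T \<cdot> (r *\<^sub>R x) = r *\<^sub>R T \<cdot> x"
  by (simp add: scaleR_scaleC)

lemma app_zero [simp]: "T \<cdot> 0 = 0"
  using app_add[of T 0 0] by simp

lemma app_minus [simp]: "T \<cdot> (- x) = - (T \<cdot> x)"
  using app_add[of T x "-x"] by (simp add: eq_neg_iff_add_eq_0 add.commute)

lemma app_diff [simp]: "T \<cdot> (x - y) = T \<cdot> x - T \<cdot> y"
  using app_add[of T x "-y"] by simp

lemma app_sum: "T \<cdot> (\<Sum>i\<in>A. f i) = (\<Sum>i\<in>A. T \<cdot> f i)"
  by (induction A rule: infinite_finite_induct) auto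

instantiation endo :: (complex_vector) "{complex_vector, real_algebra, monoid_mult}"
begin

lift_definition zero_endo :: "'a endo" is "\<lambda>x. 0" by simp
lift_definition one_endo :: "'a endo" is "\<lambda>x. x" by simp
lift_definition plus_endo :: "'a endo \<Rightarrow> 'a endo \<Rightarrow> 'a endo" is "\<lambda>S T x. S x + T x"
  by (auto simp: scaleC_add_right)
lift_definition minus_endo :: "'a endo \<Rightarrow> 'a endo \<Rightarrow> 'a endo" is "\<lambda>S T x. S x - T x"
  by (auto simp: scaleC_diff_right)
lift_definition uminus_endo :: "'a endo \<Rightarrow> 'a endo" is "\<lambda>S x. - S x"
  by auto
lift_definition times_endo :: "'a endo \<Rightarrow> 'a endo \<Rightarrow> 'a endo" is "\<lambda>S T x. S (T x)"
  by auto
lift_definition scaleC_endo :: "complex \<Rightarrow> 'a endo \<Rightarrow> 'a endo" is "\<lambda>c S x. c *\<^sub>C S x"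
  by (auto simp: scaleC_add_right scaleC_scaleC mult.commute)
definition scaleR_endo :: "real \<Rightarrow> 'a endo \<Rightarrow> 'a endo" where
  "scaleR_endo r = scaleC (complex_of_real r)"

instance
proof
  fix r :: real and c d :: complex and S T U :: "'a endo"
  show "(*\<^sub>R) r = ((*\<^sub>C) (complex_of_real r) :: 'a endo \<Rightarrow> _)" by (simp add: scaleR_endo_def)
  show "c *\<^sub>C (S + T) = c *\<^sub>C S + c *\<^sub>C T" by transfer (simp add: scaleC_add_right fun_eq_iff)
  show "(c + d) *\<^sub>C S = c *\<^sub>C S + d *\<^sub>C S" by transfer (simp add: scaleC_add_left fun_eq_iff)
  show "c *\<^sub>C d *\<^sub>C S = (c * d) *\<^sub>C S" by transfer (simp add: scaleC_scaleC fun_eq_iff)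
  show "1 *\<^sub>C S = S" by transfer (simp add: scaleC_one fun_eq_iff)
  show "r *\<^sub>R (S + T) = r *\<^sub>R S + r *\<^sub>R T" unfolding scaleR_endo_def
    by transfer (simp add: scaleC_add_right fun_eq_iff)
  show "(r + s) *\<^sub>R S = r *\<^sub>R S + s *\<^sub>R S" for s unfolding scaleR_endo_def
    by transfer (simp add: scaleC_add_left fun_eq_iff)
  show "r *\<^sub>R s *\<^sub>R S = (r * s) *\<^sub>R S" for s unfolding scaleR_endo_def
    by transfer (simp add: scaleC_scaleC fun_eq_iff)
  show "1 *\<^sub>R S = S" unfolding scaleR_endo_def by transfer (simp add: scaleC_one fun_eq_iff)
  show "r *\<^sub>R S * T = r *\<^sub>R (S * T)" "S * r *\<^sub>R T = r *\<^sub>R (S * T)"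
    unfolding scaleR_endo_def by (transfer, simp add: fun_eq_iff)+
  show "S * T * U = S * (T * U)" "1 * S = S" "S * 1 = S" "(S + T) * U = S * U + T * U"
    "S * (T + U) = S * T + S * U" "S + T + U = S + (T + U)" "S + T = T + S" "0 + S = S"
    "- S + S = 0" "S - T = S + - T"
    by (transfer, simp add: fun_eq_iff)+
qed

end

lemma endo_app [simp]:
  "0 \<cdot> x = 0" "1 \<cdot> x = x" "(S + T) \<cdot> x = S \<cdot> x + T \<cdot> x" "(S - T) \<cdot> x = S \<cdot> x - T \<cdot> x"
  "(- S) \<cdot> x = - (S \<cdot> x)" "(S * T) \<cdot> x = S \<cdot> T \<cdot> x" "(c *\<^sub>C S) \<cdot> x = c *\<^sub>C S \<cdot> x"
  by (transfer, simp)+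

lemma endo_app_scaleR [simp]: "(r *\<^sub>R S) \<cdot> x = r *\<^sub>R S \<cdot> x"
  by (simp add: scaleR_scaleC)

lemma scaleC_mult_endo [simp]:
  "c *\<^sub>C S * T = c *\<^sub>C (S * T)" "S * c *\<^sub>C T = c *\<^sub>C (S * (T :: 'a::complex_vector endo))"
  by (simp_all add: endo_eqI)

lemma app_Endo:
  assumes "\<And>x y. f (x + y) = f x + f y" "\<And>c x. f (c *\<^sub>C x) = c *\<^sub>C f x"
  shows "app (Endo f) = f"
  using assms by (simp add: Endo_inverse)

section \<open>Operators on inner product modules\<close>

lemma sqrt_iter_intertwine:
  fixes A :: "'a::real_algebra"
  assumes "A * K = L * A" shows "A * sqrt_iter K n = sqrt_iter L n * A"
proof (induction n)
  case (Suc n)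
  have "A * (sqrt_iter K n * sqrt_iter K n) = sqrt_iter L n * sqrt_iter L n * A"
    by (simp only: mult.assoc[symmetric] Suc) (simp only: mult.assoc Suc)
  then show ?case by (simp add: distrib_left distrib_right assms)
qed simp

text \<open>Positivity of \<open>ip E x x\<close> is left out on purpose: it becomes available, as
  \<open>nonneg_element\<close>, only after the order of the coefficient algebra has been derived
  from an instance of this locale.\<close>

locale inner_module =
  fixes E :: "('e::complex_vector, 'b::cstar_algebra) hmodule"
  assumes act_add_left: "act E (x + y) b = act E x b + act E y b"
    and act_add_right: "act E x (b + b') = act E x b + act E x b'"
    and act_scaleC_left: "act E (c *\<^sub>C x) b = c *\<^sub>C act E x b"
    and act_scaleC_right: "act E x (c *\<^sub>C b) = c *\<^sub>C act E x b"
    and act_mult: "act E x (b * b') = act E (act E x b) b'"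
    and ip_add_right: "ip E x (y + z) = ip E x y + ip E x z"
    and ip_scaleC_right: "ip E x (c *\<^sub>C y) = c *\<^sub>C ip E x y"
    and ip_act_right: "ip E x (act E y b) = ip E x y * b"
    and ip_star: "star (ip E x y) = ip E y x"
    and ip_definite: "ip E x x = 0 \<Longrightarrow> x = 0"
    and complete: "(\<And>\<epsilon>. \<epsilon> > 0 \<Longrightarrow> \<exists>N. \<forall>m\<ge>N. \<forall>n\<ge>N. hnorm E (s m - s n) < \<epsilon>) \<Longrightarrow> \<exists>x. hlim E s x"

definition adjoint_pair :: "('e::complex_vector, 'b) hmodule \<Rightarrow> 'e endo \<Rightarrow> 'e endo \<Rightarrow> bool"
  where "adjoint_pair E S T \<longleftrightarrow> (\<forall>x y. ip E (S \<cdot> x) y = ip E x (T \<cdot> y))"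

definition bounded_by :: "('e::complex_vector, 'b::cstar_algebra) hmodule \<Rightarrow> real \<Rightarrow> 'e endo \<Rightarrow> bool"
  where "bounded_by E K T \<longleftrightarrow> (\<forall>x. hnorm E (T \<cdot> x) \<le> K * hnorm E x)"

definition bounded_endo :: "('e::complex_vector, 'b::cstar_algebra) hmodule \<Rightarrow> 'e endo \<Rightarrow> bool"
  where "bounded_endo E T \<longleftrightarrow> (\<exists>K\<ge>0. bounded_by E K T)"

definition strong_limit :: "('e::complex_vector, 'b::cstar_algebra) hmodule \<Rightarrow> (nat \<Rightarrow> 'e endo) \<Rightarrow> 'e endo \<Rightarrow> bool"
  where "strong_limit E s T \<longleftrightarrow> (\<forall>x. hlim E (\<lambda>n. s n \<cdot> x) (T \<cdot> x))"

lemma adjoint_pairD: "adjoint_pair E S T \<Longrightarrow> ip E (S \<cdot> x) y = ip E x (T \<cdot> y)"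
  by (simp add: adjoint_pair_def)

lemma bounded_byD: "bounded_by E K T \<Longrightarrow> hnorm E (T \<cdot> x) \<le> K * hnorm E x"
  by (simp add: bounded_by_def)

context inner_module
begin

section \<open>Inner products, norms, adjoint pairs and operator bounds\<close>

lemma ip_zero_right [simp]: "ip E x 0 = 0"
  using ip_add_right[of x 0 0] by simp

lemma ip_minus_right [simp]: "ip E x (- y) = - ip E x y"
  using ip_add_right[of x y "-y"] by (simp add: eq_neg_iff_add_eq_0 add.commute)

lemma ip_diff_right: "ip E x (y - z) = ip E x y - ip E x z"
  using ip_add_right[of x y "-z"] by simp

lemma ip_add_left: "ip E (x + y) z = ip E x z + ip E y z"
  by (metis ip_star ip_add_right star_add)

lemma ip_scaleC_left: "ip E (c *\<^sub>C x) y = cnj c *\<^sub>C ip E x y"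
  by (metis ip_star ip_scaleC_right star_scaleC)

lemma ip_zero_left [simp]: "ip E 0 x = 0"
  using ip_add_left[of 0 0 x] by simp

lemma ip_minus_left [simp]: "ip E (- x) y = - ip E x y"
  using ip_add_left[of x "-x" y] by (simp add: eq_neg_iff_add_eq_0 add.commute)

lemma ip_diff_left: "ip E (x - y) z = ip E x z - ip E y z"
  using ip_add_left[of x "-y" z] by simp

lemma ip_scaleR_right [simp]: "ip E x (r *\<^sub>R y) = r *\<^sub>R ip E x y"
  by (simp add: scaleR_scaleC ip_scaleC_right)

lemma ip_scaleR_left [simp]: "ip E (r *\<^sub>R x) y = r *\<^sub>R ip E x y"
  by (simp add: scaleR_scaleC ip_scaleC_left)

lemma ip_act_left: "ip E (act E x b) y = star b * ip E x y"
  by (metis ip_star ip_act_right star_mult)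

lemma ip_sum_right: "ip E x (\<Sum>i\<in>A. f i) = (\<Sum>i\<in>A. ip E x (f i))"
  by (induction A rule: infinite_finite_induct) (auto simp: ip_add_right)

lemma ip_sum_left: "ip E (\<Sum>i\<in>A. f i) x = (\<Sum>i\<in>A. ip E (f i) x)"
  by (induction A rule: infinite_finite_induct) (auto simp: ip_add_left)

lemma ip_nondegenerate: "(\<And>z. ip E z x = ip E z y) \<Longrightarrow> x = y"
  using ip_definite[of "x - y"] by (simp add: ip_diff_right)

lemma ip_nondegenerate_left: "(\<And>z. ip E x z = ip E y z) \<Longrightarrow> x = y"
  by (rule ip_nondegenerate) (metis ip_star)

lemma act_zero_left [simp]: "act E 0 b = 0"
  using act_add_left[of 0 0 b] by simp

lemma act_diff_right: "act E x (b - b') = act E x b - act E x b'"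
  by (rule ip_nondegenerate) (simp add: ip_act_right ip_diff_right right_diff_distrib)

lemma hnorm_nonneg [simp]: "0 \<le> hnorm E x"
  by (simp add: hnorm_def)

lemma hnorm_power2: "(hnorm E x)\<^sup>2 = norm (ip E x x)"
  by (simp add: hnorm_def)

lemma hnorm_eq_0 [simp]: "hnorm E x = 0 \<longleftrightarrow> x = 0"
  using ip_definite by (auto simp: hnorm_def)

lemma hnorm_zero [simp]: "hnorm E 0 = 0"
  by simp

lemma hnorm_scaleC: "hnorm E (c *\<^sub>C x) = cmod c * hnorm E x"
  by (simp add: hnorm_def ip_scaleC_left ip_scaleC_right norm_scaleC real_sqrt_mult)

lemma hnorm_scaleR [simp]: "hnorm E (r *\<^sub>R x) = \<bar>r\<bar> * hnorm E x"
  by (simp add: scaleR_scaleC hnorm_scaleC)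

lemma hnorm_minus [simp]: "hnorm E (- x) = hnorm E x"
  by (simp add: hnorm_def)

lemma hnorm_minus_commute: "hnorm E (x - y) = hnorm E (y - x)"
  using hnorm_minus[of "x - y"] by simp

lemma hnorm_le_power2: "0 \<le> K \<Longrightarrow> norm (ip E x x) \<le> K\<^sup>2 \<Longrightarrow> hnorm E x \<le> K"
  using power2_le_imp_le[of "hnorm E x" K] by (simp add: hnorm_power2)

lemma hnorm_act_le: "hnorm E (act E x b) \<le> hnorm E x * norm b"
proof (rule hnorm_le_power2)
  have "norm (star b * (ip E x x * b)) \<le> norm b * (norm (ip E x x) * norm b)"
    using norm_mult_ineq[of "star b" "ip E x x * b"] norm_mult_ineq[of "ip E x x" b]
      mult_left_mono[of "norm (ip E x x * b)" _ "norm b"] by (fastforce intro: order_trans)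
  then show "norm (ip E (act E x b) (act E x b)) \<le> (hnorm E x * norm b)\<^sup>2"
    by (simp add: ip_act_left ip_act_right power_mult_distrib hnorm_power2) (simp add: power2_eq_square algebra_simps)
qed simp

lemma adjoint_pair_sym: "adjoint_pair E S T \<Longrightarrow> adjoint_pair E T S"
  unfolding adjoint_pair_def by (metis ip_star)

lemma adjoint_pair_unique: "adjoint_pair E S T \<Longrightarrow> adjoint_pair E S T' \<Longrightarrow> T = T'"
  by (rule endo_eqI, rule ip_nondegenerate) (metis adjoint_pair_def)

lemma adjoint_pair_0: "adjoint_pair E 0 0"
  by (simp add: adjoint_pair_def)

lemma adjoint_pair_1: "adjoint_pair E 1 1"
  by (simp add: adjoint_pair_def)

lemma adjoint_pair_add: "adjoint_pair E S S' \<Longrightarrow> adjoint_pair E T T' \<Longrightarrow> adjoint_pair E (S + T) (S' + T')"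
  by (simp add: adjoint_pair_def ip_add_left ip_add_right)

lemma adjoint_pair_diff: "adjoint_pair E S S' \<Longrightarrow> adjoint_pair E T T' \<Longrightarrow> adjoint_pair E (S - T) (S' - T')"
  by (simp add: adjoint_pair_def ip_diff_left ip_diff_right)

lemma adjoint_pair_minus: "adjoint_pair E S S' \<Longrightarrow> adjoint_pair E (- S) (- S')"
  by (simp add: adjoint_pair_def)

lemma adjoint_pair_mult: "adjoint_pair E S S' \<Longrightarrow> adjoint_pair E T T' \<Longrightarrow> adjoint_pair E (S * T) (T' * S')"
  by (simp add: adjoint_pair_def)

lemma adjoint_pair_scaleR: "adjoint_pair E S S' \<Longrightarrow> adjoint_pair E (r *\<^sub>R S) (r *\<^sub>R S')"
  by (simp add: adjoint_pair_def)

lemma adjoint_pair_scaleC: "adjoint_pair E S S' \<Longrightarrow> adjoint_pair E (c *\<^sub>C S) (cnj c *\<^sub>C S')"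
  by (simp add: adjoint_pair_def ip_scaleC_left ip_scaleC_right)

lemma adjoint_pair_power: "adjoint_pair E S S' \<Longrightarrow> adjoint_pair E (S ^ n) (S' ^ n)"
proof (induction n)
  case (Suc n)
  then show ?case using adjoint_pair_mult[of S S' "S ^ n" "S' ^ n"] by (simp only: power_Suc power_commutes simp_thms)
qed (simp add: adjoint_pair_1)

lemmas adjoint_pair_intros = adjoint_pair_0 adjoint_pair_1 adjoint_pair_add adjoint_pair_diff adjoint_pair_minus
  adjoint_pair_mult adjoint_pair_scaleR adjoint_pair_scaleC adjoint_pair_power

lemma self_adjoint_mult_commute:
  "adjoint_pair E S S \<Longrightarrow> adjoint_pair E T T \<Longrightarrow> S * T = T * S \<Longrightarrow> adjoint_pair E (S * T) (S * T)"
  using adjoint_pair_mult[of S S T T] by simp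

lemma adjoint_pair_sqrt_iter: "adjoint_pair E K K \<Longrightarrow> adjoint_pair E (sqrt_iter K n) (sqrt_iter K n)"
  by (induction n) (auto intro!: adjoint_pair_intros)

lemma bounded_by_mono: "bounded_by E K T \<Longrightarrow> K \<le> L \<Longrightarrow> bounded_by E L T"
  unfolding bounded_by_def by (meson hnorm_nonneg mult_right_mono order_trans)

lemma bounded_by_mult: "0 \<le> K \<Longrightarrow> bounded_by E K S \<Longrightarrow> bounded_by E L T \<Longrightarrow> bounded_by E (K * L) (S * T)"
  unfolding bounded_by_def by (auto simp: mult.assoc intro: order_trans[OF _ mult_left_mono])

lemma bounded_by_scaleR: "bounded_by E K S \<Longrightarrow> bounded_by E (\<bar>r\<bar> * K) (r *\<^sub>R S)"
  unfolding bounded_by_def by (auto simp: mult.assoc intro: mult_left_mono)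

lemma bounded_by_minus: "bounded_by E K S \<Longrightarrow> bounded_by E K (- S)"
  unfolding bounded_by_def by simp

lemma bounded_by_0 [simp]: "0 \<le> K \<Longrightarrow> bounded_by E K 0"
  unfolding bounded_by_def by simp

lemma bounded_by_1 [simp]: "bounded_by E 1 1"
  unfolding bounded_by_def by simp

lemma bounded_by_power: "0 \<le> K \<Longrightarrow> bounded_by E K S \<Longrightarrow> bounded_by E (K ^ n) (S ^ n)"
  by (induction n) (auto intro: bounded_by_mult)

lemma bounded_by_scaleR_cancel: "0 < r \<Longrightarrow> bounded_by E K (r *\<^sub>R S) \<longleftrightarrow> bounded_by E (K / r) S"
  unfolding bounded_by_def by (simp add: field_simps)

lemma bounded_by_diff_commute: "bounded_by E K (S - T) \<longleftrightarrow> bounded_by E K (T - S)"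
  by (metis bounded_by_minus minus_diff_eq)

lemma bounded_by_eq_0: "(\<And>\<epsilon>. 0 < \<epsilon> \<Longrightarrow> bounded_by E \<epsilon> T) \<Longrightarrow> T = 0"
proof (rule endo_eqI)
  fix x assume "\<And>\<epsilon>. 0 < \<epsilon> \<Longrightarrow> bounded_by E \<epsilon> T"
  then have le: "hnorm E (T \<cdot> x) \<le> \<epsilon> * hnorm E x" if "0 < \<epsilon>" for \<epsilon>
    using that by (simp add: bounded_by_def)
  have "hnorm E (T \<cdot> x) \<le> 0 + \<epsilon>" if "0 < \<epsilon>" for \<epsilon>
  proof -
    have "\<epsilon> / (hnorm E x + 1) * hnorm E x \<le> \<epsilon>"
      using that by (simp add: field_simps add_increasing2 add_pos_nonneg)
    then show ?thesis using le[of "\<epsilon> / (hnorm E x + 1)"] that by (simp add: add_pos_nonneg add_nonneg_pos)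
  qed
  then have "hnorm E (T \<cdot> x) \<le> 0" by (rule field_le_epsilon)
  then have "hnorm E (T \<cdot> x) = 0" using hnorm_nonneg[of "T \<cdot> x"] by linarith
  then show "T \<cdot> x = 0 \<cdot> x" by simp
qed

lemma bounded_endoE:
  assumes "bounded_endo E T" obtains K where "0 \<le> K" "bounded_by E K T"
  using assms unfolding bounded_endo_def by blast

lemma bounded_byI_endo: "bounded_by E K T \<Longrightarrow> bounded_endo E T"
  unfolding bounded_endo_def by (rule exI[of _ "max K 0"]) (auto intro: bounded_by_mono)

lemma bounded_endo_mult: "bounded_endo E S \<Longrightarrow> bounded_endo E T \<Longrightarrow> bounded_endo E (S * T)"
  unfolding bounded_endo_def by (meson bounded_by_mult mult_nonneg_nonneg)

lemma bounded_endo_scaleR: "bounded_endo E S \<Longrightarrow> bounded_endo E (r *\<^sub>R S)"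
  using bounded_by_scaleR bounded_byI_endo unfolding bounded_endo_def by blast

lemma bounded_endo_minus: "bounded_endo E S \<Longrightarrow> bounded_endo E (- S)"
  using bounded_by_minus bounded_byI_endo unfolding bounded_endo_def by blast

lemma bounded_endo_0: "bounded_endo E 0"
  using bounded_byI_endo bounded_by_0[of 0] by blast

lemma bounded_endo_1: "bounded_endo E 1"
  using bounded_byI_endo bounded_by_1 by blast

lemma hlim_const [simp]: "hlim E (\<lambda>n. x) x"
  by (simp add: hlim_def)

lemma hlim_app:
  assumes "bounded_endo E T" "hlim E s x" shows "hlim E (\<lambda>n. T \<cdot> s n) (T \<cdot> x)"
proof -
  obtain K where K: "0 \<le> K" "bounded_by E K T" using assms(1) by (rule bounded_endoE)
  have "(\<lambda>n. hnorm E (T \<cdot> s n - T \<cdot> x)) \<longlonglongrightarrow> 0"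
  proof (rule tendsto_sandwich[OF _ _ tendsto_const])
    show "(\<lambda>n. K * hnorm E (s n - x)) \<longlonglongrightarrow> 0"
      using tendsto_mult_right_zero assms(2) unfolding hlim_def by blast
    show "\<forall>\<^sub>F n in sequentially. hnorm E (T \<cdot> s n - T \<cdot> x) \<le> K * hnorm E (s n - x)"
      using bounded_byD[OF K(2)] by (simp flip: app_diff)
  qed simp
  then show ?thesis unfolding hlim_def .
qed

end

lemma (in inner_module) hdense_seq:
  assumes "hdense E S" obtains s where "\<And>n. s n \<in> S" "hlim E s x"
proof -
  have "\<forall>n. \<exists>y\<in>S. hnorm E (x - y) < inverse (real (Suc n))"
    using assms unfolding hdense_def by simp
  then obtain s where s: "\<And>n. s n \<in> S" "\<And>n. hnorm E (x - s n) < inverse (real (Suc n))" by metis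
  have "(\<lambda>n. hnorm E (s n - x)) \<longlonglongrightarrow> 0"
  proof (rule tendsto_sandwich[OF _ _ tendsto_const])
    show "\<forall>\<^sub>F n in sequentially. hnorm E (s n - x) \<le> inverse (real (Suc n))"
      using s(2) hnorm_minus_commute by (simp add: less_imp_le)
  qed (use LIMSEQ_inverse_real_of_nat in simp_all)
  then show ?thesis using s(1) that unfolding hlim_def by blast
qed

text \<open>
  The Cauchy-Schwarz inequality is an axiom of this locale, because for a Hilbert module its proof needs the
  order structure of the coefficient algebra. That order is obtained from the operators on the algebra as a
  module over itself, for which the inequality is trivial.
\<close>

locale cs_module = inner_module E for E :: "('e::complex_vector, 'b::cstar_algebra) hmodule" +
  assumes cauchy_schwarz: "norm (ip E x y) \<le> hnorm E x * hnorm E y"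
begin

lemma hnorm_triangle: "hnorm E (x + y) \<le> hnorm E x + hnorm E y"
proof (rule hnorm_le_power2)
  have "norm (ip E (x + y) (x + y)) \<le> norm (ip E x x) + norm (ip E x y) + (norm (ip E y x) + norm (ip E y y))"
    unfolding ip_add_left ip_add_right
    using norm_triangle_ineq[of "ip E x x + ip E y x" "ip E x y + ip E y y"] norm_triangle_ineq[of "ip E x x" "ip E y x"]
      norm_triangle_ineq[of "ip E x y" "ip E y y"] by linarith
  then show "norm (ip E (x + y) (x + y)) \<le> (hnorm E x + hnorm E y)\<^sup>2"
    using cauchy_schwarz[of x y] cauchy_schwarz[of y x]
    by (simp add: power2_sum hnorm_power2 mult.commute[of "hnorm E y" "hnorm E x"])
qed simp

lemma hnorm_triangle_diff: "hnorm E (x - y) \<le> hnorm E x + hnorm E y"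
  using hnorm_triangle[of x "-y"] by simp

lemma hnorm_triangle_sub: "hnorm E x \<le> hnorm E (x - y) + hnorm E y"
  using hnorm_triangle[of "x - y" y] by simp

lemma hnorm_diff_abs: "\<bar>hnorm E x - hnorm E y\<bar> \<le> hnorm E (x - y)"
  using hnorm_triangle_sub[of x y] hnorm_triangle_sub[of y x] hnorm_minus_commute[of x y] by simp

lemma hlim_add: "hlim E s x \<Longrightarrow> hlim E t y \<Longrightarrow> hlim E (\<lambda>n. s n + t n) (x + y)"
  unfolding hlim_def
proof (rule tendsto_sandwich[OF _ _ tendsto_const])
  assume "(\<lambda>n. hnorm E (s n - x)) \<longlonglongrightarrow> 0" "(\<lambda>n. hnorm E (t n - y)) \<longlonglongrightarrow> 0"
  then show "(\<lambda>n. hnorm E (s n - x) + hnorm E (t n - y)) \<longlonglongrightarrow> 0" using tendsto_add by fastforce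
  show "\<forall>\<^sub>F n in sequentially. hnorm E (s n + t n - (x + y)) \<le> hnorm E (s n - x) + hnorm E (t n - y)"
    using hnorm_triangle[of "s _ - x" "t _ - y"] by (simp add: algebra_simps)
qed simp

lemma hlim_scaleC: "hlim E s x \<Longrightarrow> hlim E (\<lambda>n. c *\<^sub>C s n) (c *\<^sub>C x)"
  unfolding hlim_def scaleC_diff_right[symmetric] hnorm_scaleC by (rule tendsto_mult_right_zero)

lemma hlim_scaleR: "hlim E s x \<Longrightarrow> hlim E (\<lambda>n. r *\<^sub>R s n) (r *\<^sub>R x)"
  by (simp add: scaleR_scaleC hlim_scaleC)

lemma hlim_minus: "hlim E s x \<Longrightarrow> hlim E (\<lambda>n. - s n) (- x)"
  using hlim_scaleR[of s x "-1"] by simp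

lemma hlim_diff: "hlim E s x \<Longrightarrow> hlim E t y \<Longrightarrow> hlim E (\<lambda>n. s n - t n) (x - y)"
  using hlim_add[of s x "\<lambda>n. - t n" "- y"] hlim_minus[of t y] by simp

lemma tendsto_hnorm: "hlim E s x \<Longrightarrow> (\<lambda>n. hnorm E (s n)) \<longlonglongrightarrow> hnorm E x"
proof -
  assume "hlim E s x"
  then have "(\<lambda>n. hnorm E (s n) - hnorm E x) \<longlonglongrightarrow> 0"
    unfolding hlim_def
    by (rule Lim_null_comparison[rotated]) (use hnorm_diff_abs in auto)
  then show ?thesis using Lim_null by blast
qed

lemma hlim_unique: "hlim E s x \<Longrightarrow> hlim E s y \<Longrightarrow> x = y"
  using tendsto_hnorm[OF hlim_diff[of s x s y]] by (simp add: LIMSEQ_const_iff)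

lemma hlim_Suc: "hlim E s x \<Longrightarrow> hlim E (\<lambda>n. s (Suc n)) x"
  unfolding hlim_def using LIMSEQ_Suc by fastforce

lemma hlim_hnorm_le: "hlim E s x \<Longrightarrow> (\<And>n. hnorm E (s n) \<le> K) \<Longrightarrow> hnorm E x \<le> K"
  using tendsto_hnorm Lim_bounded by blast

lemma hlim_hnorm_mono:
  "hlim E s x \<Longrightarrow> hlim E t y \<Longrightarrow> (\<And>n. hnorm E (s n) \<le> K * hnorm E (t n)) \<Longrightarrow> hnorm E x \<le> K * hnorm E y"
  by (rule tendsto_le[OF sequentially_bot tendsto_mult[OF tendsto_const tendsto_hnorm] tendsto_hnorm]) auto

lemma tendsto_ip_left: 
  assumes "hlim E s x" shows "(\<lambda>n. ip E (s n) y) \<longlonglongrightarrow> ip E x y"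
proof -
  have "(\<lambda>n. ip E (s n) y - ip E x y) \<longlonglongrightarrow> 0"
  proof (rule Lim_null_comparison)
    show "(\<lambda>n. hnorm E (s n - x) * hnorm E y) \<longlonglongrightarrow> 0"
      using assms unfolding hlim_def by (rule tendsto_mult_left_zero)
    show "\<forall>\<^sub>F n in sequentially. norm (ip E (s n) y - ip E x y) \<le> hnorm E (s n - x) * hnorm E y"
      using cauchy_schwarz by (simp flip: ip_diff_left)
  qed
  then show ?thesis using Lim_null by blast
qed

lemma tendsto_ip_right: 
  assumes "hlim E s x" shows "(\<lambda>n. ip E y (s n)) \<longlonglongrightarrow> ip E y x"
  using bounded_linear.tendsto[OF bounded_linear_star tendsto_ip_left[OF assms, of y]] by (simp add: ip_star)

lemma hlim_Cauchy:
  assumes "\<And>m n. hnorm E (s m - s n) \<le> c m n" "\<And>\<epsilon>. 0 < \<epsilon> \<Longrightarrow> \<exists>N. \<forall>m\<ge>N. \<forall>n\<ge>N. c m n < \<epsilon>"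
  obtains x where "hlim E s x"
proof -
  have "\<exists>x. hlim E s x"
    by (rule complete) (meson assms order.strict_trans1)
  then show ?thesis using that by blast
qed

lemma hlim_imp_Cauchy:
  assumes "hlim E s x" "0 < \<epsilon>" shows "\<exists>N. \<forall>m\<ge>N. \<forall>n\<ge>N. hnorm E (s m - s n) < \<epsilon>"
proof -
  obtain N where N: "\<And>n. N \<le> n \<Longrightarrow> hnorm E (s n - x) < \<epsilon> / 2"
    using LIMSEQ_D[OF assms(1)[unfolded hlim_def], of "\<epsilon> / 2"] assms(2) by auto
  have "hnorm E (s m - s n) < \<epsilon>" if "N \<le> m" "N \<le> n" for m n
    using N[OF that(1)] N[OF that(2)] hnorm_triangle_diff[of "s m - x" "s n - x"] by simp
  then show ?thesis by blast
qed

lemma bounded_by_add: "bounded_by E K S \<Longrightarrow> bounded_by E L T \<Longrightarrow> bounded_by E (K + L) (S + T)"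
  unfolding bounded_by_def by (auto simp: distrib_right intro: order_trans[OF hnorm_triangle] add_mono)

lemma bounded_by_diff: "bounded_by E K S \<Longrightarrow> bounded_by E L T \<Longrightarrow> bounded_by E (K + L) (S - T)"
  using bounded_by_add[of K S L "- T"] bounded_by_minus by simp

lemma bounded_endo_add: "bounded_endo E S \<Longrightarrow> bounded_endo E T \<Longrightarrow> bounded_endo E (S + T)"
  by (meson bounded_by_add bounded_byI_endo bounded_endoE)

lemma bounded_endo_diff: "bounded_endo E S \<Longrightarrow> bounded_endo E T \<Longrightarrow> bounded_endo E (S - T)"
  by (meson bounded_by_diff bounded_byI_endo bounded_endoE)

lemma bounded_endo_power: "bounded_endo E S \<Longrightarrow> bounded_endo E (S ^ n)"
  by (meson bounded_by_power bounded_byI_endo bounded_endoE)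

lemmas bounded_endo_intros = bounded_endo_0 bounded_endo_1 bounded_endo_add bounded_endo_diff bounded_endo_mult
  bounded_endo_scaleR bounded_endo_minus bounded_endo_power

lemma hnorm_app_power2_le:
  assumes "adjoint_pair E S T" shows "(hnorm E (S \<cdot> x))\<^sup>2 \<le> hnorm E x * hnorm E ((T * S) \<cdot> x)"
  using cauchy_schwarz[of x "(T * S) \<cdot> x"] by (simp add: hnorm_power2 adjoint_pairD[OF assms])

lemma bounded_by_adjoint_square:
  assumes "adjoint_pair E S T" "bounded_by E (K\<^sup>2) (T * S)" "0 \<le> K" shows "bounded_by E K S"
  unfolding bounded_by_def
proof
  fix x
  have "(hnorm E (S \<cdot> x))\<^sup>2 \<le> hnorm E x * (K\<^sup>2 * hnorm E x)"
    by (rule order_trans[OF hnorm_app_power2_le[OF assms(1)]])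
      (intro mult_left_mono bounded_byD[OF assms(2)] hnorm_nonneg)
  also have "\<dots> = (K * hnorm E x)\<^sup>2" by (simp only: power_mult_distrib power2_eq_square mult_ac)
  finally show "hnorm E (S \<cdot> x) \<le> K * hnorm E x"
    by (rule power2_le_imp_le) (intro mult_nonneg_nonneg assms(3) hnorm_nonneg)
qed

lemma bounded_by_adjoint:
  assumes "adjoint_pair E S T" "bounded_by E K S" "0 \<le> K" shows "bounded_by E K T"
  unfolding bounded_by_def
proof
  fix x
  have "(hnorm E (T \<cdot> x))\<^sup>2 \<le> hnorm E x * hnorm E (S \<cdot> T \<cdot> x)"
    using hnorm_app_power2_le[OF adjoint_pair_sym[OF assms(1)], of x] by simp
  also have "\<dots> \<le> hnorm E x * (K * hnorm E (T \<cdot> x))"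
    by (intro mult_left_mono bounded_byD[OF assms(2)]) simp
  finally have "hnorm E (T \<cdot> x) * hnorm E (T \<cdot> x) \<le> (K * hnorm E x) * hnorm E (T \<cdot> x)"
    by (simp add: power2_eq_square algebra_simps)
  then show "hnorm E (T \<cdot> x) \<le> K * hnorm E x"
    using assms(3) by (cases "T \<cdot> x = 0") (auto simp: mult_le_cancel_right less_le)
qed

lemma bounded_endo_adjoint: "adjoint_pair E S T \<Longrightarrow> bounded_endo E S \<Longrightarrow> bounded_endo E T"
  unfolding bounded_endo_def using bounded_by_adjoint by blast

lemma self_adjoint_square_eq_0: "adjoint_pair E S S \<Longrightarrow> S * S = 0 \<Longrightarrow> S = 0"
proof (rule endo_eqI)
  fix x assume "adjoint_pair E S S" "S * S = 0"
  then have "(hnorm E (S \<cdot> x))\<^sup>2 \<le> 0" using hnorm_app_power2_le[of S S x] by (simp del: endo_app(6))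
  then show "S \<cdot> x = 0 \<cdot> x" by simp
qed

section \<open>Strong limits and square roots of operators\<close>

lemma strong_limit_bounded_by:
  assumes "strong_limit E s T" "\<And>n. bounded_by E K (s n)" shows "bounded_by E K T"
  unfolding bounded_by_def
proof
  show "hnorm E (T \<cdot> x) \<le> K * hnorm E x" for x
    using hlim_hnorm_le[OF assms(1)[unfolded strong_limit_def, rule_format] bounded_byD[OF assms(2)]] .
qed

lemma strong_limit_adjoint_pair:
  assumes "strong_limit E s S" "strong_limit E t T" "\<And>n. adjoint_pair E (s n) (t n)" shows "adjoint_pair E S T"
  unfolding adjoint_pair_def
proof (intro allI)
  fix x y
  have "(\<lambda>n. ip E (s n \<cdot> x) y) \<longlonglongrightarrow> ip E (S \<cdot> x) y" "(\<lambda>n. ip E x (t n \<cdot> y)) \<longlonglongrightarrow> ip E x (T \<cdot> y)"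
    using assms(1,2) unfolding strong_limit_def by (auto intro!: tendsto_ip_left tendsto_ip_right)
  then show "ip E (S \<cdot> x) y = ip E x (T \<cdot> y)"
    using LIMSEQ_unique by (simp add: adjoint_pairD[OF assms(3)])
qed

lemma strong_limit_unique: "strong_limit E s T \<Longrightarrow> strong_limit E s T' \<Longrightarrow> T = T'"
  unfolding strong_limit_def by (blast intro: endo_eqI hlim_unique)

lemma strong_limit_mult:
  assumes "strong_limit E s S" "strong_limit E t T" "\<And>n. bounded_by E K (s n)" "0 \<le> K"
  shows "strong_limit E (\<lambda>n. s n * t n) (S * T)"
  unfolding strong_limit_def
proof
  fix x
  have "hlim E (\<lambda>n. s n \<cdot> (t n \<cdot> x - T \<cdot> x)) 0"
    unfolding hlim_def diff_0_right
  proof (rule tendsto_sandwich[OF _ _ tendsto_const])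
    show "\<forall>\<^sub>F n in sequentially. hnorm E (s n \<cdot> (t n \<cdot> x - T \<cdot> x)) \<le> K * hnorm E (t n \<cdot> x - T \<cdot> x)"
      by (intro always_eventually allI bounded_byD[OF assms(3)])
    show "(\<lambda>n. K * hnorm E (t n \<cdot> x - T \<cdot> x)) \<longlonglongrightarrow> 0"
      using assms(2) unfolding strong_limit_def hlim_def by (simp add: tendsto_mult_right_zero)
  qed simp
  moreover have "hlim E (\<lambda>n. s n \<cdot> T \<cdot> x) (S \<cdot> T \<cdot> x)"
    using assms(1) unfolding strong_limit_def by blast
  ultimately show "hlim E (\<lambda>n. (s n * t n) \<cdot> x) ((S * T) \<cdot> x)"
    using hlim_add by fastforce
qed

lemma bounded_by_sqrt_iter: "bounded_by E 1 K \<Longrightarrow> bounded_by E (sqrt_majorant n) (sqrt_iter K n)"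
proof (induction n)
  case (Suc n)
  then have "bounded_by E (\<bar>1/2\<bar> * (1 + sqrt_majorant n * sqrt_majorant n)) (sqrt_iter K (Suc n))"
    unfolding sqrt_iter.simps by (intro bounded_by_scaleR bounded_by_add bounded_by_mult) (auto simp: sqrt_majorant_nonneg)
  then show ?case by simp
qed simp

lemma bounded_by_sqrt_iter_diff:
  assumes K: "bounded_by E 1 K"
  shows "bounded_by E (sqrt_majorant (Suc n) - sqrt_majorant n) (sqrt_iter K (Suc n) - sqrt_iter K n)"
proof (induction n)
  case 0 then show ?case using bounded_by_scaleR[OF K, of "1/2"] by simp
next
  case (Suc n)
  have pos: "0 \<le> sqrt_majorant (Suc n) - sqrt_majorant n"
    using incseq_SucD[OF sqrt_majorant_incseq, of n] by simp
  show ?case unfolding sqrt_iter_diff[of K] sqrt_majorant_diff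
    using bounded_by_scaleR[OF bounded_by_add[OF bounded_by_mult[OF sqrt_majorant_nonneg bounded_by_sqrt_iter[OF K] Suc]
      bounded_by_mult[OF pos Suc bounded_by_sqrt_iter[OF K]]], of "1/2" "Suc n" n]
    by (simp del: sqrt_iter.simps)
qed

text \<open>The majorant controls the iterates uniformly, but the limit is formed at each vector
  separately, since \<open>endo\<close> has no norm of its own and completeness is that of the
  module. Adjoints and bounds survive strong limits.\<close>

lemma operator_sqrt_exists:
  assumes K: "bounded_by E 1 K" "adjoint_pair E K K"
  obtains Y where "strong_limit E (sqrt_iter K) Y" "adjoint_pair E Y Y" "bounded_by E 1 Y" "(1 - Y) * (1 - Y) = 1 - K"
proof -
  have inc: "bounded_by E (sqrt_majorant (n + m) - sqrt_majorant n) (sqrt_iter K (n + m) - sqrt_iter K n)" for n m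
  proof (induction m)
    case (Suc m)
    then show ?case using bounded_by_add[OF bounded_by_sqrt_iter_diff[OF K(1), of "n + m"] Suc]
      by (simp del: sqrt_iter.simps)
  qed simp
  have inc': "bounded_by E \<bar>sqrt_majorant m - sqrt_majorant n\<bar> (sqrt_iter K m - sqrt_iter K n)" for n m
  proof (cases "n \<le> m")
    case True
    then show ?thesis using inc[of n "m - n"] by (auto intro: bounded_by_mono)
  next
    case False
    then show ?thesis using inc[of m "n - m"] by (subst bounded_by_diff_commute) (auto intro: bounded_by_mono)
  qed
  have "\<exists>y. hlim E (\<lambda>n. sqrt_iter K n \<cdot> x) y" for x
  proof (rule hlim_Cauchy)
    show "hnorm E (sqrt_iter K m \<cdot> x - sqrt_iter K n \<cdot> x) \<le> \<bar>sqrt_majorant m - sqrt_majorant n\<bar> * hnorm E x" for m n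
      using bounded_byD[OF inc'] by simp
    fix \<epsilon> :: real assume "0 < \<epsilon>"
    then have "0 < \<epsilon> / (hnorm E x + 1)" by (simp add: add_nonneg_pos)
    then obtain N where N: "\<And>m n. N \<le> m \<Longrightarrow> N \<le> n \<Longrightarrow> \<bar>sqrt_majorant m - sqrt_majorant n\<bar> < \<epsilon> / (hnorm E x + 1)"
      using sqrt_majorant_Cauchy by blast
    have "\<bar>sqrt_majorant m - sqrt_majorant n\<bar> * hnorm E x < \<epsilon>" if "N \<le> m" "N \<le> n" for m n
    proof -
      have "\<bar>sqrt_majorant m - sqrt_majorant n\<bar> * hnorm E x \<le> \<bar>sqrt_majorant m - sqrt_majorant n\<bar> * (hnorm E x + 1)"
        by (simp add: mult_left_mono)
      also have "\<dots> < \<epsilon>" using N[OF that] by (subst (asm) pos_less_divide_eq) (simp_all add: add_nonneg_pos)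
      finally show ?thesis .
    qed
    then show "\<exists>N. \<forall>m\<ge>N. \<forall>n\<ge>N. \<bar>sqrt_majorant m - sqrt_majorant n\<bar> * hnorm E x < \<epsilon>" by blast
  qed blast
  then obtain f where f: "\<And>x. hlim E (\<lambda>n. sqrt_iter K n \<cdot> x) (f x)" by metis
  have "app (Endo f) = f"
  proof (rule app_Endo)
    show "f (x + y) = f x + f y" for x y
      using hlim_unique[OF f[of "x + y"]] hlim_add[OF f[of x] f[of y]] by simp
    show "f (c *\<^sub>C x) = c *\<^sub>C f x" for c x
      using hlim_unique[OF f[of "c *\<^sub>C x"]] hlim_scaleC[OF f[of x]] by simp
  qed
  then have lim: "strong_limit E (sqrt_iter K) (Endo f)" unfolding strong_limit_def using f by simp
  have bd: "bounded_by E 1 (sqrt_iter K n)" for n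
    using bounded_by_sqrt_iter[OF K(1)] sqrt_majorant_le_1 bounded_by_mono by blast
  have "Endo f = (1/2) *\<^sub>R (K + Endo f * Endo f)"
  proof (rule strong_limit_unique)
    show "strong_limit E (\<lambda>n. sqrt_iter K (Suc n)) (Endo f)"
      using lim hlim_Suc unfolding strong_limit_def by blast
    show "strong_limit E (\<lambda>n. sqrt_iter K (Suc n)) ((1/2) *\<^sub>R (K + Endo f * Endo f))"
      using strong_limit_mult[OF lim lim bd] unfolding strong_limit_def sqrt_iter.simps
      by (auto simp del: sqrt_iter.simps intro!: hlim_scaleR hlim_add)
  qed
  then have "2 *\<^sub>R Endo f = K + Endo f * Endo f" by (metis scaleR_2 scaleR_half_double scaleR_right_distrib)
  then have "(1 - Endo f) * (1 - Endo f) = 1 - K" by (simp add: algebra_simps scaleR_2)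
  moreover have "bounded_by E 1 (Endo f)" using strong_limit_bounded_by[OF lim bd] .
  moreover have "adjoint_pair E (Endo f) (Endo f)"
    using strong_limit_adjoint_pair[OF lim lim adjoint_pair_sqrt_iter[OF K(2)]] .
  ultimately show ?thesis using lim that by blast
qed

text \<open>The iterates are polynomials in their parameter, so the intertwining passes to them and
  then to the strong limit. For \<open>K = L\<close> it says that the root \<open>1 - Y\<close>
  commutes with every bounded operator commuting with its square.\<close>

lemma operator_sqrt_intertwine:
  assumes "strong_limit E (sqrt_iter K) Y" "strong_limit E (sqrt_iter L) Z" "bounded_endo E A" "A * K = L * A"
  shows "A * Y = Z * A"
proof (rule strong_limit_unique)
  show "strong_limit E (\<lambda>n. A * sqrt_iter K n) (A * Y)"
    using assms(1) hlim_app[OF assms(3)] unfolding strong_limit_def by simp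
  show "strong_limit E (\<lambda>n. A * sqrt_iter K n) (Z * A)"
    using assms(2) unfolding strong_limit_def sqrt_iter_intertwine[OF assms(4)] by simp
qed

end

section \<open>Positive operators\<close>

text \<open>The spectrum-free criterion: a self-adjoint operator is positive exactly when it lies
  within \<open>t\<close> of \<open>t\<close> times the identity for some \<open>t\<close>. In this
  form sums are immediate, and the square root iteration applies after scaling.\<close>

definition positive_endo :: "('e::complex_vector, 'b::cstar_algebra) hmodule \<Rightarrow> 'e endo \<Rightarrow> bool"
  where "positive_endo E T \<longleftrightarrow> adjoint_pair E T T \<and> (\<exists>t\<ge>0. bounded_by E t (t *\<^sub>R 1 - T))"

context cs_module
begin

lemma positive_endo_adjoint: "positive_endo E T \<Longrightarrow> adjoint_pair E T T"
  by (simp add: positive_endo_def)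

lemma positive_endoE:
  assumes "positive_endo E T" obtains t where "0 < t" "bounded_by E t (t *\<^sub>R 1 - T)"
proof -
  obtain t where t: "0 \<le> t" "bounded_by E t (t *\<^sub>R 1 - T)" using assms unfolding positive_endo_def by blast
  \<comment> \<open>The radius is enlarged by 1 so that later proofs may divide by it.\<close>
  have "bounded_by E (1 + t) (1 + (t *\<^sub>R 1 - T))" by (intro bounded_by_add t bounded_by_1)
  then have "bounded_by E (t + 1) ((t + 1) *\<^sub>R 1 - T)" by (simp add: algebra_simps)
  then show ?thesis using that[of "t + 1"] t by simp
qed

lemma positive_endo_bounded: "positive_endo E T \<Longrightarrow> bounded_endo E T"
proof -
  assume "positive_endo E T"
  then obtain t where t: "0 < t" "bounded_by E t (t *\<^sub>R 1 - T)" by (rule positive_endoE)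
  show ?thesis using bounded_endo_diff[OF bounded_endo_scaleR[OF bounded_endo_1, of t] bounded_byI_endo[OF t(2)]] by simp
qed

lemma positive_endo_add: "positive_endo E S \<Longrightarrow> positive_endo E T \<Longrightarrow> positive_endo E (S + T)"
proof -
  assume S: "positive_endo E S" and T: "positive_endo E T"
  obtain s where s: "0 < s" "bounded_by E s (s *\<^sub>R 1 - S)" using S by (rule positive_endoE)
  obtain t where t: "0 < t" "bounded_by E t (t *\<^sub>R 1 - T)" using T by (rule positive_endoE)
  have "bounded_by E (s + t) ((s + t) *\<^sub>R 1 - (S + T))"
    using bounded_by_add[OF s(2) t(2)] by (simp add: algebra_simps)
  then show ?thesis using S T s t unfolding positive_endo_def
    by (auto intro!: adjoint_pair_add exI[of _ "s + t"])
qed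

lemma positive_endo_scaleR: "0 \<le> r \<Longrightarrow> positive_endo E T \<Longrightarrow> positive_endo E (r *\<^sub>R T)"
proof -
  assume r: "0 \<le> r" and T: "positive_endo E T"
  obtain t where t: "0 < t" "bounded_by E t (t *\<^sub>R 1 - T)" using T by (rule positive_endoE)
  have "bounded_by E (r * t) ((r * t) *\<^sub>R 1 - r *\<^sub>R T)"
    using bounded_by_scaleR[OF t(2), of r] r by (simp add: algebra_simps)
  then show ?thesis using T t r unfolding positive_endo_def
    by (auto intro!: adjoint_pair_scaleR exI[of _ "r * t"])
qed

lemma positive_endo_diff_bound:
  "adjoint_pair E T T \<Longrightarrow> bounded_by E t T \<Longrightarrow> 0 \<le> t \<Longrightarrow> positive_endo E (t *\<^sub>R 1 - T)"
  unfolding positive_endo_def by (auto intro!: adjoint_pair_intros exI[of _ t])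

lemma positive_endo_0: "positive_endo E 0"
  unfolding positive_endo_def by (auto intro!: adjoint_pair_0 exI[of _ 0])

lemma positive_endo_1: "positive_endo E 1"
  unfolding positive_endo_def by (auto intro!: adjoint_pair_1 exI[of _ 1])

text \<open>By the choice of \<open>t\<close>, \<open>K = 1 - T / t\<close> is a contraction, and
  the root of \<open>1 - K = T / t\<close> is rescaled by the square root of \<open>t\<close>. The
  commutation clause is kept because later arguments need roots of commuting operators to
  commute.\<close>

lemma positive_endo_root:
  assumes "positive_endo E T"
  obtains Z where "positive_endo E Z" "Z * Z = T" "\<And>A. bounded_endo E A \<Longrightarrow> A * T = T * A \<Longrightarrow> A * Z = Z * A"
proof -
  obtain t where t: "0 < t" "bounded_by E t (t *\<^sub>R 1 - T)" using assms by (rule positive_endoE)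
  define K where "K = (1/t) *\<^sub>R (t *\<^sub>R 1 - T)"
  have K: "bounded_by E 1 K" "adjoint_pair E K K"
    using bounded_by_scaleR[OF t(2), of "1/t"] t(1)
    unfolding K_def by (simp, intro adjoint_pair_intros positive_endo_adjoint assms)
  obtain Y where Y: "strong_limit E (sqrt_iter K) Y" "adjoint_pair E Y Y" "bounded_by E 1 Y" "(1 - Y) * (1 - Y) = 1 - K"
    using operator_sqrt_exists[OF K] .
  define Z where "Z = sqrt t *\<^sub>R (1 - Y)"
  have "Z * Z = T" using t(1) Y(4) by (simp add: Z_def) (simp add: K_def algebra_simps)
  moreover have "positive_endo E Z"
  proof -
    have "bounded_by E (sqrt t) (sqrt t *\<^sub>R 1 - Z)"
      using bounded_by_scaleR[OF Y(3), of "sqrt t"] t(1) by (simp add: Z_def scaleR_diff_right)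
    moreover have "adjoint_pair E Z Z" unfolding Z_def by (intro adjoint_pair_intros Y)
    ultimately show ?thesis unfolding positive_endo_def using t(1) by (intro conjI exI[of _ "sqrt t"]) auto
  qed
  moreover have "A * Z = Z * A" if "bounded_endo E A" "A * T = T * A" for A
  proof -
    have "A * K = K * A" using that(2) by (simp add: K_def algebra_simps)
    from operator_sqrt_intertwine[OF Y(1) Y(1) that(1) this] show ?thesis
      by (simp add: Z_def algebra_simps)
  qed
  ultimately show ?thesis using that by blast
qed

text \<open>Because \<open>a + i c\<close> is \<open>\<surd>t\<close> times a unitary.\<close>

lemma bounded_by_sum_of_squares:
  assumes a: "adjoint_pair E a a" and c: "adjoint_pair E c c" and "a * c = c * a" "a * a + c * c = t *\<^sub>R 1" "0 \<le> t"
  shows "bounded_by E (sqrt t) a"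
proof -
  define u u' where "u = a + \<i> *\<^sub>C c" and "u' = a - \<i> *\<^sub>C c"
  have adj: "adjoint_pair E u u'"
    using adjoint_pair_add[OF a adjoint_pair_scaleC[OF c, of \<i>]] by (simp add: u_def u'_def)
  have "u' * u = a * a + c * c" "u * u' = a * a + c * c"
    using assms(3) by (simp_all add: u_def u'_def algebra_simps scaleC_add_right scaleC_diff_right scaleC_scaleC scaleC_one)
  then have "bounded_by E ((sqrt t)\<^sup>2) (u' * u)" "bounded_by E ((sqrt t)\<^sup>2) (u * u')"
    using assms(4,5) bounded_by_scaleR[OF bounded_by_1, of t] by simp_all
  then have "bounded_by E (sqrt t) u" "bounded_by E (sqrt t) u'"
    using bounded_by_adjoint_square[OF adj] bounded_by_adjoint_square[OF adjoint_pair_sym[OF adj]] assms(5) by simp_all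
  then have "bounded_by E (\<bar>1/2\<bar> * (sqrt t + sqrt t)) ((1/2) *\<^sub>R (u + u'))"
    by (intro bounded_by_scaleR bounded_by_add)
  then show ?thesis by (simp add: u_def u'_def)
qed

text \<open>For a self-adjoint contraction \<open>V\<close> the root \<open>1 - Y\<close> of
  \<open>1 - V^2\<close> commutes with \<open>V\<close>, and the two squares add up to 1. Hence
  \<open>1 - Y\<close> is a contraction, so is \<open>1 - V^2\<close>, and this is the criterion
  with \<open>t = 1\<close>.\<close>

lemma positive_endo_square:
  assumes "adjoint_pair E Z Z" "bounded_endo E Z" shows "positive_endo E (Z * Z)"
proof -
  obtain K0 where K0: "0 \<le> K0" "bounded_by E K0 Z" using assms(2) by (rule bounded_endoE)
  define K where "K = K0 + 1"
  have K: "0 < K" "bounded_by E K Z" using K0 bounded_by_mono by (auto simp: K_def)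
  define V where "V = (1/K) *\<^sub>R Z"
  have V: "bounded_by E 1 V" "adjoint_pair E V V"
    using bounded_by_scaleR[OF K(2), of "1/K"] K(1) assms(1) by (auto simp: V_def intro: adjoint_pair_scaleR)
  have VV: "bounded_by E 1 (V * V)" "adjoint_pair E (V * V) (V * V)"
    using bounded_by_mult[OF _ V(1) V(1)] adjoint_pair_mult[OF V(2) V(2)] by simp_all
  obtain Y where Y: "strong_limit E (sqrt_iter (V * V)) Y" "adjoint_pair E Y Y" "bounded_by E 1 Y"
      "(1 - Y) * (1 - Y) = 1 - V * V"
    using operator_sqrt_exists[OF VV] .
  have "V * Y = Y * V"
    by (rule operator_sqrt_intertwine[OF Y(1) Y(1) bounded_byI_endo[OF V(1)]]) (simp add: mult.assoc)
  then have "bounded_by E (sqrt 1) (1 - Y)"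
    using V(2) Y(2,4) by (intro bounded_by_sum_of_squares[of _ V]) (auto intro: adjoint_pair_intros simp: algebra_simps)
  then have "bounded_by E 1 (1 - V * V)" using bounded_by_mult[of 1 "1 - Y" 1 "1 - Y"] Y(4) by simp
  then have "positive_endo E (V * V)" unfolding positive_endo_def using VV(2) by (intro conjI exI[of _ 1]) auto
  from positive_endo_scaleR[OF _ this, of "K * K"] show ?thesis using K(1) by (simp add: V_def)
qed

text \<open>The roots \<open>d\<close> of \<open>a\<close> and \<open>c\<close> of
  \<open>t - a\<close> commute and their squares add up to \<open>t\<close>, so \<open>d\<close> has
  norm at most the square root of \<open>t\<close>.\<close>

lemma positive_endo_bounded_by:
  assumes a: "positive_endo E a" and ta: "positive_endo E (t *\<^sub>R 1 - a)" and t: "0 \<le> t"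
  shows "bounded_by E t a"
proof -
  obtain d where d: "positive_endo E d" "d * d = a" "\<And>A. bounded_endo E A \<Longrightarrow> A * a = a * A \<Longrightarrow> A * d = d * A"
    using positive_endo_root[OF a] by blast
  obtain c where c: "positive_endo E c" "c * c = t *\<^sub>R 1 - a"
    "\<And>A. bounded_endo E A \<Longrightarrow> A * (t *\<^sub>R 1 - a) = (t *\<^sub>R 1 - a) * A \<Longrightarrow> A * c = c * A"
    using positive_endo_root[OF ta] by blast
  have "a * c = c * a" by (rule c(3)[OF positive_endo_bounded[OF a]]) (simp add: algebra_simps)
  then have "c * d = d * c" using d(3)[OF positive_endo_bounded[OF c(1)]] by simp
  then have "bounded_by E (sqrt t) d"
    using d(1,2) c(1,2) t positive_endo_adjoint by (intro bounded_by_sum_of_squares[of _ c]) auto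
  from bounded_by_mult[OF _ this this] show ?thesis using t d(2) by simp
qed

text \<open>The roots \<open>p\<close>, \<open>q\<close> commute by their commutation clauses, so
  \<open>a b\<close> is the square of the self-adjoint \<open>p q\<close>.\<close>

lemma positive_endo_mult:
  assumes a: "positive_endo E a" and b: "positive_endo E b" and comm: "a * b = b * a"
  shows "positive_endo E (a * b)"
proof -
  obtain p where p: "positive_endo E p" "p * p = a" "\<And>A. bounded_endo E A \<Longrightarrow> A * a = a * A \<Longrightarrow> A * p = p * A"
    using positive_endo_root[OF a] by blast
  obtain q where q: "positive_endo E q" "q * q = b" "\<And>A. bounded_endo E A \<Longrightarrow> A * b = b * A \<Longrightarrow> A * q = q * A"
    using positive_endo_root[OF b] by blast
  have "p * b = b * p" using p(3)[OF positive_endo_bounded[OF b]] comm by simp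
  then have pq: "p * q = q * p" using q(3)[OF positive_endo_bounded[OF p(1)]] by simp
  then have "positive_endo E ((p * q) * (p * q))"
    by (intro positive_endo_square self_adjoint_mult_commute bounded_endo_mult positive_endo_bounded
        positive_endo_adjoint p(1) q(1))
  also have "(p * q) * (p * q) = p * (q * p) * q" by (simp add: mult.assoc)
  also have "\<dots> = (p * p) * (q * q)" by (simp add: mult.assoc flip: pq)
  finally show ?thesis using p(2) q(2) by simp
qed

lemma positive_endo_power: "positive_endo E a \<Longrightarrow> positive_endo E (a ^ n)"
  by (induction n) (auto simp: positive_endo_1 power_commutes intro: positive_endo_mult)

text \<open>Bernoulli's inequality for operators; the induction step adds the positive term
  \<open>n f^2\<close>. It turns boundedness of \<open>f (1 + f)^n\<close> in \<open>n\<close> into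
  a bound for \<open>n f^2\<close>.\<close>

lemma positive_endo_one_plus_power:
  assumes f: "positive_endo E f" shows "positive_endo E ((1 + f) ^ n - 1 - real n *\<^sub>R f)"
proof -
  have comm: "(1 + f) ^ n * f = f * (1 + f) ^ n" for n
    by (induction n) (simp_all add: mult.assoc distrib_left distrib_right)
  show ?thesis
  proof (induction n)
    case 0 then show ?case by (simp add: positive_endo_0)
  next
    case (Suc n)
    define w where "w = (1 + f) ^ n - 1 - real n *\<^sub>R f"
    have "w * f = f * w" by (simp add: w_def left_diff_distrib right_diff_distrib comm)
    then have "positive_endo E (w * (1 + f) + real n *\<^sub>R (f * f))"
      using Suc f unfolding w_def[symmetric]
      by (intro positive_endo_add positive_endo_mult positive_endo_scaleR positive_endo_1) (auto simp: algebra_simps)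
    moreover have "w * (1 + f) + real n *\<^sub>R (f * f) = (1 + f) ^ Suc n - 1 - real (Suc n) *\<^sub>R f"
      unfolding w_def using comm[of n] by (simp add: algebra_simps)
    ultimately show ?case by simp
  qed
qed

text \<open>The scalar function \<open>x (1 - x)^n\<close> stays below \<open>1/(n+1)\<close> on the
  unit interval. For operators, with \<open>U = 1 - G\<close>, the induction rests on
  \<open>1 - (n+2) G U^(n+1) = U (1 - (n+1) G U^n) + G (1 - U^(n+1))\<close>, a sum of products of
  commuting positive operators.\<close>

lemma bounded_by_decay:
  assumes G: "positive_endo E G" and U: "positive_endo E (1 - G)"
  shows "bounded_by E (1 / real (Suc n)) (G * (1 - G) ^ n)"
proof -
  define U where "U = 1 - G"
  have GU: "G * U ^ n = U ^ n * G" for n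
    using power_commuting_commutes[of U G n] by (simp add: U_def left_diff_distrib right_diff_distrib)
  have posU: "positive_endo E (U ^ n)" for n using assms by (simp add: U_def positive_endo_power)
  have one_minus: "positive_endo E (1 - U ^ n)" for n
  proof (induction n)
    case (Suc n)
    have "positive_endo E ((1 - U ^ n) + U ^ n * G)"
      using Suc posU G GU by (intro positive_endo_add positive_endo_mult) auto
    moreover have "(1 - U ^ n) + U ^ n * G = 1 - U ^ Suc n"
      unfolding power_Suc GU[symmetric] by (simp add: U_def left_diff_distrib)
    ultimately show ?case by simp
  qed (simp add: positive_endo_0)
  have pos: "positive_endo E (1 - real (Suc n) *\<^sub>R (G * U ^ n))" for n
  proof (induction n)
    case 0 then show ?case using U by simp
  next
    case (Suc n)
    have "positive_endo E (U * (1 - real (Suc n) *\<^sub>R (G * U ^ n)) + G * (1 - U ^ Suc n))"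
    proof (intro positive_endo_add positive_endo_mult Suc one_minus G)
      show "positive_endo E U" using U by (simp add: U_def)
      show "U * (1 - real (Suc n) *\<^sub>R (G * U ^ n)) = (1 - real (Suc n) *\<^sub>R (G * U ^ n)) * U"
        using GU[of n] GU[of 1]
        by (simp add: left_diff_distrib right_diff_distrib mult.assoc power_commutes) (simp add: mult.assoc[symmetric] power_commutes)
      show "G * (1 - U ^ Suc n) = (1 - U ^ Suc n) * G"
        using GU[of "Suc n"] by (simp only: left_diff_distrib right_diff_distrib mult_1_left mult_1_right)
    qed
    moreover have "U * (1 - real (Suc n) *\<^sub>R (G * U ^ n)) + G * (1 - U ^ Suc n) = 1 - real (Suc (Suc n)) *\<^sub>R (G * U ^ Suc n)"
    proof -
      have "U * (G * U ^ n) = G * U ^ Suc n" using GU[of 1] by (simp add: mult.assoc[symmetric])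
      then have "U * (1 - real (Suc n) *\<^sub>R (G * U ^ n)) + G * (1 - U ^ Suc n)
        = U + G - real (Suc n) *\<^sub>R (G * U ^ Suc n) - G * U ^ Suc n"
        by (simp only: right_diff_distrib mult_scaleR_right mult_1_right) (simp only: algebra_simps)
      also have "\<dots> = 1 - real (Suc n) *\<^sub>R (G * U ^ Suc n) - G * U ^ Suc n" by (simp add: U_def)
      also have "\<dots> = 1 - (real (Suc n) + 1) *\<^sub>R (G * U ^ Suc n)"
        unfolding scaleR_add_left by simp
      finally show ?thesis by simp
    qed
    ultimately show ?case by simp
  qed
  have "bounded_by E 1 (real (Suc n) *\<^sub>R (G * U ^ n))"
    using pos[of n] posU[of n] G GU[of n]
    by (intro positive_endo_bounded_by positive_endo_scaleR positive_endo_mult) auto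
  then show ?thesis using bounded_by_scaleR_cancel[of "real (Suc n)" 1 "G * U ^ n"] by (simp add: U_def)
qed

text \<open>
  With \<open>h = x\<^sup>* x\<close>, \<open>z = |h|\<close>, \<open>p = z - h\<close> and \<open>y = x p\<close> one has \<open>y\<^sup>* y = -e\<close> with \<open>e \<ge> 0\<close>, whereas
  \<open>y y\<^sup>*\<close> is positive. Hence \<open>y (1 + r e)\<^sup>n = (1 - r y y\<^sup>*)\<^sup>n y\<close> is bounded in \<open>n\<close> for small \<open>r > 0\<close>, which
  forces \<open>e = 0\<close>.
\<close>

lemma positive_endo_adjoint_mult:
  assumes adj: "adjoint_pair E x x'" and bd: "bounded_endo E x" shows "positive_endo E (x' * x)"
proof -
  define h where "h = x' * x"
  have bd': "bounded_endo E x'" using bounded_endo_adjoint[OF adj bd] .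
  have h: "adjoint_pair E h h" "bounded_endo E h"
    unfolding h_def by (intro adjoint_pair_mult adjoint_pair_sym[OF adj] adj) (intro bounded_endo_mult bd bd')
  obtain z where z: "positive_endo E z" "z * z = h * h"
      "\<And>A. bounded_endo E A \<Longrightarrow> A * (h * h) = h * h * A \<Longrightarrow> A * z = z * A"
    using positive_endo_root[OF positive_endo_square[OF h]] by blast
  have hz: "h * z = z * h" using z(3)[OF h(2)] by (simp add: mult.assoc)
  obtain s where s: "positive_endo E s" "s * s = z" "\<And>A. bounded_endo E A \<Longrightarrow> A * z = z * A \<Longrightarrow> A * s = s * A"
    using positive_endo_root[OF z(1)] by blast
  have hs: "h * s = s * h" using s(3)[OF h(2) hz] .
  define p where "p = z - h"
  have p: "adjoint_pair E p p" "bounded_endo E p"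
    unfolding p_def using positive_endo_adjoint[OF z(1)] positive_endo_bounded[OF z(1)]
    by (auto intro: adjoint_pair_diff bounded_endo_diff h)
  have sp: "s * p = p * s" using hs s(2) by (simp add: p_def left_diff_distrib right_diff_distrib) (simp add: mult.assoc flip: s(2))
  have zp: "z * p = p * z" using hz by (simp add: p_def left_diff_distrib right_diff_distrib)
  \<comment> \<open>Because \<open>h z - h^2 = z h - z^2\<close>. So \<open>h\<close> acts as
    \<open>-z\<close> on the range of \<open>p\<close>, which is the candidate for twice the
    negative part of \<open>h\<close>.\<close>
  have hp: "h * p = - (z * p)" using hz z(2) by (simp add: p_def right_diff_distrib)
  define k where "k = s * p"
  have k: "adjoint_pair E k k" "bounded_endo E k"
    unfolding k_def using self_adjoint_mult_commute[OF positive_endo_adjoint[OF s(1)] p(1) sp]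
      bounded_endo_mult[OF positive_endo_bounded[OF s(1)] p(2)] by auto
  define e where "e = k * k"
  have e: "positive_endo E e" unfolding e_def by (intro positive_endo_square k)
  have "e = s * (p * s) * p" by (simp add: e_def k_def mult.assoc)
  also have "\<dots> = z * p * p" by (simp add: mult.assoc flip: sp s(2))
  finally have e_eq: "e = z * p * p" .
  define y y' where "y = x * p" and "y' = p * x'"
  have y: "adjoint_pair E y y'" "bounded_endo E y" "bounded_endo E y'"
    unfolding y_def y'_def using adj p bd bd' by (auto intro!: adjoint_pair_mult bounded_endo_mult)
  have "y' * y = p * (h * p)" by (simp add: y_def y'_def h_def mult.assoc)
  also have "\<dots> = - e" by (simp add: hp e_eq zp mult.assoc)
  finally have y'y: "y' * y = - e" .
  define q where "q = y * y'"
  have q: "positive_endo E q"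
  proof -
    \<comment> \<open>Real and imaginary part of \<open>y\<close>:
      \<open>y y' + y' y = 2 \<alpha>^2 + 2 \<beta>^2\<close>. As \<open>y' y = -e\<close>,
      \<open>q\<close> is this sum of squares plus \<open>e\<close>.\<close>
    define \<alpha> \<beta> where "\<alpha> = (1/2) *\<^sub>R (y + y')" and "\<beta> = (1/2) *\<^sub>R (- \<i>) *\<^sub>C (y - y')"
    have adj': "adjoint_pair E \<alpha> \<alpha>" 
      unfolding \<alpha>_def using adjoint_pair_add[OF y(1) adjoint_pair_sym[OF y(1)]]
      by (intro adjoint_pair_scaleR) (simp add: add.commute)
    have "cnj (- \<i>) *\<^sub>C (y' - y) = (- \<i>) *\<^sub>C (y - y')" by (simp add: scaleC_diff_right)
    then have adj'': "adjoint_pair E \<beta> \<beta>" 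
      unfolding \<beta>_def using adjoint_pair_scaleC[OF adjoint_pair_diff[OF y(1) adjoint_pair_sym[OF y(1)]], of "- \<i>"]
      by (intro adjoint_pair_scaleR) simp
    have bd\<beta>: "bounded_endo E \<beta>"
    proof -
      have "bounded_endo E (y - y')" using y by (intro bounded_endo_diff)
      then have "bounded_endo E ((- \<i>) *\<^sub>C (y - y'))"
        unfolding bounded_endo_def bounded_by_def by (simp add: hnorm_scaleC)
      then show ?thesis unfolding \<beta>_def by (rule bounded_endo_scaleR)
    qed
    have "positive_endo E (2 *\<^sub>R (\<alpha> * \<alpha>) + 2 *\<^sub>R (\<beta> * \<beta>) + e)"
      using adj' adj'' y e bd\<beta>
      by (intro positive_endo_add positive_endo_scaleR positive_endo_square) (auto simp: \<alpha>_def intro!: bounded_endo_intros)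
    moreover have "2 *\<^sub>R (\<alpha> * \<alpha>) + 2 *\<^sub>R (\<beta> * \<beta>) = y * y' + y' * y"
    proof -
      have "\<beta> * \<beta> = - ((1/4) *\<^sub>R ((y - y') * (y - y')))" 
        by (simp add: \<beta>_def scaleC_scaleR_commute scaleC_scaleC scaleC_one)
      then have "2 *\<^sub>R (\<alpha> * \<alpha>) + 2 *\<^sub>R (\<beta> * \<beta>) = (1/2) *\<^sub>R ((y + y') * (y + y') - (y - y') * (y - y'))"
        by (simp add: \<alpha>_def scaleR_diff_right)
      also have "(y + y') * (y + y') - (y - y') * (y - y') = 2 *\<^sub>R (y * y' + y' * y)"
        by (simp add: algebra_simps scaleR_2)
      finally show ?thesis by simp
    qed
    ultimately show ?thesis by (simp add: q_def y'y)
  qed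
  obtain t where t: "0 < t" "bounded_by E t (t *\<^sub>R 1 - q)" using q by (rule positive_endoE)
  define r where "r = 1 / t"
  have r: "0 < r" "bounded_by E 1 (1 - r *\<^sub>R q)"
    using t bounded_by_scaleR[OF t(2), of r] by (auto simp: r_def scaleR_diff_right)
  define f where "f = r *\<^sub>R e"
  have f: "positive_endo E f" using e r(1) by (simp add: f_def positive_endo_scaleR)
  have shift: "y * (1 + f) ^ n = (1 - r *\<^sub>R q) ^ n * y" for n
  proof (induction n)
    case (Suc n)
    have "y * (1 + f) = (1 - r *\<^sub>R q) * y"
    proof -
      have "q * y = - (y * e)" by (simp add: q_def mult.assoc y'y)
      then show ?thesis by (simp add: f_def algebra_simps)
    qed
    then have "y * (1 + f) ^ Suc n = (1 - r *\<^sub>R q) * (y * (1 + f) ^ n)" by (simp add: mult.assoc[symmetric])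
    then show ?case by (simp add: Suc mult.assoc)
  qed simp
  obtain L where L: "0 \<le> L" "bounded_by E L y" using y(2) by (rule bounded_endoE)
  have "bounded_by E (L * L) (e * (1 + f) ^ n)" for n
  proof -
    have "bounded_by E (1 ^ n * L) ((1 - r *\<^sub>R q) ^ n * y)" by (intro bounded_by_mult bounded_by_power r L) auto
    then have "bounded_by E (L * L) (y' * (y * (1 + f) ^ n))"
      using bounded_by_mult[OF L(1) bounded_by_adjoint[OF y(1) L(2,1)]] by (simp add: shift)
    then have "bounded_by E (L * L) (- (e * (1 + f) ^ n))" by (simp add: mult.assoc[symmetric] y'y)
    from bounded_by_minus[OF this] show ?thesis by simp
  qed
  then have fb: "bounded_by E (r * (L * L)) (f * (1 + f) ^ n)" for n
    using bounded_by_scaleR[of "L * L" "e * (1 + f) ^ n" r] r(1) by (simp add: f_def)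
  define C where "C = r * (L * L)"
  have C0: "0 \<le> C" using r(1) L(1) by (simp add: C_def)
  have comm: "(1 + f) ^ n * f = f * (1 + f) ^ n" for n
    by (induction n) (simp_all add: mult.assoc distrib_left distrib_right)
  \<comment> \<open>Bernoulli gives \<open>n f^2 \<le> f (1 + f)^n - f\<close>, and the right side
    is at most \<open>C\<close> whatever \<open>n\<close> is. So \<open>f^2\<close> has norm at most
    \<open>C / n\<close>.\<close>
  have ff: "bounded_by E C (real n *\<^sub>R (f * f))" for n
  proof (rule positive_endo_bounded_by)
    show "positive_endo E (real n *\<^sub>R (f * f))" by (intro positive_endo_scaleR positive_endo_mult f) auto
    have fn: "positive_endo E (f * ((1 + f) ^ n - 1 - real n *\<^sub>R f))"
      using comm[of n] by (intro positive_endo_mult f positive_endo_one_plus_power) (simp add: left_diff_distrib right_diff_distrib)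
    have "adjoint_pair E (f * (1 + f) ^ n) (f * (1 + f) ^ n)"
      using f comm[of n] by (intro self_adjoint_mult_commute adjoint_pair_intros positive_endo_adjoint) auto
    then have "positive_endo E (C *\<^sub>R 1 - f * (1 + f) ^ n)"
      using fb C0 unfolding C_def by (intro positive_endo_diff_bound) auto
    from positive_endo_add[OF positive_endo_add[OF this fn] f]
    show "positive_endo E (C *\<^sub>R 1 - real n *\<^sub>R (f * f))"
      by (simp add: algebra_simps)
  qed (rule C0)
  have "f * f = 0"
  proof (rule bounded_by_eq_0)
    fix \<epsilon> :: real assume \<epsilon>: "0 < \<epsilon>"
    then obtain n where n: "C / \<epsilon> < real n" using reals_Archimedean2 by blast
    then have n0: "0 < real n" using C0 \<epsilon> by (smt (verit) divide_nonneg_pos)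
    then have "bounded_by E (C / real n) (f * f)" using ff[of n] bounded_by_scaleR_cancel by blast
    moreover have "C / real n \<le> \<epsilon>" using n n0 \<epsilon> by (simp add: field_simps)
    ultimately show "bounded_by E \<epsilon> (f * f)" by (rule bounded_by_mono)
  qed
  then have "f = 0" using self_adjoint_square_eq_0 positive_endo_adjoint[OF f] by blast
  then have "e = 0" using r(1) by (simp add: f_def)
  \<comment> \<open>\<open>p^2 = z p - h p = 2 z p\<close>, hence \<open>p^3 = 2 e = 0\<close>, and
    a self-adjoint nilpotent operator vanishes.\<close>
  have "p * p = 2 *\<^sub>R (z * p)" by (subst (1) p_def) (simp add: left_diff_distrib hp scaleR_2)
  then have "p * p * p = 0" using \<open>e = 0\<close> e_eq by simp
  then have "(p * p) * (p * p) = 0" by (simp add: mult.assoc[symmetric])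
  then have "p * p = 0" by (rule self_adjoint_square_eq_0[OF adjoint_pair_mult[OF p(1) p(1)]])
  then have "p = 0" by (rule self_adjoint_square_eq_0[OF p(1)])
  then show ?thesis using z(1) by (simp add: p_def h_def)
qed

end

section \<open>The order of a C*-algebra\<close>

definition algebra_module :: "('b::cstar_algebra, 'b) hmodule"
  where "algebra_module = \<lparr>act = (*), ip = (\<lambda>x y. star x * y), gr = (\<lambda>x. x)\<rparr>"

lemma algebra_module_simps [simp]:
  "act algebra_module = (*)" "ip algebra_module x y = star x * y"
  by (simp_all add: algebra_module_def)

lemma hnorm_algebra_module [simp]: "hnorm algebra_module x = norm x"
  by (simp add: hnorm_def cstar_identity)

text \<open>By the C*-identity the module norm is the norm of the algebra, so the Cauchy-Schwarz
  inequality is submultiplicativity together with the isometry of \<open>star\<close>.\<close>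

lemma cs_module_algebra_module: "cs_module (algebra_module :: ('b::cstar_algebra, 'b) hmodule)"
proof
  fix s :: "nat \<Rightarrow> 'b"
  assume "\<And>\<epsilon>. \<epsilon> > 0 \<Longrightarrow> \<exists>N. \<forall>m\<ge>N. \<forall>n\<ge>N. hnorm algebra_module (s m - s n) < \<epsilon>"
  then have "Cauchy s" unfolding Cauchy_def dist_norm by simp
  then obtain x where "s \<longlonglongrightarrow> x" using Cauchy_convergent convergent_def by blast
  then show "\<exists>x. hlim algebra_module s x"
    unfolding hlim_def by (auto intro!: tendsto_norm_zero LIM_zero)
next
  fix x y :: 'b
  show "x = 0" if "ip algebra_module x x = 0" using that cstar_identity[of x] by simp
  show "norm (ip algebra_module x y) \<le> hnorm algebra_module x * hnorm algebra_module y"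
    using norm_mult_ineq[of "star x" y] by simp
qed (simp_all add: algebra_simps star_mult star_star scaleC_mult_left scaleC_mult_right)

definition left_mult :: "'b::cstar_algebra \<Rightarrow> 'b endo"
  where "left_mult b = Endo ((*) b)"

lemma app_left_mult [simp]: "left_mult b \<cdot> x = b * x"
  unfolding left_mult_def by (subst app_Endo) (auto simp: distrib_left scaleC_mult_right)

lemma left_mult_simps:
  "left_mult (a + b) = left_mult a + left_mult b" "left_mult (a - b) = left_mult a - left_mult b"
  "left_mult (a * b) = left_mult a * left_mult b" "left_mult (r *\<^sub>R a) = r *\<^sub>R left_mult a"
  by (rule endo_eqI, simp add: algebra_simps)+

lemma adjoint_pair_left_mult: "adjoint_pair algebra_module (left_mult b) (left_mult (star b))"
  by (simp add: adjoint_pair_def star_mult mult.assoc)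

lemma bounded_by_left_mult: "bounded_by algebra_module (norm b) (left_mult b)"
  by (simp add: bounded_by_def norm_mult_ineq)

text \<open>The test vector is \<open>star b\<close>, for which the C*-identity computes the norm of
  the image exactly; thus the left regular representation is isometric even without a unit.\<close>

lemma bounded_by_left_multD:
  assumes "bounded_by algebra_module K (left_mult b)" "0 \<le> K" shows "norm b \<le> K"
proof (cases "b = 0")
  case True
  then show ?thesis using assms(2) by simp
next
  case False
  have "norm b * norm b \<le> K * norm b"
    using bounded_byD[OF assms(1), of "star b"] cstar_identity[of "star b"]
    by (simp add: star_star power2_eq_square)
  then show ?thesis using False by simp
qed

text \<open>Left multiplications live in an algebra of operators that has an identity, which takes
  the place of a unitization of the coefficient algebra.\<close>

definition nonneg_element :: "'b::cstar_algebra \<Rightarrow> bool"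
  where "nonneg_element b \<longleftrightarrow> positive_endo algebra_module (left_mult b)"

interpretation algebra_module: cs_module "algebra_module :: ('b::cstar_algebra, 'b) hmodule"
  by (rule cs_module_algebra_module)

lemma nonneg_element_star_mult: "nonneg_element (star y * y)"
  unfolding nonneg_element_def left_mult_simps
  by (intro algebra_module.positive_endo_adjoint_mult adjoint_pair_left_mult)
    (rule algebra_module.bounded_byI_endo[OF bounded_by_left_mult])

lemma nonneg_element_add: "nonneg_element a \<Longrightarrow> nonneg_element b \<Longrightarrow> nonneg_element (a + b)"
  unfolding nonneg_element_def left_mult_simps by (rule algebra_module.positive_endo_add)

lemma nonneg_element_norm_diff:
  assumes "nonneg_element p" shows "positive_endo algebra_module (norm p *\<^sub>R 1 - left_mult p)"
  using assms unfolding nonneg_element_def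
  by (intro algebra_module.positive_endo_diff_bound algebra_module.positive_endo_adjoint bounded_by_left_mult) auto

text \<open>From \<open>p \<le> p + q \<le> norm (p + q)\<close> in the order of operators,
  \<open>positive_endo_bounded_by\<close> recovers the norm inequality.\<close>

lemma norm_le_norm_add_nonneg:
  assumes p: "nonneg_element p" and q: "nonneg_element q" shows "norm p \<le> norm (p + q)"
proof -
  have "positive_endo algebra_module (norm (p + q) *\<^sub>R 1 - left_mult (p + q) + left_mult q)"
    using nonneg_element_norm_diff[OF nonneg_element_add[OF p q]] q
    unfolding nonneg_element_def by (rule algebra_module.positive_endo_add)
  then have "positive_endo algebra_module (norm (p + q) *\<^sub>R 1 - left_mult p)"
    by (simp add: left_mult_simps)
  then have "bounded_by algebra_module (norm (p + q)) (left_mult p)"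
    using p unfolding nonneg_element_def by (intro algebra_module.positive_endo_bounded_by) auto
  then show ?thesis by (rule bounded_by_left_multD) simp
qed

text \<open>With \<open>Z\<close> the root of \<open>norm p - p\<close>, the element acts as the
  adjoint of \<open>Z a\<close> times \<open>Z a\<close>. The root itself is an operator on the
  algebra and need not be a multiplication.\<close>

lemma nonneg_element_conjugate:
  assumes "nonneg_element p" shows "nonneg_element (norm p *\<^sub>R (star a * a) - star a * p * a)"
proof -
  obtain Z where Z: "positive_endo algebra_module Z" "Z * Z = norm p *\<^sub>R 1 - left_mult p"
    using algebra_module.positive_endo_root[OF nonneg_element_norm_diff[OF assms]] by metis
  have "positive_endo algebra_module ((left_mult (star a) * Z) * (Z * left_mult a))"
    by (intro algebra_module.positive_endo_adjoint_mult algebra_module.adjoint_pair_mult adjoint_pair_left_mult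
        algebra_module.positive_endo_adjoint Z algebra_module.bounded_endo_mult algebra_module.positive_endo_bounded
        algebra_module.bounded_byI_endo[OF bounded_by_left_mult])
  also have "(left_mult (star a) * Z) * (Z * left_mult a) = left_mult (star a) * (Z * Z) * left_mult a"
    by (simp add: mult.assoc)
  also have "\<dots> = left_mult (norm p *\<^sub>R (star a * a) - star a * p * a)"
    by (simp add: Z(2) left_mult_simps left_diff_distrib right_diff_distrib)
  finally show ?thesis unfolding nonneg_element_def .
qed

section \<open>Hilbert modules\<close>

locale hilbert_module = inner_module E for E :: "('e::complex_vector, 'b::cstar_algebra) hmodule" +
  assumes ip_nonneg: "nonneg_element (ip E x x)"
begin

text \<open>The usual vector \<open>x a - t y\<close>, with \<open>a = ip E x y\<close> and
  \<open>t\<close> the norm of \<open>ip E x x\<close>, exhibits \<open>t^2 ip E y y\<close> as a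
  sum of three non-negative elements. Keeping only \<open>t star a * a\<close> does not raise the
  norm.\<close>

lemma cauchy_schwarz_power2: "(norm (ip E x y))\<^sup>2 \<le> norm (ip E x x) * norm (ip E y y)"
proof (cases "x = 0")
  case False
  define a t z where "a = ip E x y" and "t = norm (ip E x x)" and "z = act E x a - t *\<^sub>R y"
  have t: "0 < t" using False ip_definite by (auto simp: t_def)
  have yx: "ip E y x = star a" by (simp add: a_def ip_star)
  have "ip E z z = star a * ip E x x * a - t *\<^sub>R (star a * a) - t *\<^sub>R (star a * a) + (t * t) *\<^sub>R ip E y y"
    unfolding z_def
    by (simp add: ip_diff_left ip_diff_right ip_act_left ip_act_right yx flip: a_def)
      (simp add: ip_act_left ip_act_right yx mult.assoc algebra_simps flip: a_def)
  then have eq: "(t * t) *\<^sub>R ip E y y = t *\<^sub>R (star a * a) +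
    ((t *\<^sub>R (star a * a) - star a * ip E x x * a) + ip E z z)"
    by (simp add: algebra_simps)
  have "nonneg_element (t *\<^sub>R (star a * a))"
    using nonneg_element_star_mult[of "sqrt t *\<^sub>R a"] t by (simp add: star_scaleR)
  then have "norm (t *\<^sub>R (star a * a)) \<le> norm ((t * t) *\<^sub>R ip E y y)"
    unfolding eq using nonneg_element_conjugate[OF ip_nonneg[of x], of a] ip_nonneg[of z]
    by (intro norm_le_norm_add_nonneg nonneg_element_add) (auto simp: t_def)
  then show ?thesis using t by (simp add: cstar_identity flip: t_def a_def)
qed simp

end

sublocale hilbert_module \<subseteq> cs_module
proof
  show "norm (ip E x y) \<le> hnorm E x * hnorm E y" for x y
    by (rule power2_le_imp_le) (use cauchy_schwarz_power2 in \<open>auto simp: power_mult_distrib hnorm_power2\<close>)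
qed

lemma hilbert_module_algebra_module: "hilbert_module (algebra_module :: ('b::cstar_algebra, 'b) hmodule)"
  by unfold_locales (simp add: nonneg_element_star_mult)

lemma (in graded_hilbert_module) hilbert_module: "hilbert_module E"
proof
  show "nonneg_element (ip E x x)" for x
    using ip_positive[of x] nonneg_element_star_mult unfolding positive_element_def by auto
qed (fact act_add_left act_add_right act_scaleC_left act_scaleC_right act_mult ip_add_right ip_scaleC_right
     ip_act_right ip_star ip_definite complete)+

context hilbert_module
begin

lemma hnorm_le_of_ip_eq_add: "ip E x x = ip E y y + ip E z z \<Longrightarrow> hnorm E y \<le> hnorm E x"
  using norm_le_norm_add_nonneg[OF ip_nonneg[of y] ip_nonneg[of z]] by (simp add: hnorm_def)

lemma adjointable_endoE:
  assumes "adjointable E E f" obtains S T where "f = app S" "adjoint_pair E S T" "adj E E f = app T"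
proof -
  obtain g where g: "\<And>x y. ip E (f x) y = ip E x (g y)" using assms unfolding adjointable_def by blast
  have f: "app (Endo f) = f"
    by (rule app_Endo; rule ip_nondegenerate_left) (simp_all add: g ip_add_left ip_scaleC_left)
  have g': "app (Endo g) = g"
    by (rule app_Endo; rule ip_nondegenerate) (simp_all add: ip_add_right ip_scaleC_right flip: g)
  have "adj E E f = g" unfolding adj_def
  proof (rule the_equality)
    fix S assume "\<forall>x y. ip E (f x) y = ip E x (S y)"
    then show "S = g" using g by (intro ext ip_nondegenerate) metis
  qed (simp add: g)
  then show ?thesis using that[of "Endo f" "Endo g"] g f g' by (simp add: adjoint_pair_def)
qed

lemma adjointableI: "adjoint_pair E S T \<Longrightarrow> adjointable E E (app S)"
  unfolding adjointable_def adjoint_pair_def by blast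

lemma adj_app: "adjoint_pair E S T \<Longrightarrow> adj E E (app S) = app T"
  by (metis adjointableI adjointable_endoE adjoint_pair_unique app_inject)

text \<open>If \<open>norm b \<le> 1\<close>, then \<open>1 - star b * b\<close> is formally the
  square of \<open>1 - y\<close> with \<open>y\<close> in the algebra. Hence \<open>ip E x x\<close>
  is the sum of the inner squares of \<open>f b x\<close> and \<open>(1 - f y) x\<close>.\<close>

lemma representation_contractive:
  fixes f :: "'a::cstar_algebra \<Rightarrow> 'e endo"
  assumes add: "\<And>a b. f (a + b) = f a + f b" and scale: "\<And>r a. f (r *\<^sub>R a) = r *\<^sub>R f a"
    and mult: "\<And>a b. f (a * b) = f a * f b" and star: "\<And>a. adjoint_pair E (f a) (f (star a))"
  shows "bounded_by E (norm a) (f a)"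
proof -
  have le1: "bounded_by E 1 (f b)" if "norm b \<le> 1" for b
    unfolding bounded_by_def
  proof
    fix x
    define h where "h = star b * b"
    have h: "norm h \<le> 1" "star h = h"
      using that by (auto simp: h_def cstar_identity power_le_one star_mult star_star)
    obtain y where y: "star y = y" "2 *\<^sub>R y - y * y = h" using cstar_quasi_sqrt[OF h] .
    have fh: "f h + f y * f y = 2 *\<^sub>R f y"
      using y(2) by (metis add scale mult diff_add_cancel)
    have adj: "adjoint_pair E (1 - f y) (1 - f y)"
      using star[of y] y(1) by (intro adjoint_pair_diff adjoint_pair_1) simp
    have "(1 - f y) * (1 - f y) = 1 - f h"
      using fh by (simp add: algebra_simps scaleR_2)
    then have "ip E ((1 - f y) \<cdot> x) ((1 - f y) \<cdot> x) = ip E x ((1 - f h) \<cdot> x)"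
      unfolding adjoint_pairD[OF adj] by (simp only: flip: endo_app(6))
    moreover have "ip E (f b \<cdot> x) (f b \<cdot> x) = ip E x (f h \<cdot> x)"
      by (simp add: adjoint_pairD[OF star] h_def mult)
    ultimately have "ip E x x = ip E (f b \<cdot> x) (f b \<cdot> x) + ip E ((1 - f y) \<cdot> x) ((1 - f y) \<cdot> x)"
      by (simp add: ip_diff_right)
    then show "hnorm E (f b \<cdot> x) \<le> 1 * hnorm E x" using hnorm_le_of_ip_eq_add by simp
  qed
  show ?thesis
  proof (cases "a = 0")
    case True
    then show ?thesis using scale[of 0 a] by simp
  next
    case False
    then have "bounded_by E 1 ((1 / norm a) *\<^sub>R f a)"
      using le1[of "(1 / norm a) *\<^sub>R a"] by (simp add: scale)
    then show ?thesis using bounded_by_scaleR_cancel[of "1 / norm a" 1 "f a"] False by simp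
  qed
qed

text \<open>Bounded maps of Hilbert modules may fail to have adjoints. Here the solutions
  \<open>z\<close> exist for \<open>y\<close> in a dense set and depend on \<open>y\<close> in a
  Lipschitz way, as seen by evaluating \<open>T\<close> at the difference of two solutions; they
  therefore extend to limits.\<close>

lemma adjointable_of_dense:
  fixes F :: "('f::complex_vector, 'b) hmodule"
  assumes F: "hilbert_module F" and T: "\<And>x. hnorm F (T x) \<le> K * hnorm E x"
    and S: "hdense F S" and adj: "\<And>y. y \<in> S \<Longrightarrow> \<exists>z. \<forall>x. ip F (T x) y = ip E x z"
  shows "adjointable E F T"
proof -
  interpret F: hilbert_module F by (rule F)
  have K: "0 \<le> K * hnorm E x" for x using T[of x] F.hnorm_nonneg order_trans by blast
  have "\<exists>z. \<forall>x. ip F (T x) y = ip E x z" for y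
  proof -
    obtain s where s: "\<And>n. s n \<in> S" "hlim F s y" using F.hdense_seq[OF S] by blast
    obtain g where g: "\<And>n x. ip F (T x) (s n) = ip E x (g n)" using adj[OF s(1)] by metis
    have "hnorm E (g m - g n) \<le> \<bar>K\<bar> * hnorm F (s m - s n)" for m n
    proof (cases "g m = g n")
      case False
      define d where "d = g m - g n"
      have "(hnorm E d)\<^sup>2 = norm (ip F (T d) (s m - s n))"
        by (simp add: hnorm_power2 F.ip_diff_right g d_def ip_diff_right)
      also have "\<dots> \<le> (K * hnorm E d) * hnorm F (s m - s n)"
        by (rule order_trans[OF F.cauchy_schwarz]) (intro mult_right_mono T F.hnorm_nonneg)
      finally have "hnorm E d * hnorm E d \<le> (K * hnorm F (s m - s n)) * hnorm E d"
        by (simp add: power2_eq_square algebra_simps)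
      then have "hnorm E d \<le> K * hnorm F (s m - s n)"
        using False by (auto simp: d_def mult_le_cancel_right less_le)
      also have "\<dots> \<le> \<bar>K\<bar> * hnorm F (s m - s n)" by (simp add: mult_right_mono)
      finally show ?thesis by (simp add: d_def)
    qed simp
    moreover have "\<exists>N. \<forall>m\<ge>N. \<forall>n\<ge>N. \<bar>K\<bar> * hnorm F (s m - s n) < \<epsilon>" if "0 < \<epsilon>" for \<epsilon>
    proof -
      have "0 < \<epsilon> / (\<bar>K\<bar> + 1)" using that by simp
      then obtain N where N: "\<And>m n. m \<ge> N \<Longrightarrow> n \<ge> N \<Longrightarrow> hnorm F (s m - s n) < \<epsilon> / (\<bar>K\<bar> + 1)"
        using F.hlim_imp_Cauchy[OF s(2)] by metis
      have "\<bar>K\<bar> * hnorm F (s m - s n) < \<epsilon>" if "m \<ge> N" "n \<ge> N" for m n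
      proof -
        have "\<bar>K\<bar> * hnorm F (s m - s n) \<le> (\<bar>K\<bar> + 1) * hnorm F (s m - s n)" by (simp add: mult_right_mono)
        also have "\<dots> < \<epsilon>" using N[OF that] by (simp add: field_simps)
        finally show ?thesis .
      qed
      then show ?thesis by blast
    qed
    ultimately obtain z where z: "hlim E g z" by (rule hlim_Cauchy)
    have "ip F (T x) y = ip E x z" for x
      using LIMSEQ_unique[OF F.tendsto_ip_right[OF s(2), of "T x"]] tendsto_ip_right[OF z, of x] by (simp add: g)
    then show ?thesis by blast
  qed
  then show ?thesis unfolding adjointable_def by metis
qed

lemma adjoint_pair_of_dense:
  assumes "bounded_by E K T" "hdense E S" "\<And>y. y \<in> S \<Longrightarrow> \<exists>z. \<forall>x. ip E (T \<cdot> x) y = ip E x z"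
  obtains T' where "adjoint_pair E T T'"
proof -
  have "adjointable E E (app T)"
    by (rule adjointable_of_dense[OF _ _ assms(2,3)]) (use assms(1) hilbert_module_axioms in \<open>auto simp: bounded_by_def\<close>)
  then show ?thesis using adjointable_endoE that by (metis app_inject)
qed

lemma hnorm_le_of_dense:
  assumes "hdense E S" "\<And>y. y \<in> S \<Longrightarrow> norm (ip E x y) \<le> K * hnorm E y" "0 \<le> K"
  shows "hnorm E x \<le> K"
proof -
  obtain s where s: "\<And>n. s n \<in> S" "hlim E s x" using hdense_seq[OF assms(1)] by blast
  have "norm (ip E x x) \<le> K * hnorm E x"
    by (rule tendsto_le[OF sequentially_bot tendsto_mult[OF tendsto_const tendsto_hnorm[OF s(2)]]
          tendsto_norm[OF tendsto_ip_right[OF s(2)]]]) (use assms(2) s(1) in auto)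
  then have "hnorm E x * hnorm E x \<le> K * hnorm E x" by (simp flip: hnorm_power2 add: power2_eq_square)
  then show ?thesis using assms(3) by (cases "x = 0") (auto simp: mult_le_cancel_right less_le)
qed

text \<open>The formal adjoint \<open>g\<close> does double duty: pairing with the dense
  \<open>S'\<close> makes the limits independent of the chosen sequences, hence linear, and it
  provides the adjoint of the extension.\<close>

lemma extend_densely_defined:
  assumes S: "csubspace S" "hdense E S"
    and add: "\<And>x y. x \<in> S \<Longrightarrow> y \<in> S \<Longrightarrow> f (x + y) = f x + f y"
    and scale: "\<And>c x. x \<in> S \<Longrightarrow> f (c *\<^sub>C x) = c *\<^sub>C f x"
    and bd: "\<And>x. x \<in> S \<Longrightarrow> hnorm E (f x) \<le> K * hnorm E x"
    and S': "hdense E S'" and adj: "\<And>x y. x \<in> S \<Longrightarrow> y \<in> S' \<Longrightarrow> ip E (f x) y = ip E x (g y)"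
  obtains X X' where "adjoint_pair E X X'" "bounded_endo E X" "\<And>x. x \<in> S \<Longrightarrow> X \<cdot> x = f x"
proof -
  have diff: "f (x - y) = f x - f y" if "x \<in> S" "y \<in> S" for x y
    using add[OF that(1) csubspace_scale[OF S(1) that(2)], of "-1"] scale[OF that(2), of "-1"]
    by (simp add: scaleC_one)
  have ex: "\<exists>z. \<exists>s. (\<forall>n. s n \<in> S) \<and> hlim E s x \<and> hlim E (\<lambda>n. f (s n)) z" for x
  proof -
    obtain s where s: "\<And>n. s n \<in> S" "hlim E s x" using hdense_seq[OF S(2)] by blast
    obtain z where "hlim E (\<lambda>n. f (s n)) z"
    proof (rule hlim_Cauchy)
      show "hnorm E (f (s m) - f (s n)) \<le> \<bar>K\<bar> * hnorm E (s m - s n)" for m n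
        using bd[OF csubspace_diff[OF S(1) s(1) s(1)], of m n] mult_right_mono[OF abs_ge_self, of "hnorm E (s m - s n)" K]
        by (simp add: diff s(1))
      fix \<epsilon> :: real assume \<epsilon>: "0 < \<epsilon>"
      have "0 < \<epsilon> / (\<bar>K\<bar> + 1)" using \<epsilon> by simp
      then obtain N where N: "\<And>m n. m \<ge> N \<Longrightarrow> n \<ge> N \<Longrightarrow> hnorm E (s m - s n) < \<epsilon> / (\<bar>K\<bar> + 1)"
        using hlim_imp_Cauchy[OF s(2)] by metis
      have "\<bar>K\<bar> * hnorm E (s m - s n) < \<epsilon>" if "m \<ge> N" "n \<ge> N" for m n
      proof -
        have "\<bar>K\<bar> * hnorm E (s m - s n) \<le> (\<bar>K\<bar> + 1) * hnorm E (s m - s n)" by (simp add: mult_right_mono)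
        also have "\<dots> < \<epsilon>" using N[OF that] by (simp add: field_simps)
        finally show ?thesis .
      qed
      then show "\<exists>N. \<forall>m\<ge>N. \<forall>n\<ge>N. \<bar>K\<bar> * hnorm E (s m - s n) < \<epsilon>" by blast
    qed
    then show ?thesis using s by blast
  qed
  then obtain h s where s: "\<And>x n. s x n \<in> S" "\<And>x. hlim E (s x) x" "\<And>x. hlim E (\<lambda>n. f (s x n)) (h x)"
    by metis
  have bdh: "hnorm E (h x) \<le> K * hnorm E x" for x
    using hlim_hnorm_mono[OF s(3) s(2)] bd[OF s(1)] by blast
  have h: "ip E (h x) y = ip E x (g y)" if "y \<in> S'" for x y
    using LIMSEQ_unique[OF tendsto_ip_left[OF s(3)[of x], of y]] tendsto_ip_left[OF s(2)[of x], of "g y"]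
    by (simp add: adj[OF s(1) that])
  have eqI: "x = y" if "\<And>z. z \<in> S' \<Longrightarrow> ip E x z = ip E y z" for x y
  proof -
    have "hnorm E (x - y) \<le> 0" using that by (intro hnorm_le_of_dense[OF S']) (simp_all add: ip_diff_left)
    then show ?thesis using hnorm_nonneg[of "x - y"] by (metis antisym eq_iff_diff_eq_0 hnorm_eq_0)
  qed
  have X: "app (Endo h) = h"
    by (rule app_Endo; rule eqI) (simp_all add: h ip_add_left ip_scaleC_left)
  have "bounded_by E K (Endo h)" unfolding bounded_by_def X using bdh by blast
  moreover obtain X' where "adjoint_pair E (Endo h) X'"
    by (rule adjoint_pair_of_dense[OF \<open>bounded_by E K (Endo h)\<close> S']) (use h X in auto)
  moreover have "Endo h \<cdot> x = f x" if "x \<in> S" for x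
    unfolding X by (rule eqI) (simp add: h adj that)
  ultimately show ?thesis using that bounded_byI_endo by blast
qed

end

text \<open>Continuity of the grading is not an axiom. Followed by left multiplication,
  \<open>grade\<close> is a star-preserving representation, hence contractive, and it is its own
  inverse.\<close>

lemma norm_grade [simp]: "norm (grade b) = norm (b :: 'b::graded_cstar_algebra)"
proof -
  interpret hilbert_module "algebra_module :: ('b, 'b) hmodule" by (rule hilbert_module_algebra_module)
  have "norm (grade c) \<le> norm c" for c :: 'b
  proof -
    have "bounded_by algebra_module (norm c) (left_mult (grade c))"
      by (rule representation_contractive)
        (simp_all add: grade_add grade_mult left_mult_simps scaleR_scaleC grade_scaleC grade_star adjoint_pair_left_mult
          endo_eqI scaleC_mult_left)
    then show ?thesis by (rule bounded_by_left_multD) simp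
  qed
  from this[of b] this[of "grade b"] show ?thesis by (simp add: grade_grade)
qed

section \<open>Direct sums\<close>

lemma dsum_module_simps [simp]:
  "act (dsum_module E F) (x, y) b = (act E x b, act F y b)"
  "ip (dsum_module E F) (x, y) (x', y') = ip E x x' + ip F y y'"
  "gr (dsum_module E F) (x, y) = (gr E x, gr F y)"
  by (simp_all add: dsum_module_def)

lemma scaleC_Pair [simp]: "c *\<^sub>C (x, y) = (c *\<^sub>C x, c *\<^sub>C y)"
  by (simp add: scaleC_prod_def)

context
  fixes E :: "('e::complex_vector, 'b::cstar_algebra) hmodule" and F :: "('f::complex_vector, 'b) hmodule"
  assumes E: "hilbert_module E" and F: "hilbert_module F"
begin

interpretation E: hilbert_module E by (rule E)
interpretation F: hilbert_module F by (rule F)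

text \<open>The norm of a pair is not simply a function of the norms of its entries. It is enclosed
  between their maximum and their sum, which is enough for limits, density and completeness.\<close>

lemma hnorm_dsum_le: "hnorm E x \<le> hnorm (dsum_module E F) (x, y)" "hnorm F y \<le> hnorm (dsum_module E F) (x, y)"
  using norm_le_norm_add_nonneg[OF E.ip_nonneg[of x] F.ip_nonneg[of y]]
    norm_le_norm_add_nonneg[OF F.ip_nonneg[of y] E.ip_nonneg[of x]]
  by (simp_all add: hnorm_def add.commute)

lemma hnorm_dsum_ge: "hnorm (dsum_module E F) (x, y) \<le> hnorm E x + hnorm F y"
proof -
  have "hnorm (dsum_module E F) (x, y) \<le> sqrt (norm (ip E x x) + norm (ip F y y))"
    by (simp add: hnorm_def norm_triangle_ineq)
  also have "\<dots> \<le> hnorm E x + hnorm F y"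
    unfolding hnorm_def by (rule sqrt_add_le_add_sqrt) auto
  finally show ?thesis .
qed

lemma hlim_dsum: "hlim (dsum_module E F) s p \<longleftrightarrow> hlim E (\<lambda>n. fst (s n)) (fst p) \<and> hlim F (\<lambda>n. snd (s n)) (snd p)"
proof -
  have s: "s n - p = (fst (s n) - fst p, snd (s n) - snd p)" for n by (simp add: prod_eq_iff)
  show ?thesis
  proof (intro iffI conjI)
    assume "hlim (dsum_module E F) s p"
    then have *: "(\<lambda>n. hnorm (dsum_module E F) (fst (s n) - fst p, snd (s n) - snd p)) \<longlonglongrightarrow> 0"
      by (simp add: hlim_def s)
    show "hlim E (\<lambda>n. fst (s n)) (fst p)" "hlim F (\<lambda>n. snd (s n)) (snd p)"
      unfolding hlim_def by (rule tendsto_sandwich[OF _ _ tendsto_const *]; simp add: hnorm_dsum_le)+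
  next
    assume "hlim E (\<lambda>n. fst (s n)) (fst p) \<and> hlim F (\<lambda>n. snd (s n)) (snd p)"
    then have *: "(\<lambda>n. hnorm E (fst (s n) - fst p) + hnorm F (snd (s n) - snd p)) \<longlonglongrightarrow> 0"
      unfolding hlim_def using tendsto_add by fastforce
    have nn: "0 \<le> hnorm (dsum_module E F) q" for q by (simp add: hnorm_def)
    show "hlim (dsum_module E F) s p"
      unfolding hlim_def s
      by (rule tendsto_sandwich[OF _ _ tendsto_const *]) (simp_all add: hnorm_dsum_ge nn)
  qed
qed

lemma hdense_dsum: "hdense E S \<Longrightarrow> hdense F T \<Longrightarrow> hdense (dsum_module E F) (S \<times> T)"
  unfolding hdense_def
proof (intro allI impI)
  fix p :: "'e \<times> 'f" and \<epsilon> :: real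
  assume *: "\<forall>x. \<forall>\<epsilon>>0. \<exists>y\<in>S. hnorm E (x - y) < \<epsilon>" "\<forall>x. \<forall>\<epsilon>>0. \<exists>y\<in>T. hnorm F (x - y) < \<epsilon>" "0 < \<epsilon>"
  obtain x y where p: "p = (x, y)" by (cases p)
  have "0 < \<epsilon> / 2" using *(3) by simp
  then obtain x' y' where "x' \<in> S" "hnorm E (x - x') < \<epsilon> / 2" "y' \<in> T" "hnorm F (y - y') < \<epsilon> / 2"
    using *(1,2) by metis
  then show "\<exists>q\<in>S \<times> T. hnorm (dsum_module E F) (p - q) < \<epsilon>"
    using hnorm_dsum_ge[of "x - x'" "y - y'"] by (intro bexI[of _ "(x', y')"]) (auto simp: p)
qed

lemma hilbert_module_dsum: "hilbert_module (dsum_module E F)"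
proof
  fix s :: "nat \<Rightarrow> 'e \<times> 'f"
  assume *: "\<And>\<epsilon>. 0 < \<epsilon> \<Longrightarrow> \<exists>N. \<forall>m\<ge>N. \<forall>n\<ge>N. hnorm (dsum_module E F) (s m - s n) < \<epsilon>"
  have s: "s m - s n = (fst (s m) - fst (s n), snd (s m) - snd (s n))" for m n by (simp add: prod_eq_iff)
  have "\<exists>x. hlim E (\<lambda>n. fst (s n)) x"
    by (rule E.complete) (use * in \<open>metis s hnorm_dsum_le(1) order.strict_trans1\<close>)
  moreover have "\<exists>y. hlim F (\<lambda>n. snd (s n)) y"
    by (rule F.complete) (use * in \<open>metis s hnorm_dsum_le(2) order.strict_trans1\<close>)
  ultimately show "\<exists>p. hlim (dsum_module E F) s p" unfolding hlim_dsum by auto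
next
  fix p assume "ip (dsum_module E F) p p = 0"
  then have "hnorm (dsum_module E F) (fst p, snd p) = 0" by (simp add: hnorm_def)
  then have "hnorm E (fst p) \<le> 0" "hnorm F (snd p) \<le> 0" using hnorm_dsum_le(1)[of "fst p" "snd p"] hnorm_dsum_le(2)[of "snd p" "fst p"] by simp_all
  then show "p = 0" using E.hnorm_nonneg[of "fst p"] F.hnorm_nonneg[of "snd p"] by (metis E.hnorm_eq_0 F.hnorm_eq_0 antisym prod_eq_iff fst_zero snd_zero)
next
  show "nonneg_element (ip (dsum_module E F) p p)" for p
    by (cases p) (simp add: nonneg_element_add E.ip_nonneg F.ip_nonneg)
qed (auto simp: dsum_module_def scaleC_prod_def E.act_add_left F.act_add_left E.act_add_right F.act_add_right
     E.act_scaleC_left F.act_scaleC_left E.act_scaleC_right F.act_scaleC_right E.act_mult F.act_mult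
     E.ip_add_right F.ip_add_right E.ip_scaleC_right F.ip_scaleC_right E.ip_act_right F.ip_act_right
     E.ip_star F.ip_star star_add scaleC_add_right distrib_right split: prod.splits)

end

section \<open>Compact operators\<close>

lemma finite_rank_opsI: "f = (\<lambda>z. \<Sum>i<(n::nat). act E (x i) (ip E (y i) z)) \<Longrightarrow> f \<in> finite_rank_ops E"
  unfolding finite_rank_ops_def by blast

context hilbert_module
begin

lemma adjoint_pair_act: "adjoint_pair E S T \<Longrightarrow> S \<cdot> act E x b = act E (S \<cdot> x) b"
  by (rule ip_nondegenerate_left) (simp add: adjoint_pair_def ip_act_left)

definition finite_rank_endo :: "'e endo \<Rightarrow> bool"
  where "finite_rank_endo T \<longleftrightarrow> app T \<in> finite_rank_ops E"

lemma finite_rank_ops_app: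
  assumes "f \<in> finite_rank_ops E"
  obtains S S' where "f = app S" "adjoint_pair E S S'" "finite_rank_endo S" "finite_rank_endo S'"
proof -
  obtain n :: nat and x y where f: "f = (\<lambda>z. \<Sum>i<n. act E (x i) (ip E (y i) z))"
    using assms unfolding finite_rank_ops_def by blast
  have app: "app (Endo (\<lambda>z. \<Sum>i<n. act E (u i) (ip E (v i) z))) = (\<lambda>z. \<Sum>i<n. act E (u i) (ip E (v i) z))" for u v
    by (rule app_Endo) (simp_all add: ip_add_right act_add_right sum.distrib ip_scaleC_right act_scaleC_right
        module.scale_sum_right[OF scaleC_module])
  let ?S = "Endo (\<lambda>z. \<Sum>i<n. act E (x i) (ip E (y i) z))" and ?S' = "Endo (\<lambda>z. \<Sum>i<n. act E (y i) (ip E (x i) z))"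
  have "adjoint_pair E ?S ?S'"
    unfolding adjoint_pair_def app ip_sum_left ip_sum_right ip_act_left ip_act_right ip_star by simp
  moreover have "f = app ?S" unfolding app by (rule f)
  moreover have "finite_rank_endo ?S" "finite_rank_endo ?S'"
    unfolding finite_rank_endo_def app by (rule finite_rank_opsI, rule refl)+
  ultimately show ?thesis using that by blast
qed

lemma finite_rank_endo_adjoint:
  assumes "finite_rank_endo S" "adjoint_pair E S T" shows "finite_rank_endo T"
proof -
  obtain R R' where "app S = app R" "adjoint_pair E R R'" "finite_rank_endo R'"
    using finite_rank_ops_app[OF assms(1)[unfolded finite_rank_endo_def]] by blast
  then show ?thesis using adjoint_pair_unique[OF assms(2)] by (simp add: app_inject)
qed

lemma finite_rank_endo_add:
  assumes "finite_rank_endo S" "finite_rank_endo T" shows "finite_rank_endo (S + T)"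
proof -
  obtain m n :: nat and x y x' y'
    where S: "app S = (\<lambda>z. \<Sum>i<m. act E (x i) (ip E (y i) z))" and T: "app T = (\<lambda>z. \<Sum>i<n. act E (x' i) (ip E (y' i) z))"
    using assms unfolding finite_rank_endo_def finite_rank_ops_def by blast
  have "app (S + T) = (\<lambda>z. \<Sum>i<m + n. act E (if i < m then x i else x' (i - m)) (ip E (if i < m then y i else y' (i - m)) z))"
  proof
    fix z
    let ?f = "\<lambda>i. act E (if i < m then x i else x' (i - m)) (ip E (if i < m then y i else y' (i - m)) z)"
    have "(\<Sum>i<m + n. ?f i) = (\<Sum>i<m. ?f i) + (\<Sum>i<n. ?f (m + i))"
    proof (induction n)
      case (Suc n)
      then show ?case by (simp add: add.assoc)
    qed simp
    then show "app (S + T) z = (\<Sum>i<m + n. ?f i)" by (simp add: S T)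
  qed
  then show ?thesis unfolding finite_rank_endo_def by (rule finite_rank_opsI)
qed

lemma finite_rank_endo_mult_left:
  assumes "adjoint_pair E A A'" "finite_rank_endo S" shows "finite_rank_endo (A * S)"
proof -
  obtain n :: nat and x y where S: "app S = (\<lambda>z. \<Sum>i<n. act E (x i) (ip E (y i) z))"
    using assms(2) unfolding finite_rank_endo_def finite_rank_ops_def by blast
  have "app (A * S) = (\<lambda>z. \<Sum>i<n. act E (A \<cdot> x i) (ip E (y i) z))"
    by (simp add: fun_eq_iff S app_sum adjoint_pair_act[OF assms(1)])
  then show ?thesis unfolding finite_rank_endo_def by (rule finite_rank_opsI)
qed

lemma compact_op_endo:
  "compact_op E (app T) \<longleftrightarrow> (\<exists>T'. adjoint_pair E T T') \<and>
    (\<forall>\<epsilon>>0. \<exists>S S'. adjoint_pair E S S' \<and> finite_rank_endo S \<and> bounded_by E \<epsilon> (T - S))"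
proof -
  have "adjointable E E (app T) \<longleftrightarrow> (\<exists>T'. adjoint_pair E T T')"
    by (metis adjointableI adjointable_endoE app_inject)
  moreover have "(\<exists>S\<in>finite_rank_ops E. \<forall>x. hnorm E (T \<cdot> x - S x) \<le> \<epsilon> * hnorm E x) \<longleftrightarrow>
     (\<exists>S S'. adjoint_pair E S S' \<and> finite_rank_endo S \<and> bounded_by E \<epsilon> (T - S))" for \<epsilon>
  proof
    assume "\<exists>S\<in>finite_rank_ops E. \<forall>x. hnorm E (T \<cdot> x - S x) \<le> \<epsilon> * hnorm E x"
    then obtain f where f: "f \<in> finite_rank_ops E" "\<forall>x. hnorm E (T \<cdot> x - f x) \<le> \<epsilon> * hnorm E x" by blast
    obtain S S' where "f = app S" "adjoint_pair E S S'" "finite_rank_endo S" using finite_rank_ops_app[OF f(1)] .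
    then show "\<exists>S S'. adjoint_pair E S S' \<and> finite_rank_endo S \<and> bounded_by E \<epsilon> (T - S)"
      using f(2) unfolding bounded_by_def by auto
  qed (auto simp: bounded_by_def finite_rank_endo_def)
  ultimately show ?thesis unfolding compact_op_def by simp
qed

abbreviation compact_endo :: "'e endo \<Rightarrow> bool"
  where "compact_endo T \<equiv> compact_op E (app T)"

lemma compact_endo_closed:
  assumes "adjoint_pair E T T'" "\<And>\<epsilon>. 0 < \<epsilon> \<Longrightarrow> \<exists>S. compact_endo S \<and> bounded_by E \<epsilon> (T - S)"
  shows "compact_endo T"
  unfolding compact_op_endo
proof (intro conjI allI impI)
  fix \<epsilon> :: real assume "0 < \<epsilon>"
  then have \<epsilon>2: "0 < \<epsilon> / 2" by simp
  obtain S where S: "compact_endo S" "bounded_by E (\<epsilon> / 2) (T - S)" using assms(2)[OF \<epsilon>2] by blast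
  obtain R R' where R: "adjoint_pair E R R'" "finite_rank_endo R" "bounded_by E (\<epsilon> / 2) (S - R)"
    using S(1) \<epsilon>2 unfolding compact_op_endo by meson
  have "bounded_by E \<epsilon> (T - R)" using bounded_by_add[OF S(2) R(3)] by simp
  then show "\<exists>S S'. adjoint_pair E S S' \<and> finite_rank_endo S \<and> bounded_by E \<epsilon> (T - S)" using R by blast
qed (use assms(1) in blast)

lemma compact_endo_add:
  assumes S: "compact_endo S" and T: "compact_endo T" shows "compact_endo (S + T)"
  unfolding compact_op_endo
proof (intro conjI allI impI)
  show "\<exists>T'. adjoint_pair E (S + T) T'" using assms unfolding compact_op_endo by (blast intro: adjoint_pair_add)
  fix \<epsilon> :: real assume "0 < \<epsilon>"
  then have \<epsilon>2: "0 < \<epsilon> / 2" by simp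
  obtain P P' where P: "adjoint_pair E P P'" "finite_rank_endo P" "bounded_by E (\<epsilon> / 2) (S - P)"
    using S \<epsilon>2 unfolding compact_op_endo by meson
  obtain Q Q' where Q: "adjoint_pair E Q Q'" "finite_rank_endo Q" "bounded_by E (\<epsilon> / 2) (T - Q)"
    using T \<epsilon>2 unfolding compact_op_endo by meson
  have "bounded_by E \<epsilon> (S + T - (P + Q))" using bounded_by_add[OF P(3) Q(3)] by (simp add: algebra_simps)
  then show "\<exists>R R'. adjoint_pair E R R' \<and> finite_rank_endo R \<and> bounded_by E \<epsilon> (S + T - R)"
    using P(1,2) Q(1,2) by (blast intro: adjoint_pair_add finite_rank_endo_add)
qed

lemma compact_endo_0: "compact_endo 0"
  unfolding compact_op_endo
  by (rule conjI, blast intro: adjoint_pair_0, intro allI impI exI[of _ 0])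
    (auto simp: finite_rank_endo_def adjoint_pair_0 fun_eq_iff intro!: finite_rank_opsI[where n=0])

lemma compact_endo_mult_left:
  assumes A: "adjoint_pair E A A'" "bounded_endo E A" and T: "compact_endo T" shows "compact_endo (A * T)"
  unfolding compact_op_endo
proof (intro conjI allI impI)
  show "\<exists>T'. adjoint_pair E (A * T) T'" using A T unfolding compact_op_endo by (blast intro: adjoint_pair_mult)
  obtain K where K: "0 \<le> K" "bounded_by E K A" using A(2) by (rule bounded_endoE)
  fix \<epsilon> :: real assume \<epsilon>: "0 < \<epsilon>"
  then have "0 < \<epsilon> / (K + 1)" using K by simp
  then obtain P P' where P: "adjoint_pair E P P'" "finite_rank_endo P" "bounded_by E (\<epsilon> / (K + 1)) (T - P)"
    using T unfolding compact_op_endo by meson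
  have "bounded_by E (K * (\<epsilon> / (K + 1))) (A * (T - P))" using K P(3) by (rule bounded_by_mult)
  moreover have "K * (\<epsilon> / (K + 1)) \<le> \<epsilon>" using K \<epsilon> by (simp add: field_simps)
  ultimately have "bounded_by E \<epsilon> (A * T - A * P)" using bounded_by_mono by (metis right_diff_distrib)
  then show "\<exists>R R'. adjoint_pair E R R' \<and> finite_rank_endo R \<and> bounded_by E \<epsilon> (A * T - R)"
    using P(1,2) A by (blast intro: adjoint_pair_mult finite_rank_endo_mult_left)
qed

lemma compact_endo_adjoint:
  assumes adj: "adjoint_pair E T T'" and T: "compact_endo T" shows "compact_endo T'"
  unfolding compact_op_endo
proof (intro conjI allI impI)
  show "\<exists>T''. adjoint_pair E T' T''" using adjoint_pair_sym[OF adj] by blast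
  fix \<epsilon> :: real assume \<epsilon>: "0 < \<epsilon>"
  then obtain P P' where P: "adjoint_pair E P P'" "finite_rank_endo P" "bounded_by E \<epsilon> (T - P)"
    using T unfolding compact_op_endo by meson
  have "bounded_by E \<epsilon> (T' - P')" by (rule bounded_by_adjoint[OF adjoint_pair_diff[OF adj P(1)] P(3)]) (use \<epsilon> in simp)
  then show "\<exists>R R'. adjoint_pair E R R' \<and> finite_rank_endo R \<and> bounded_by E \<epsilon> (T' - R)"
    using adjoint_pair_sym[OF P(1)] finite_rank_endo_adjoint[OF P(2,1)] by blast
qed

lemma compact_endo_mult_right:
  assumes B: "adjoint_pair E B B'" "bounded_endo E B" and T: "compact_endo T" shows "compact_endo (T * B)"
proof -
  obtain T' where T': "adjoint_pair E T T'" using T unfolding compact_op_endo by blast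
  have "compact_endo (B' * T')"
    by (rule compact_endo_mult_left[OF adjoint_pair_sym[OF B(1)] bounded_endo_adjoint[OF B] compact_endo_adjoint[OF T' T]])
  then show ?thesis
    by (rule compact_endo_adjoint[OF adjoint_pair_mult[OF adjoint_pair_sym[OF B(1)] adjoint_pair_sym[OF T']]])
qed

lemma compact_endo_scaleR: "compact_endo T \<Longrightarrow> compact_endo (r *\<^sub>R T)"
  using compact_endo_mult_left[of "r *\<^sub>R 1" "r *\<^sub>R 1" T] by (simp add: adjoint_pair_intros bounded_endo_intros)

lemma compact_endo_minus: "compact_endo T \<Longrightarrow> compact_endo (- T)"
  using compact_endo_scaleR[of T "-1"] by simp

lemma compact_endo_diff: "compact_endo S \<Longrightarrow> compact_endo T \<Longrightarrow> compact_endo (S - T)"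
  using compact_endo_add[of S "- T"] compact_endo_minus by simp

lemma compact_endo_sum: "(\<And>i. i \<in> A \<Longrightarrow> compact_endo (f i)) \<Longrightarrow> compact_endo (sum f A)"
  by (induction A rule: infinite_finite_induct) (auto simp: compact_endo_0 compact_endo_add)

end

section \<open>Compactness of commutators with bounded transforms\<close>

text \<open>
  The bounded picture of an unbounded operator \<open>D\<close>: \<open>G = (1 + D\<^sup>* D)\<^sup>-\<^sup>1\<^sup>/\<^sup>2\<close>, whose range is the domain of
  \<open>D\<close>, and \<open>F = D G\<close>. In these terms, that \<open>S\<close> maps \<open>Dom D2\<close> into \<open>Dom D1\<close> and that \<open>D1 S - S' D2\<close> has
  a bounded adjointable closure \<open>X\<close> is expressed with \<open>M = G1\<^sup>-\<^sup>1 S G2\<close>.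
\<close>

definition transform_triple :: "('e::complex_vector, 'b::cstar_algebra) hmodule \<Rightarrow> 'e endo \<Rightarrow> 'e endo \<Rightarrow> 'e endo \<Rightarrow> bool"
  where "transform_triple E F F' G \<longleftrightarrow> adjoint_pair E F F' \<and> positive_endo E G \<and> positive_endo E (1 - G) \<and>
    F' * F + G * G = 1 \<and> hdense E (range (app G))"

definition bounded_commutator ::
  "('e::complex_vector, 'b::cstar_algebra) hmodule \<Rightarrow> 'e endo \<Rightarrow> 'e endo \<Rightarrow> 'e endo \<Rightarrow> 'e endo \<Rightarrow> 'e endo \<Rightarrow> 'e endo \<Rightarrow> bool"
  where "bounded_commutator E F1 G1 F2 G2 S S' \<longleftrightarrow> (\<exists>M M' X X'. adjoint_pair E M M' \<and> bounded_endo E M \<and>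
    adjoint_pair E X X' \<and> bounded_endo E X \<and> S * G2 = G1 * M \<and> F1 * M = S' * F2 + X * G2)"

lemma bounded_commutatorE:
  assumes "bounded_commutator E F1 G1 F2 G2 S S'"
  obtains M M' X X' where "adjoint_pair E M M'" "bounded_endo E M" "adjoint_pair E X X'" "bounded_endo E X"
    "S * G2 = G1 * M" "F1 * M = S' * F2 + X * G2"
  using assms unfolding bounded_commutator_def by blast

context hilbert_module
begin

lemma bounded_by_sum: "(\<And>i. i \<in> A \<Longrightarrow> bounded_by E (f i) (g i)) \<Longrightarrow> bounded_by E (sum f A) (sum g A)"
  by (induction A rule: infinite_finite_induct) (simp_all add: bounded_by_add)

lemma transform_triple_bounded:
  assumes "transform_triple E F F' G" shows "bounded_endo E F" "bounded_endo E F'" "bounded_endo E G"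
proof -
  have adj: "adjoint_pair E F F'" and G: "adjoint_pair E G G" and eq: "F' * F + G * G = 1"
    using assms positive_endo_adjoint by (auto simp: transform_triple_def)
  have "hnorm E (F \<cdot> x) \<le> 1 * hnorm E x" for x
  proof -
    have "ip E x x = ip E x ((F' * F + G * G) \<cdot> x)" by (simp add: eq)
    also have "\<dots> = ip E (F \<cdot> x) (F \<cdot> x) + ip E (G \<cdot> x) (G \<cdot> x)"
      by (simp add: ip_add_right adjoint_pairD[OF adj] adjoint_pairD[OF G])
    finally show ?thesis using hnorm_le_of_ip_eq_add by simp
  qed
  then show F: "bounded_endo E F" using bounded_byI_endo unfolding bounded_by_def by blast
  show "bounded_endo E F'" using bounded_endo_adjoint[OF adj F] .
  show "bounded_endo E G" using assms positive_endo_bounded by (auto simp: transform_triple_def)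
qed

lemma transform_triple_contraction:
  assumes "transform_triple E F F' G" shows "bounded_by E 1 G" "bounded_by E 1 (1 - G)"
  using assms by (auto simp: transform_triple_def intro!: positive_endo_bounded_by)

lemma transform_triple_decay:
  assumes "transform_triple E F F' G" shows "bounded_by E (1 / real (Suc n)) (G * (1 - G) ^ n)"
  by (rule bounded_by_decay) (use assms in \<open>auto simp: transform_triple_def\<close>)

lemma one_minus_power_commutes: "G * (1 - G) ^ n = (1 - G) ^ n * (G :: 'e endo)"
  using power_commuting_commutes[of "1 - G" G n] by (simp add: left_diff_distrib right_diff_distrib)

text \<open>On the dense range of \<open>G\<close> the decay estimate gives the rate
  \<open>1/(n+1)\<close>, and contractivity of the powers carries the limit over to all vectors. The
  convergence is strong, not in norm.\<close>

lemma transform_triple_power_tendsto_0: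
  assumes t: "transform_triple E F F' G" shows "hlim E (\<lambda>n. (1 - G) ^ n \<cdot> x) 0"
  unfolding hlim_def diff_0_right
proof (rule LIMSEQ_I)
  fix \<epsilon> :: real assume "0 < \<epsilon>"
  then have \<epsilon>2: "0 < \<epsilon> / 2" by simp
  obtain z where z: "hnorm E (x - G \<cdot> z) < \<epsilon> / 2"
    using t \<epsilon>2 unfolding transform_triple_def hdense_def by (metis rangeE)
  obtain N :: nat where N: "hnorm E z / (\<epsilon> / 2) < real N" using reals_Archimedean2 by blast
  have "hnorm E ((1 - G) ^ n \<cdot> x) < \<epsilon>" if "n \<ge> N" for n
  proof -
    have "bounded_by E (1 ^ n) ((1 - G) ^ n)"
      by (intro bounded_by_power transform_triple_contraction[OF t]) simp
    then have "hnorm E ((1 - G) ^ n \<cdot> (x - G \<cdot> z)) < \<epsilon> / 2"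
      using bounded_byD[of E "1 ^ n" _ "x - G \<cdot> z"] z by fastforce
    moreover have "hnorm E ((1 - G) ^ n \<cdot> G \<cdot> z) \<le> \<epsilon> / 2"
    proof -
      have "hnorm E ((1 - G) ^ n \<cdot> G \<cdot> z) \<le> 1 / real (Suc n) * hnorm E z"
        using bounded_byD[OF transform_triple_decay[OF t, of n], of z]
        unfolding one_minus_power_commutes by (simp only: endo_app)
      also have "\<dots> \<le> \<epsilon> / 2"
      proof -
        have "hnorm E z \<le> (\<epsilon> / 2) * real N" using N \<epsilon>2 by (simp add: pos_divide_less_eq mult.commute)
        also have "\<dots> \<le> (\<epsilon> / 2) * real (Suc n)" using that \<epsilon>2 by (intro mult_left_mono) auto
        finally show ?thesis by (simp add: field_simps)
      qed
      finally show ?thesis .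
    qed
    ultimately show ?thesis
      using hnorm_triangle[of "(1 - G) ^ n \<cdot> (x - G \<cdot> z)" "(1 - G) ^ n \<cdot> G \<cdot> z"] by simp
  qed
  then show "\<exists>N. \<forall>n\<ge>N. norm (hnorm E ((1 - G) ^ n \<cdot> x) - 0) < \<epsilon>" by auto
qed

text \<open>The exponent is split into two halves, each taking one factor \<open>G\<close>; the
  constant 4 arises because \<open>n + 1\<close> is at most twice \<open>m + 1\<close> and at most
  twice \<open>n - m + 1\<close>.\<close>

lemma transform_triple_decay2:
  assumes t: "transform_triple E F F' G"
  shows "bounded_by E (4 / (real (Suc n))\<^sup>2) (G * G * (1 - G) ^ n)"
proof -
  define U m where "U = 1 - G" and "m = n div 2"
  have m: "n = m + (n - m)" "m \<le> n - m" by (auto simp: m_def)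
  have "G * G * U ^ n = (G * U ^ m) * (G * U ^ (n - m))"
  proof -
    have "G * G * U ^ n = G * (G * U ^ m) * U ^ (n - m)"
      by (subst m(1)) (simp add: power_add mult.assoc)
    also have "G * U ^ m = U ^ m * G" using one_minus_power_commutes by (simp add: U_def)
    finally show ?thesis by (simp add: mult.assoc)
  qed
  moreover have "bounded_by E (1 / real (Suc m) * (1 / real (Suc (n - m)))) ((G * U ^ m) * (G * U ^ (n - m)))"
    using transform_triple_decay[OF t] by (intro bounded_by_mult) (auto simp: U_def)
  moreover have "1 / real (Suc m) * (1 / real (Suc (n - m))) \<le> 4 / (real (Suc n))\<^sup>2"
  proof -
    have "real (Suc n) \<le> 2 * real (Suc m)" "real (Suc n) \<le> 2 * real (Suc (n - m))"
      by (auto simp: m_def)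
    then have "real (Suc n) * real (Suc n) \<le> (2 * real (Suc m)) * (2 * real (Suc (n - m)))"
      by (intro mult_mono) auto
    then show ?thesis by (simp add: divide_simps power2_eq_square del: of_nat_Suc)
  qed
  ultimately show ?thesis unfolding U_def using bounded_by_mono by auto
qed

text \<open>
  With \<open>V = S - M\<close> one has \<open>F1 S - S' F2 = F1 V + X G2\<close>, and \<open>G1 V + V G2\<close> is a sum of terms in which each
  summand carries enough factors \<open>G\<^sub>i\<close>. Iterating \<open>V = (1 - G1) V (1 - G2) + (G1 V + V G2 - G1 V G2)\<close> then
  gives a norm convergent series for \<open>V\<close>, all of whose terms end with \<open>G2\<close>.
\<close>

theorem commutator_compact:
  assumes t1: "transform_triple E F1 F1' G1" and t2: "transform_triple E F2 F2' G2"
    and S: "adjoint_pair E S Sa" "bounded_endo E S" and S': "adjoint_pair E S' Sa'" "bounded_endo E S'"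
    and comm: "bounded_commutator E F1 G1 F2 G2 S S'" and comm': "bounded_commutator E F2 G2 F1 G1 Sa Sa'"
    and b: "adjoint_pair E b b'" "bounded_endo E b" "compact_endo (G2 * b)"
  shows "compact_endo ((F1 * S - S' * F2) * b)"
proof -
  obtain M M' X X' where M: "adjoint_pair E M M'" "bounded_endo E M" and X: "adjoint_pair E X X'" "bounded_endo E X"
    and SG: "S * G2 = G1 * M" and FM: "F1 * M = S' * F2 + X * G2"
    using comm by (rule bounded_commutatorE)
  obtain N N' Y Y' where N: "adjoint_pair E N N'" and Y: "adjoint_pair E Y Y'" "bounded_endo E Y"
    and SaG: "Sa * G1 = G2 * N" and FN: "F2 * N = Sa' * F1 + Y * G1"
    using comm' by (rule bounded_commutatorE)
  have F1: "adjoint_pair E F1 F1'" "F1' * F1 + G1 * G1 = 1" "adjoint_pair E G1 G1"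
    and F2: "adjoint_pair E F2 F2'" "F2' * F2 + G2 * G2 = 1" "adjoint_pair E G2 G2"
    using t1 t2 positive_endo_adjoint by (auto simp: transform_triple_def)
  note bd = transform_triple_bounded[OF t1] transform_triple_bounded[OF t2]
  have Y': "bounded_endo E Y'" using bounded_endo_adjoint[OF Y] .
  have GS: "G1 * S = N' * G2"
    using adjoint_pair_mult[OF adjoint_pair_sym[OF S(1)] F1(3)] adjoint_pair_mult[OF F2(3) N]
    unfolding SaG by (rule adjoint_pair_unique)
  have NF: "N' * F2' = F1' * S' + G1 * Y'"
    using adjoint_pair_mult[OF F2(1) N]
      adjoint_pair_add[OF adjoint_pair_mult[OF adjoint_pair_sym[OF S'(1)] F1(1)] adjoint_pair_mult[OF Y(1) F1(3)]]
    unfolding FN by (rule adjoint_pair_unique)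
  define V where "V = S - M"
  have V: "adjoint_pair E V (Sa - M')" "bounded_endo E V"
    unfolding V_def by (intro adjoint_pair_diff bounded_endo_diff S M)+
  define W where "W = G1 * Y' * F2 - F1' * X * G2"
  have sylvester: "G1 * V + V * G2 = W * G2"
  proof -
    \<comment> \<open>The identity is inserted on the left of \<open>M\<close> and on the right of
      \<open>G1 * S\<close>. In \<open>G1 V + V G2 = G1 S - M G2\<close> the terms without
      \<open>X\<close> and \<open>Y'\<close> then cancel, and what remains carries either
      \<open>G2\<close> twice or \<open>G1\<close> on the left together with \<open>G2\<close> on
      the right.\<close>
    have "M = (F1' * F1 + G1 * G1) * M" by (simp add: F1)
    also have "\<dots> = F1' * (F1 * M) + G1 * (G1 * M)" by (simp add: distrib_right mult.assoc)
    also have "\<dots> = F1' * S' * F2 + F1' * X * G2 + G1 * S * G2"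
      unfolding FM SG[symmetric] by (simp add: distrib_left mult.assoc)
    finally have M_eq: "M = F1' * S' * F2 + F1' * X * G2 + G1 * S * G2" .
    have "F2' * F2 = 1 - G2 * G2" using F2(2) by (simp add: eq_diff_eq)
    then have G2: "G2 * (F2' * F2) = (F2' * F2) * G2" by (simp add: left_diff_distrib right_diff_distrib mult.assoc)
    have "G1 * S = G1 * S * (F2' * F2 + G2 * G2)" by (simp add: F2)
    also have "\<dots> = N' * (G2 * (F2' * F2)) + G1 * S * G2 * G2"
      by (simp add: distrib_left GS mult.assoc)
    also have "N' * (G2 * (F2' * F2)) = N' * F2' * F2 * G2" unfolding G2 by (simp add: mult.assoc)
    finally have GS_eq: "G1 * S = (F1' * S' + G1 * Y') * F2 * G2 + G1 * S * G2 * G2" unfolding NF .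
    have "G1 * V + V * G2 = G1 * S - M * G2"
      by (simp add: V_def left_diff_distrib right_diff_distrib SG)
    also have "\<dots> = ((F1' * S' + G1 * Y') * F2 * G2 + G1 * S * G2 * G2)
        - (F1' * S' * F2 + F1' * X * G2 + G1 * S * G2) * G2"
      by (simp only: GS_eq[symmetric] M_eq[symmetric])
    also have "\<dots> = W * G2"
      by (simp add: W_def left_diff_distrib distrib_right)
    finally show ?thesis .
  qed
  define U1 U2 Q where "U1 = 1 - G1" and "U2 = 1 - G2" and "Q = W - G1 * V"
  have U: "adjoint_pair E U1 U1" "adjoint_pair E U2 U2" "bounded_endo E U1" "bounded_endo E U2"
    unfolding U1_def U2_def by (intro adjoint_pair_intros F1 F2 bounded_endo_diff bounded_endo_1 bd)+
  have QG: "Q * G2 = V - U1 * V * U2"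
  proof -
    have "V - U1 * V * U2 = (G1 * V + V * G2) - G1 * V * G2"
      by (simp add: U1_def U2_def left_diff_distrib right_diff_distrib)
    then show ?thesis unfolding sylvester by (simp add: Q_def left_diff_distrib)
  qed
  define summand where "summand n = U1 ^ n * (Q * G2) * U2 ^ n" for n
  have telescope: "U1 ^ n * V * U2 ^ n = (\<Sum>k=n..<m. summand k) + U1 ^ m * V * U2 ^ m" if "n \<le> m" for n m
    using that
  proof (induction m rule: dec_induct)
    case (step m)
    have "U1 ^ m * V * U2 ^ m = summand m + U1 ^ Suc m * V * U2 ^ Suc m"
      unfolding summand_def QG power_Suc2[of U1] power_Suc[of U2] by (simp add: left_diff_distrib right_diff_distrib mult.assoc)
    then show ?case using step by (simp add: add.assoc)
  qed simp
  obtain c where c: "0 \<le> c" "\<And>n. bounded_by E (c / (real (Suc n))\<^sup>2) (summand n)"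
  proof -
    obtain k1 where k1: "0 \<le> k1" "bounded_by E k1 (Y' * F2)" using bounded_endo_mult[OF Y' bd(4)] by (rule bounded_endoE)
    obtain k2 where k2: "0 \<le> k2" "bounded_by E k2 (F1' * X)" using bounded_endo_mult[OF bd(2) X(2)] by (rule bounded_endoE)
    obtain k3 where k3: "0 \<le> k3" "bounded_by E k3 V" using V(2) by (rule bounded_endoE)
    have bU: "bounded_by E 1 (U1 ^ n)" for n
      using bounded_by_power[of 1 U1 n] transform_triple_contraction[OF t1] by (simp add: U1_def)
    have d1: "bounded_by E (1 / real (Suc n)) (U1 ^ n * G1)" for n
      using transform_triple_decay[OF t1, of n] unfolding one_minus_power_commutes U1_def .
    have d2: "bounded_by E (1 / real (Suc n)) (G2 * U2 ^ n)" for n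
      using transform_triple_decay[OF t2, of n] unfolding U2_def .
    have d3: "bounded_by E (4 / (real (Suc n))\<^sup>2) (G2 * G2 * U2 ^ n)" for n
      using transform_triple_decay2[OF t2, of n] unfolding U2_def .
    \<comment> \<open>The terms with \<open>Y'\<close> and with \<open>V\<close> have
      \<open>G1\<close> on the left and \<open>G2\<close> on the right, the term with
      \<open>X\<close> has \<open>G2\<close> twice. So each decays like \<open>1/(n+1)^2\<close>,
      which is summable.\<close>
    have eq: "summand n = (U1 ^ n * G1) * ((Y' * F2) * (G2 * U2 ^ n)) - U1 ^ n * ((F1' * X) * (G2 * G2 * U2 ^ n))
        - (U1 ^ n * G1) * (V * (G2 * U2 ^ n))" for n
      by (simp add: summand_def Q_def W_def left_diff_distrib right_diff_distrib mult.assoc)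
    have "bounded_by E (1 / real (Suc n) * (k1 * (1 / real (Suc n))) + 1 * (k2 * (4 / (real (Suc n))\<^sup>2))
      + 1 / real (Suc n) * (k3 * (1 / real (Suc n)))) (summand n)" for n
      unfolding eq using k1 k2 k3 by (intro bounded_by_diff bounded_by_mult bU d1 d2 d3) auto
    moreover have "1 / real (Suc n) * (k1 * (1 / real (Suc n))) + 1 * (k2 * (4 / (real (Suc n))\<^sup>2))
      + 1 / real (Suc n) * (k3 * (1 / real (Suc n))) = (k1 + 4 * k2 + k3) / (real (Suc n))\<^sup>2" for n
      by (simp add: power2_eq_square add_divide_distrib)
    ultimately show ?thesis using that[of "k1 + 4 * k2 + k3"] k1 k2 k3 by simp
  qed
  have Vb: "compact_endo (V * b)"
  proof (rule compact_endo_closed[OF adjoint_pair_mult[OF V(1) b(1)]])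
    fix \<epsilon> :: real assume \<epsilon>: "0 < \<epsilon>"
    obtain L where L: "0 \<le> L" "bounded_by E L b" using b(2) by (rule bounded_endoE)
    define \<delta> where "\<delta> = \<epsilon> / (L + 1)"
    have \<delta>: "0 < \<delta>" using \<epsilon> L by (simp add: \<delta>_def)
    have "summable (\<lambda>n. c * (1 / (real (Suc n))\<^sup>2))"
      by (rule summable_mult) (use inverse_squares_sums in \<open>simp add: sums_iff add.commute\<close>)
    then have "summable (\<lambda>n. c / (real (Suc n))\<^sup>2)" by simp
    then obtain n where n: "\<And>m. m \<ge> n \<Longrightarrow> norm (\<Sum>k=n..<m. c / (real (Suc k))\<^sup>2) < \<delta>"
      using \<delta> unfolding summable_Cauchy by (metis le_refl)
    \<comment> \<open>The remainders tend to 0 only strongly, yet the telescoped sum from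
      \<open>n\<close> to \<open>m\<close> is bounded uniformly in \<open>m\<close>. Letting
      \<open>m\<close> grow at a fixed vector therefore gives a norm bound for the remainder at
      \<open>n\<close>.\<close>
    have tail: "bounded_by E \<delta> (U1 ^ n * V * U2 ^ n)"
      unfolding bounded_by_def
    proof
      fix x
      have le: "hnorm E ((U1 ^ n * V * U2 ^ n) \<cdot> x) - hnorm E ((U1 ^ m * V * U2 ^ m) \<cdot> x) \<le> \<delta> * hnorm E x" if "n \<le> m" for m
      proof -
        have "bounded_by E (\<Sum>k=n..<m. c / (real (Suc k))\<^sup>2) (\<Sum>k=n..<m. summand k)" 
          by (intro bounded_by_sum c)
        then have "bounded_by E \<delta> (\<Sum>k=n..<m. summand k)"
          by (rule bounded_by_mono) (rule less_imp_le[OF le_less_trans[OF abs_ge_self n[OF that, unfolded real_norm_def]]])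
        then have "hnorm E ((\<Sum>k=n..<m. summand k) \<cdot> x) \<le> \<delta> * hnorm E x" by (rule bounded_byD)
        then show ?thesis
          unfolding telescope[OF that] using hnorm_triangle[of "(\<Sum>k=n..<m. summand k) \<cdot> x" "(U1 ^ m * V * U2 ^ m) \<cdot> x"]
          by (simp only: endo_app)
      qed
      have "(\<lambda>m. hnorm E ((U1 ^ m * V * U2 ^ m) \<cdot> x)) \<longlonglongrightarrow> 0"
      proof (rule tendsto_sandwich[OF _ _ tendsto_const])
        have "hlim E (\<lambda>m. V \<cdot> U2 ^ m \<cdot> x) 0"
          using hlim_app[OF V(2) transform_triple_power_tendsto_0[OF t2, of x]] by (simp add: U2_def)
        then show "(\<lambda>m. hnorm E (V \<cdot> U2 ^ m \<cdot> x)) \<longlonglongrightarrow> 0" by (simp add: hlim_def)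
        have "hnorm E (U1 ^ m \<cdot> y) \<le> 1 * hnorm E y" for m y
          using bounded_by_power[of 1 U1 m] transform_triple_contraction[OF t1] by (simp add: U1_def bounded_by_def)
        then show "\<forall>\<^sub>F m in sequentially. hnorm E ((U1 ^ m * V * U2 ^ m) \<cdot> x) \<le> hnorm E (V \<cdot> U2 ^ m \<cdot> x)" by simp
      qed simp
      then have "(\<lambda>m. hnorm E ((U1 ^ n * V * U2 ^ n) \<cdot> x) - hnorm E ((U1 ^ m * V * U2 ^ m) \<cdot> x))
        \<longlonglongrightarrow> hnorm E ((U1 ^ n * V * U2 ^ n) \<cdot> x) - 0"
        by (intro tendsto_diff tendsto_const)
      then have "hnorm E ((U1 ^ n * V * U2 ^ n) \<cdot> x) - 0 \<le> \<delta> * hnorm E x"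
        by (rule LIMSEQ_le_const2) (intro exI[of _ n] allI impI le)
      then show "hnorm E ((U1 ^ n * V * U2 ^ n) \<cdot> x) \<le> \<delta> * hnorm E x" by simp
    qed
    have "compact_endo ((\<Sum>k=0..<n. summand k) * b)"
      unfolding sum_distrib_right
    proof (rule compact_endo_sum)
      fix k
      have "G2 * U2 ^ k = U2 ^ k * G2" unfolding U2_def by (rule one_minus_power_commutes)
      moreover have "summand k * b = U1 ^ k * Q * (G2 * U2 ^ k) * b" by (simp add: summand_def mult.assoc)
      ultimately have "summand k * b = (U1 ^ k * Q * U2 ^ k) * (G2 * b)" by (simp add: mult.assoc)
      moreover have "compact_endo ((U1 ^ k * Q * U2 ^ k) * (G2 * b))"
      proof (rule compact_endo_mult_left[OF _ _ b(3)])
        have "adjoint_pair E Q (F2' * (Y * G1) - G2 * (X' * F1) - (Sa - M') * G1)"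
          unfolding Q_def W_def
          by (intro adjoint_pair_mult adjoint_pair_diff F1 F2 X V(1) adjoint_pair_sym[OF Y(1)] adjoint_pair_sym[OF F1(1)])
        then show "adjoint_pair E (U1 ^ k * Q * U2 ^ k)
          (U2 ^ k * ((F2' * (Y * G1) - G2 * (X' * F1) - (Sa - M') * G1) * U1 ^ k))"
          by (intro adjoint_pair_mult adjoint_pair_power U)
        show "bounded_endo E (U1 ^ k * Q * U2 ^ k)"
          unfolding Q_def W_def by (intro bounded_endo_mult bounded_endo_power bounded_endo_diff U X Y' V bd)
      qed
      ultimately show "compact_endo (summand k * b)" by simp
    qed
    moreover have "V * b - (\<Sum>k=0..<n. summand k) * b = U1 ^ n * V * U2 ^ n * b"
    proof -
      have "V = (\<Sum>k=0..<n. summand k) + U1 ^ n * V * U2 ^ n" using telescope[of 0 n] by simp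
      then have "V - (\<Sum>k=0..<n. summand k) = U1 ^ n * V * U2 ^ n" by (simp add: diff_eq_eq add.commute)
      then show ?thesis by (simp only: left_diff_distrib[symmetric])
    qed
    moreover have "bounded_by E \<epsilon> (U1 ^ n * V * U2 ^ n * b)"
    proof -
      have "bounded_by E (\<delta> * L) (U1 ^ n * V * U2 ^ n * b)" by (rule bounded_by_mult) (use \<delta> tail L in auto)
      moreover have "\<delta> * L \<le> \<epsilon>" using \<epsilon> L by (simp add: \<delta>_def field_simps)
      ultimately show ?thesis by (rule bounded_by_mono)
    qed
    ultimately show "\<exists>S. compact_endo S \<and> bounded_by E \<epsilon> (V * b - S)" by metis
  qed
  have "(F1 * S - S' * F2) * b = F1 * (V * b) + X * (G2 * b)"
    using FM by (simp add: V_def left_diff_distrib right_diff_distrib mult.assoc[symmetric] distrib_right)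
  then show ?thesis
    using compact_endo_add[OF compact_endo_mult_left[OF F1(1) bd(1) Vb] compact_endo_mult_left[OF X b(3)]] by simp
qed

text \<open>The adjoint of \<open>D1 S - S' D2 = X\<close> reads
  \<open>D2a Sa' - Sa D1a = - X'\<close>, with \<open>D1a\<close>, \<open>D2a\<close> the adjoints
  of \<open>D1\<close>, \<open>D2\<close>. Only bounded data occur, so the domain statement has to
  be supplied as a factorization through \<open>H2\<close>.\<close>

lemma bounded_commutator_dual:
  assumes t1: "transform_triple E F1 F1' G1" and t2: "transform_triple E F2 F2' G2"
    and t1': "transform_triple E F1' F1 H1" and t2': "transform_triple E F2' F2 H2"
    and FG1: "F1 * G1 = H1 * F1" and FG2: "F2 * G2 = H2 * F2"
    and S: "adjoint_pair E S Sa" "bounded_endo E S" and S': "adjoint_pair E S' Sa'" "bounded_endo E S'"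
    and comm: "bounded_commutator E F1 G1 F2 G2 S S'"
  shows "bounded_commutator E F2' H2 F1' H1 Sa' Sa"
proof -
  obtain M M' X X' where M: "adjoint_pair E M M'" "bounded_endo E M" and X: "adjoint_pair E X X'" "bounded_endo E X"
    and SG: "S * G2 = G1 * M" and FM: "F1 * M = S' * F2 + X * G2"
    using comm by (rule bounded_commutatorE)
  have F1: "adjoint_pair E F1 F1'" "adjoint_pair E G1 G1" "adjoint_pair E H1 H1"
    and F2: "adjoint_pair E F2 F2'" "F2' * F2 + G2 * G2 = 1" "F2 * F2' + H2 * H2 = 1" "adjoint_pair E G2 G2" "adjoint_pair E H2 H2"
    using t1 t2 t1' t2' positive_endo_adjoint by (auto simp: transform_triple_def)
  note bd = transform_triple_bounded[OF t1] transform_triple_bounded[OF t2] transform_triple_bounded[OF t1'] transform_triple_bounded[OF t2']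
  have GF1: "G1 * F1' = F1' * H1"
    using adjoint_pair_mult[OF F1(1,2)] adjoint_pair_mult[OF F1(3,1)] unfolding FG1 by (rule adjoint_pair_unique)
  have GF2: "G2 * F2' = F2' * H2"
    using adjoint_pair_mult[OF F2(1,4)] adjoint_pair_mult[OF F2(5,1)] unfolding FG2 by (rule adjoint_pair_unique)
  have GS: "G2 * Sa = M' * G1"
    using adjoint_pair_mult[OF S(1) F2(4)] adjoint_pair_mult[OF F1(2) M(1)] unfolding SG by (rule adjoint_pair_unique)
  have MF: "M' * F1' = F2' * Sa' + G2 * X'"
    using adjoint_pair_mult[OF F1(1) M(1)]
      adjoint_pair_add[OF adjoint_pair_mult[OF S'(1) F2(1)] adjoint_pair_mult[OF X(1) F2(4)]]
    unfolding FM by (rule adjoint_pair_unique)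
  \<comment> \<open>The value that the adjoint of \<open>D2\<close> should take on
    \<open>Sa' * H1\<close>, read off from the formal identity.\<close>
  define Z where "Z = Sa * F1' - X' * H1"
  have GZ: "G2 * Z = F2' * Sa' * H1"
  proof -
    have "G2 * Z = M' * (G1 * F1') - G2 * X' * H1"
      unfolding Z_def right_diff_distrib mult.assoc[symmetric] GS ..
    also have "M' * (G1 * F1') = (F2' * Sa' + G2 * X') * H1"
      unfolding GF1 mult.assoc[symmetric] MF ..
    finally show ?thesis by (simp add: distrib_right)
  qed
  \<comment> \<open>A vector \<open>u\<close> in the domain of the adjoint of \<open>D2\<close>,
    with image \<open>v\<close>, equals \<open>H2 (H2 u + F2 v)\<close>. \<open>P\<close> is this
    preimage for \<open>u = Sa' H1 x\<close> and \<open>v = Z x\<close>.\<close>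
  define P where "P = H2 * Sa' * H1 + F2 * Z"
  have adj: "adjoint_pair E Z (F1 * S - H1 * X)"
    unfolding Z_def by (intro adjoint_pair_diff adjoint_pair_mult adjoint_pair_sym[OF S(1)] adjoint_pair_sym[OF F1(1)]
        adjoint_pair_sym[OF X(1)] F1)
  have "adjoint_pair E P (H1 * (S' * H2) + (F1 * S - H1 * X) * F2')"
    unfolding P_def by (intro adjoint_pair_add adjoint_pair_mult adj F1 F2 adjoint_pair_sym[OF S'(1)])
  moreover have "bounded_endo E P"
    unfolding P_def Z_def
    by (intro bounded_endo_add bounded_endo_mult bounded_endo_diff bd bounded_endo_adjoint[OF S] bounded_endo_adjoint[OF S']
        bounded_endo_adjoint[OF X])
  moreover have "Sa' * H1 = H2 * P"
  proof -
    have "H2 * P = H2 * H2 * (Sa' * H1) + F2 * (G2 * Z)"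
      by (simp add: P_def distrib_left mult.assoc[symmetric] FG2)
    also have "\<dots> = (F2 * F2' + H2 * H2) * (Sa' * H1)"
      unfolding GZ by (simp add: distrib_right mult.assoc)
    finally show ?thesis by (simp add: F2)
  qed
  moreover have "F2' * P = Sa * F1' + (- X') * H1"
  proof -
    have "F2' * P = (F2' * H2) * (Sa' * H1) + F2' * F2 * Z"
      by (simp add: P_def distrib_left mult.assoc)
    also have "(F2' * H2) * (Sa' * H1) = G2 * (G2 * Z)"
      unfolding GZ GF2[symmetric] by (simp add: mult.assoc)
    also have "G2 * (G2 * Z) + F2' * F2 * Z = (F2' * F2 + G2 * G2) * Z"
      by (simp add: distrib_right mult.assoc add.commute)
    finally show ?thesis by (simp add: F2 Z_def)
  qed
  ultimately show ?thesis
    unfolding bounded_commutator_def using adjoint_pair_minus[OF adjoint_pair_sym[OF X(1)]]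
      bounded_endo_minus[OF bounded_endo_adjoint[OF X]] by blast
qed

text \<open>The polynomial \<open>1 - (1 - G)^n\<close> is divisible by \<open>G\<close>, so
  \<open>a G\<close> differs from the compact \<open>a G^2 P\<close> by
  \<open>a G (1 - G)^n\<close>, which the decay estimate makes small in norm.\<close>

lemma compact_endo_mult_root:
  assumes t: "transform_triple E F F' G" and a: "adjoint_pair E a a'" "bounded_endo E a"
    and c: "compact_endo (a * (G * G))"
  shows "compact_endo (a * G)"
proof -
  have G: "adjoint_pair E G G" using t positive_endo_adjoint by (auto simp: transform_triple_def)
  note bd = transform_triple_bounded[OF t]
  show ?thesis
  proof (rule compact_endo_closed[OF adjoint_pair_mult[OF a(1) G]])
    fix \<epsilon> :: real assume \<epsilon>: "0 < \<epsilon>"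
    obtain K where K: "0 \<le> K" "bounded_by E K a" using a(2) by (rule bounded_endoE)
    obtain n :: nat where "K / \<epsilon> < real n" using reals_Archimedean2 by blast
    then have n: "K * (1 / real (Suc n)) \<le> \<epsilon>" using \<epsilon> by (simp add: field_simps)
    have "\<exists>P P'. adjoint_pair E P P' \<and> bounded_endo E P \<and> 1 - (1 - G) ^ n = G * P"
    proof (induction n)
      case 0
      then show ?case using adjoint_pair_0 bounded_endo_0 by (intro exI[of _ 0]) simp
    next
      case (Suc n)
      then obtain P P' where P: "adjoint_pair E P P'" "bounded_endo E P" "1 - (1 - G) ^ n = G * P" by blast
      have "1 - (1 - G) ^ Suc n = G * (P + (1 - G) ^ n)"
        using P(3) by (simp add: distrib_left left_diff_distrib flip: P(3))
      moreover have "adjoint_pair E (P + (1 - G) ^ n) (P' + (1 - G) ^ n)" "bounded_endo E (P + (1 - G) ^ n)"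
        by (intro adjoint_pair_intros P G bounded_endo_add bounded_endo_power bounded_endo_diff bounded_endo_1 bd)+
      ultimately show ?case by blast
    qed
    then obtain P P' where P: "adjoint_pair E P P'" "bounded_endo E P" "1 - (1 - G) ^ n = G * P" by blast
    have "compact_endo (a * (G * G) * P)" by (rule compact_endo_mult_right[OF P(1,2) c])
    moreover have "a * G - a * (G * G) * P = a * (G * (1 - G) ^ n)"
      by (simp add: mult.assoc right_diff_distrib flip: P(3))
    moreover have "bounded_by E \<epsilon> (a * (G * (1 - G) ^ n))"
      using bounded_by_mult[OF K transform_triple_decay[OF t, of n]] n by (rule bounded_by_mono)
    ultimately show "\<exists>S. compact_endo S \<and> bounded_by E \<epsilon> (a * G - S)" by metis
  qed
qed

text \<open>\<open>m'\<close> and \<open>T'\<close> stand for the grading conjugates. Two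
  compactness hypotheses occur because the commutators with \<open>m\<close> and \<open>T\<close>
  are absorbed by \<open>G\<close>, while the adjoint of the one with \<open>ma\<close> belongs to
  \<open>F'\<close> and is absorbed by \<open>H\<close>.\<close>

theorem product_commutator_compact:
  assumes t: "transform_triple E F F' G" and t': "transform_triple E F' F H" and FG: "F * G = H * F"
    and m: "adjoint_pair E m ma" "bounded_endo E m" and m': "adjoint_pair E m' ma'" "bounded_endo E m'"
    and T: "adjoint_pair E T T" "bounded_endo E T" and T': "adjoint_pair E T' T'" "bounded_endo E T'"
    and cm: "bounded_commutator E F G F G m m'" and cma: "bounded_commutator E F G F G ma ma'"
    and cT: "bounded_commutator E F G F G T T'"
    and mG: "compact_endo (m * G)" and mH: "compact_endo (m' * H)"
  shows "compact_endo (F * (m * T * ma) - (m' * T' * ma') * F)"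
proof -
  have F: "adjoint_pair E F F'" "adjoint_pair E G G" "adjoint_pair E H H"
    using t t' positive_endo_adjoint by (auto simp: transform_triple_def)
  note bd = transform_triple_bounded[OF t] transform_triple_bounded[OF t']
  note ma = adjoint_pair_sym[OF m(1)] bounded_endo_adjoint[OF m]
  note ma' = adjoint_pair_sym[OF m'(1)] bounded_endo_adjoint[OF m']
  have F'H: "F' * H = G * F'"
    using adjoint_pair_mult[OF F(3,1)] adjoint_pair_mult[OF F(1,2)] unfolding FG by (rule adjoint_pair_unique)
  have Gma: "compact_endo (G * ma)" using compact_endo_adjoint[OF adjoint_pair_mult[OF m(1) F(2)] mG] .
  have Hma: "compact_endo (H * ma')" using compact_endo_adjoint[OF adjoint_pair_mult[OF m'(1) F(3)] mH] .
  \<comment> \<open>Taking adjoints in \<open>A G0 = G0 M\<close> gives \<open>G0 A = M' G0\<close>,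
    so compactness of \<open>G0 b\<close> passes through \<open>A\<close>.\<close>
  have absorb: "compact_endo (G0 * (A * b))"
    if c: "bounded_commutator E F0 G0 F0 G0 A A'" and A: "adjoint_pair E A A" and G0: "adjoint_pair E G0 G0"
      and G0b: "compact_endo (G0 * b)" for F0 G0 A A' b
  proof -
    obtain M M' where M: "adjoint_pair E M M'" "bounded_endo E M" "A * G0 = G0 * M"
      using c unfolding bounded_commutator_def by blast
    have "G0 * A = M' * G0"
      using adjoint_pair_mult[OF A G0] adjoint_pair_mult[OF G0 M(1)] unfolding M(3) by (rule adjoint_pair_unique)
    then have "G0 * (A * b) = M' * (G0 * b)" by (simp add: mult.assoc[symmetric])
    then show ?thesis
      using compact_endo_mult_left[OF adjoint_pair_sym[OF M(1)] bounded_endo_adjoint[OF M(1,2)] G0b] by simp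
  qed
  have 1: "compact_endo ((F * m - m' * F) * (T * ma))"
    by (rule commutator_compact[OF t t m m' cm cma adjoint_pair_mult[OF T(1) ma(1)] bounded_endo_mult[OF T(2) ma(2)]
          absorb[OF cT T(1) F(2) Gma]])
  have 2: "compact_endo ((F * T - T' * F) * ma)"
    by (rule commutator_compact[OF t t T T' cT cT ma Gma])
  have cT': "bounded_commutator E F' H F' H T' T"
    by (rule bounded_commutator_dual[OF t t t' t' FG FG T T' cT])
  have 3: "compact_endo ((F' * m' - m * F') * (T' * ma'))"
    by (rule commutator_compact[OF t' t' m' m bounded_commutator_dual[OF t t t' t' FG FG ma ma' cma]
          bounded_commutator_dual[OF t t t' t' FG FG m m' cm]
          adjoint_pair_mult[OF T'(1) ma'(1)] bounded_endo_mult[OF T'(2) ma'(2)] absorb[OF cT' T'(1) F(3) Hma]])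
  have "adjoint_pair E ((F' * m' - m * F') * (T' * ma')) ((m' * T') * (ma' * F - F * ma))"
    by (intro adjoint_pair_mult adjoint_pair_diff adjoint_pair_sym[OF F(1)] m m' T' ma')
  from compact_endo_adjoint[OF this 3] have 3: "compact_endo ((m' * T') * (ma' * F - F * ma))" .
  have "F * (m * T * ma) - (m' * T' * ma') * F =
    (F * m - m' * F) * (T * ma) + m' * ((F * T - T' * F) * ma) - (m' * T') * (ma' * F - F * ma)"
    by (simp add: algebra_simps)
  then show ?thesis
    using compact_endo_diff[OF compact_endo_add[OF 1 compact_endo_mult_left[OF m' 2]] 3] by simp
qed

end

section \<open>Regular operators\<close>

context hilbert_module
begin

section \<open>Uniqueness of positive roots and of solutions of Sylvester equations\<close>

lemma positive_endo_add_eq_0: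
  assumes "positive_endo E a" "positive_endo E b" "a + b = 0" shows "a = 0"
proof -
  have "0 *\<^sub>R 1 - a = b" using minus_unique[OF assms(3)] by simp
  then have "bounded_by E 0 a" using positive_endo_bounded_by[of a 0] assms by simp
  then show ?thesis by (intro bounded_by_eq_0) (auto intro: bounded_by_mono)
qed

lemma positive_endo_conjugate:
  assumes "positive_endo E a" "adjoint_pair E p p'" "bounded_endo E p" shows "positive_endo E (p' * a * p)"
proof -
  obtain z where z: "positive_endo E z" "z * z = a" using positive_endo_root[OF assms(1)] by metis
  have "positive_endo E ((p' * z) * (z * p))"
    by (intro positive_endo_adjoint_mult adjoint_pair_mult positive_endo_adjoint bounded_endo_mult positive_endo_bounded z assms)
  then show ?thesis by (simp add: mult.assoc flip: z(2))
qed

text \<open>Any positive root \<open>r\<close> commutes with its square and therefore with the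
  constructed root \<open>z\<close>. For \<open>p = r - z\<close> the positive operators
  \<open>p r p\<close> and \<open>p z p\<close> add up to 0, so both vanish and
  \<open>p^3 = 0\<close>. Thus both given roots equal \<open>z\<close>.\<close>

lemma positive_endo_root_unique:
  assumes s: "positive_endo E s" and g: "positive_endo E g" and eq: "s * s = g * g"
  shows "s = g"
proof -
  have "r = z" if r: "positive_endo E r" "r * r = g * g" and z: "positive_endo E z" "z * z = g * g"
    "\<And>A. bounded_endo E A \<Longrightarrow> A * (g * g) = g * g * A \<Longrightarrow> A * z = z * A" for r z
  proof -
    have rz: "r * z = z * r"
      by (rule z(3)[OF positive_endo_bounded[OF r(1)]]) (simp add: mult.assoc flip: r(2))
    define p where "p = r - z"
    have p: "adjoint_pair E p p" "bounded_endo E p"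
      using r(1) z(1) positive_endo_adjoint positive_endo_bounded by (auto simp: p_def intro: adjoint_pair_diff bounded_endo_diff)
    have "(r + z) * p = 0" using rz r(2) z(2) by (simp add: p_def right_diff_distrib distrib_right)
    then have "p * r * p + p * z * p = 0" by (metis distrib_left distrib_right mult.assoc mult_zero_right)
    moreover have "positive_endo E (p * r * p)" "positive_endo E (p * z * p)"
      using positive_endo_conjugate p r(1) z(1) by blast+
    ultimately have "p * r * p = 0" "p * z * p = 0"
      using positive_endo_add_eq_0 by (blast, metis add.commute positive_endo_add_eq_0)
    then have "p * p * p = 0" by (subst (2) p_def) (simp add: left_diff_distrib right_diff_distrib)
    then have "(p * p) * (p * p) = 0" by (simp add: mult.assoc[symmetric])
    then have "p * p = 0" by (rule self_adjoint_square_eq_0[OF adjoint_pair_mult[OF p(1) p(1)]])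
    then have "p = 0" by (rule self_adjoint_square_eq_0[OF p(1)])
    then show ?thesis by (simp add: p_def)
  qed
  moreover obtain z where "positive_endo E z" "z * z = g * g"
    "\<And>A. bounded_endo E A \<Longrightarrow> A * (g * g) = g * g * A \<Longrightarrow> A * z = z * A"
    using positive_endo_root[OF positive_endo_square[OF positive_endo_adjoint positive_endo_bounded, OF g g]] by blast
  ultimately show ?thesis using s g eq by metis
qed

lemma positive_op_app: "positive_endo E T \<Longrightarrow> positive_op E (app T)"
proof -
  assume "positive_endo E T"
  then obtain z where z: "positive_endo E z" "z * z = T" using positive_endo_root by metis
  then have "adjoint_pair E z z" by (simp add: positive_endo_adjoint)
  then show ?thesis
    unfolding positive_op_def using z(2) by (intro exI[of _ "app z"]) (auto simp: adjointableI adj_app fun_eq_iff)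
qed

lemma sqrt_op_app:
  assumes g: "positive_endo E g" shows "sqrt_op E (app (g * g)) = app g"
  unfolding sqrt_op_def
proof (rule the_equality)
  show "positive_op E (app g) \<and> app g \<circ> app g = app (g * g)" using positive_op_app[OF g] by (simp add: fun_eq_iff)
  fix S assume S: "positive_op E S \<and> S \<circ> S = app (g * g)"
  then obtain f where f: "adjointable E E f" "S = adj E E f \<circ> f" unfolding positive_op_def by blast
  obtain b b' where b: "f = app b" "adjoint_pair E b b'" "adj E E f = app b'" using adjointable_endoE[OF f(1)] .
  define s where "s = b' * b"
  have S_eq: "S = app s" by (simp add: f(2) b(1) adj_app[OF b(2)] s_def fun_eq_iff)
  then have "app s \<circ> app s = app (g * g)" using S by simp
  then have ss: "s * s = g * g" by (intro endo_eqI) (simp add: fun_eq_iff)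
  have s: "adjoint_pair E s s" unfolding s_def by (intro adjoint_pair_mult adjoint_pair_sym[OF b(2)] b(2))
  \<comment> \<open>\<open>positive_op\<close> asks for adjointability only. The estimate
    \<open>||A x||^2 \<le> ||x|| ||A' A x||\<close> brings boundedness from \<open>s^2\<close> to
    \<open>s\<close> and from \<open>s = b' b\<close> to \<open>b\<close>.\<close>
  have square: "bounded_endo E A" if "adjoint_pair E A A'" "bounded_endo E (A' * A)" for A A'
  proof -
    obtain K where "0 \<le> K" "bounded_by E K (A' * A)" using \<open>bounded_endo E (A' * A)\<close> by (rule bounded_endoE)
    then have "bounded_by E (sqrt K) A" by (intro bounded_by_adjoint_square[OF that(1)]) simp_all
    then show ?thesis by (rule bounded_byI_endo)
  qed
  have "bounded_endo E s"
    by (rule square[OF s], unfold ss) (intro bounded_endo_mult positive_endo_bounded g)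
  then have "bounded_endo E b" unfolding s_def by (rule square[OF b(2)])
  then have "positive_endo E s" unfolding s_def by (rule positive_endo_adjoint_mult[OF b(2)])
  then show "S = app g" using positive_endo_root_unique[OF _ g ss] S_eq by simp
qed

text \<open>Multiplication by \<open>p'\<close> from the left gives \<open>q g = - p' h p\<close>
  with \<open>q = p' p\<close>. This is self-adjoint, so \<open>q\<close> and \<open>g\<close>
  commute and \<open>q g\<close> is both positive and negative, hence 0; density of the range of
  \<open>g\<close> then kills \<open>q\<close>.\<close>

lemma positive_endo_sylvester_zero:
  assumes h: "positive_endo E h" and g: "positive_endo E g" "hdense E (range (app g))"
    and p: "adjoint_pair E p p'" "bounded_endo E p" and eq: "h * p + p * g = 0"
  shows "p = 0"
proof -
  have g': "adjoint_pair E g g" using g(1) by (rule positive_endo_adjoint)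
  define q where "q = p' * p"
  have q: "positive_endo E q" unfolding q_def using p by (rule positive_endo_adjoint_mult)
  have h': "positive_endo E (p' * h * p)" using h p by (rule positive_endo_conjugate)
  have "p' * (h * p + p * g) = p' * h * p + q * g" by (simp add: q_def distrib_left mult.assoc)
  then have sum: "p' * h * p + q * g = 0" using eq by simp
  then have qg: "q * g = - (p' * h * p)" by (simp add: eq_neg_iff_add_eq_0 add.commute)
  have "adjoint_pair E (q * g) (q * g)"
    unfolding qg by (intro adjoint_pair_minus positive_endo_adjoint h')
  moreover have "adjoint_pair E (q * g) (g * q)"
    by (intro adjoint_pair_mult positive_endo_adjoint q g')
  ultimately have "q * g = g * q" using adjoint_pair_unique by blast
  then have "positive_endo E (q * g)" using q g(1) by (intro positive_endo_mult)
  then have qg0: "q * g = 0" using positive_endo_add_eq_0[OF _ h'] sum by (simp add: add.commute)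
  have "q \<cdot> x = 0" for x
  proof -
    obtain s where s: "\<And>n. s n \<in> range (app g)" "hlim E s x" using hdense_seq[OF g(2)] by blast
    have "q \<cdot> s n = 0" for n using s(1)[of n] qg0 by (metis endo_app(1,6) rangeE)
    then show ?thesis using hlim_unique[OF hlim_app[OF positive_endo_bounded[OF q] s(2)]] by simp
  qed
  then have "q = 0" by (intro endo_eqI) simp
  have "p \<cdot> x = 0" for x
    using hnorm_app_power2_le[OF p(1), of x] \<open>q = 0\<close> by (simp add: q_def del: endo_app(6))
  then show ?thesis by (intro endo_eqI) simp
qed

lemma one_minus_power_eq: "\<exists>P. 1 - (1 - g) ^ n = g * (P :: 'e endo)"
proof (induction n)
  case 0
  show ?case by (rule exI[of _ 0]) simp
next
  case (Suc n)
  then obtain P where P: "1 - (1 - g) ^ n = g * P" by blast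
  have "1 - (1 - g) ^ Suc n = g * (P + (1 - g) ^ n)"
    by (simp add: distrib_left left_diff_distrib flip: P)
  then show ?case by blast
qed

lemma eq_of_dense: "hdense E S \<Longrightarrow> (\<And>x. x \<in> S \<Longrightarrow> ip E x y = ip E x z) \<Longrightarrow> y = z"
proof -
  assume S: "hdense E S" and eq: "\<And>x. x \<in> S \<Longrightarrow> ip E x y = ip E x z"
  have "hnorm E (y - z) \<le> 0"
    by (rule hnorm_le_of_dense[OF S]) (use eq in \<open>simp_all add: ip_diff_left, metis ip_star\<close>)
  then show ?thesis by (metis antisym eq_iff_diff_eq_0 hnorm_eq_0 hnorm_nonneg)
qed

lemma adj_op_eqI:
  assumes "hdense E (dom D)" "\<And>x. x \<in> dom D \<Longrightarrow> ip E (the (D x)) y = ip E x z"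
  shows "adj_op E E D y = Some z"
  unfolding adj_op_def using eq_of_dense[OF assms(1)] assms(2) by (auto intro!: the_equality)

end

locale regular_operator = hilbert_module E
  for E :: "('e::complex_vector, 'b::cstar_algebra) hmodule" +
  fixes D :: "'e \<rightharpoonup> 'e"
  assumes regular: "regular_op E D"
begin

abbreviation val :: "'e \<Rightarrow> 'e" where "val x \<equiv> the (D x)"
abbreviation Dadj :: "'e \<rightharpoonup> 'e" where "Dadj \<equiv> adj_op E E D"

section \<open>Domain, adjoint and resolvent of a regular operator\<close>

lemma dom_csubspace: "csubspace (dom D)"
  and dom_dense: "hdense E (dom D)" and dom_adj_dense: "hdense E (dom Dadj)"
  and ran_dense: "hdense E (ran (one_plus_adj_comp E D))"
  and val_add: "x \<in> dom D \<Longrightarrow> y \<in> dom D \<Longrightarrow> val (x + y) = val x + val y"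
  and val_scaleC: "x \<in> dom D \<Longrightarrow> val (c *\<^sub>C x) = c *\<^sub>C val x"
  using regular unfolding regular_op_def linear_op_def by auto

lemma closed: "(\<And>n. s n \<in> dom D) \<Longrightarrow> hlim E s x \<Longrightarrow> hlim E (\<lambda>n. val (s n)) y \<Longrightarrow> D x = Some y"
  using regular unfolding regular_op_def closed_op_def by blast

lemma dom_diff: "x \<in> dom D \<Longrightarrow> y \<in> dom D \<Longrightarrow> x - y \<in> dom D"
  using csubspace_diff[OF dom_csubspace] .

lemma val_diff: "x \<in> dom D \<Longrightarrow> y \<in> dom D \<Longrightarrow> val (x - y) = val x - val y"
  using val_add[of "x - y" y] dom_diff by simp

lemma Dadj_eqI: "(\<And>x. x \<in> dom D \<Longrightarrow> ip E (val x) y = ip E x z) \<Longrightarrow> Dadj y = Some z"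
  by (rule adj_op_eqI[OF dom_dense])

lemma Dadj_ip:
  assumes "y \<in> dom Dadj" "x \<in> dom D" shows "ip E (val x) y = ip E x (the (Dadj y))"
proof -
  have "\<exists>z. \<forall>x\<in>dom D. ip E (val x) y = ip E x z"
  proof (rule ccontr)
    assume "\<not> ?thesis"
    then have "Dadj y = None" by (simp add: adj_op_def)
    then show False using assms(1) by auto
  qed
  then obtain z where "\<forall>x\<in>dom D. ip E (val x) y = ip E x z" by blast
  then show ?thesis using Dadj_eqI[of y z] assms(2) by auto
qed

lemma Dadj_ip': "y \<in> dom Dadj \<Longrightarrow> x \<in> dom D \<Longrightarrow> ip E y (val x) = ip E (the (Dadj y)) x"
  using Dadj_ip by (metis ip_star)

lemma Dadj_add: "y \<in> dom Dadj \<Longrightarrow> z \<in> dom Dadj \<Longrightarrow> Dadj (y + z) = Some (the (Dadj y) + the (Dadj z))"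
  by (rule Dadj_eqI) (simp add: ip_add_right Dadj_ip)

lemma Dadj_scaleC: "y \<in> dom Dadj \<Longrightarrow> Dadj (c *\<^sub>C y) = Some (c *\<^sub>C the (Dadj y))"
  by (rule Dadj_eqI) (simp add: ip_scaleC_right Dadj_ip)

lemma Dadj_diff: "y \<in> dom Dadj \<Longrightarrow> z \<in> dom Dadj \<Longrightarrow> Dadj (y - z) = Some (the (Dadj y) - the (Dadj z))"
  by (rule Dadj_eqI) (simp add: ip_diff_right Dadj_ip)

lemma Dadj_csubspace: "csubspace (dom Dadj)"
proof (rule csubspaceI)
  show "0 \<in> dom Dadj" using Dadj_eqI[of 0 0] by auto
  show "x + y \<in> dom Dadj" if "x \<in> dom Dadj" "y \<in> dom Dadj" for x y by (rule domI, rule Dadj_add[OF that])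
  show "c *\<^sub>C x \<in> dom Dadj" if "x \<in> dom Dadj" for c x by (rule domI, rule Dadj_scaleC[OF that])
qed

lemma Dadj_closed:
  assumes "\<And>n. s n \<in> dom Dadj" "hlim E s y" "hlim E (\<lambda>n. the (Dadj (s n))) z" shows "Dadj y = Some z"
proof (rule Dadj_eqI)
  fix x assume "x \<in> dom D"
  then show "ip E (val x) y = ip E x z"
    using LIMSEQ_unique[OF tendsto_ip_right[OF assms(2), of "val x"]] tendsto_ip_right[OF assms(3), of x]
    by (simp add: Dadj_ip[OF assms(1)])
qed

definition graph_eq :: "'e \<Rightarrow> 'e \<Rightarrow> bool"
  where "graph_eq x z \<longleftrightarrow> one_plus_adj_comp E D x = Some z"

lemma graph_eq_iff: "graph_eq x z \<longleftrightarrow> x \<in> dom D \<and> val x \<in> dom Dadj \<and> z = x + the (Dadj (val x))"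
  unfolding graph_eq_def one_plus_adj_comp_def by auto

lemma graph_eq_diff: "graph_eq x z \<Longrightarrow> graph_eq x' z' \<Longrightarrow> graph_eq (x - x') (z - z')"
  unfolding graph_eq_iff using Dadj_diff[of "val x" "val x'"] by (auto simp: dom_diff val_diff)

text \<open>With \<open>w\<close> the image of \<open>val x\<close> under the adjoint, both cross
  terms of \<open>ip E z z\<close> equal the inner square of \<open>val x\<close>, so
  \<open>ip E z z\<close> is a sum of four inner squares.\<close>

lemma graph_eq_bounds:
  assumes "graph_eq x z" shows "hnorm E x \<le> hnorm E z" "hnorm E (val x) \<le> hnorm E z" "hnorm E (z - x) \<le> hnorm E z"
proof -
  define w where "w = the (Dadj (val x))"
  have x: "x \<in> dom D" "val x \<in> dom Dadj" "z = x + w" using assms by (auto simp: graph_eq_iff w_def)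
  have w: "ip E x w = ip E (val x) (val x)" "ip E w x = ip E (val x) (val x)"
    using Dadj_ip[OF x(2,1)] Dadj_ip'[OF x(2,1)] by (auto simp: w_def)
  have z: "ip E z z = ip E x x + ip E (val x) (val x) + ip E (val x) (val x) + ip E w w"
    by (simp add: x(3) ip_add_left ip_add_right w)
  have le: "hnorm E u \<le> hnorm E z" if "ip E z z = ip E u u + q" "nonneg_element q" for u q
    using norm_le_norm_add_nonneg[OF ip_nonneg[of u] that(2)] that(1) by (simp add: hnorm_def)
  show "hnorm E x \<le> hnorm E z"
    by (rule le[of _ "ip E (val x) (val x) + ip E (val x) (val x) + ip E w w"]) (simp_all add: z nonneg_element_add ip_nonneg add.assoc)
  show "hnorm E (val x) \<le> hnorm E z"
    by (rule le[of _ "ip E (val x) (val x) + ip E x x + ip E w w"]) (simp_all add: z nonneg_element_add ip_nonneg algebra_simps)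
  have "hnorm E w \<le> hnorm E z"
    by (rule le[of _ "ip E (val x) (val x) + ip E x x + ip E (val x) (val x)"]) (simp_all add: z nonneg_element_add ip_nonneg algebra_simps)
  then show "hnorm E (z - x) \<le> hnorm E z" by (simp add: x(3))
qed

text \<open>Regularity provides a dense range. The bounds make \<open>x\<close> and
  \<open>val x\<close> converge along an approximating sequence, hence also \<open>z - x\<close>,
  and closedness of \<open>D\<close> and of its adjoint identifies the limits.\<close>

lemma graph_eq_surj: "\<exists>x. graph_eq x z"
proof -
  obtain s where s: "\<And>n. s n \<in> ran (one_plus_adj_comp E D)" "hlim E s z" using hdense_seq[OF ran_dense] by blast
  have "\<exists>x. graph_eq x (s n)" for n using s(1)[of n] unfolding ran_def graph_eq_def by blast
  then obtain t where t: "\<And>n. graph_eq (t n) (s n)" by metis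
  note diff = graph_eq_bounds[OF graph_eq_diff[OF t t]]
  note cau = hlim_imp_Cauchy[OF s(2)]
  obtain x where x: "hlim E t x" by (rule hlim_Cauchy[OF diff(1) cau])
  have tdom: "t n \<in> dom D" "val (t n) \<in> dom Dadj" for n using t by (auto simp: graph_eq_iff)
  obtain y where y: "hlim E (\<lambda>n. val (t n)) y"
    by (rule hlim_Cauchy[of "\<lambda>n. val (t n)" "\<lambda>m n. hnorm E (s m - s n)"]) (use diff(2) cau tdom in \<open>auto simp: val_diff\<close>)
  have Dx: "D x = Some y" by (rule closed[OF tdom(1) x y])
  have "hlim E (\<lambda>n. s n - t n) (z - x)" by (rule hlim_diff[OF s(2) x])
  moreover have "s n - t n = the (Dadj (val (t n)))" for n using t[of n] by (simp add: graph_eq_iff)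
  ultimately have "Dadj y = Some (z - x)" using Dadj_closed[OF tdom(2) y] by simp
  then have "graph_eq x z" using Dx by (auto simp: graph_eq_iff)
  then show ?thesis by blast
qed

lemma graph_eq_inj: "graph_eq x z \<Longrightarrow> graph_eq y z \<Longrightarrow> x = y"
  using graph_eq_bounds(1)[OF graph_eq_diff, of x z y z] hnorm_nonneg[of "x - y"]
    hnorm_eq_0[of "x - y"] by (simp del: hnorm_nonneg hnorm_eq_0)

lemma graph_eq_resolvent: "graph_eq (resolvent_op E D z) z"
  unfolding resolvent_op_def graph_eq_def[symmetric] by (rule theI') (use graph_eq_surj graph_eq_inj in blast)

text \<open>
  Below, \<open>res = (1 + D\<^sup>* D)\<^sup>-\<^sup>1\<close> and \<open>groot = (1 + D\<^sup>* D)\<^sup>-\<^sup>1\<^sup>/\<^sup>2\<close>, the bounded transform of \<open>D\<close> is \<open>btr\<close> and its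
  adjoint is \<open>btra\<close>, and \<open>coroot = (1 + D D\<^sup>*)\<^sup>-\<^sup>1\<^sup>/\<^sup>2\<close>.
\<close>

definition res :: "'e endo" where "res = Endo (resolvent_op E D)"

lemma app_res: "app res = resolvent_op E D"
  and res_adjoint: "adjoint_pair E res res"
proof -
  have eq: "ip E (resolvent_op E D z) w = ip E z (resolvent_op E D w)" for z w
  proof -
    let ?x = "resolvent_op E D z" and ?y = "resolvent_op E D w"
    have x: "?x \<in> dom D" "val ?x \<in> dom Dadj" "z = ?x + the (Dadj (val ?x))"
      and y: "?y \<in> dom D" "val ?y \<in> dom Dadj" "w = ?y + the (Dadj (val ?y))"
      using graph_eq_resolvent by (auto simp: graph_eq_iff)
    have "ip E ?x w = ip E ?x ?y + ip E (val ?x) (val ?y)"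
      using arg_cong[OF y(3), of "ip E ?x"] by (simp only: ip_add_right Dadj_ip[OF y(2) x(1)])
    moreover have "ip E z ?y = ip E ?x ?y + ip E (val ?x) (val ?y)"
      using arg_cong[OF x(3), of "\<lambda>u. ip E u ?y"] by (simp only: ip_add_left Dadj_ip'[OF x(2) y(1)])
    ultimately show ?thesis by simp
  qed
  show "app res = resolvent_op E D" unfolding res_def
    by (rule app_Endo; rule ip_nondegenerate_left) (simp_all add: eq ip_add_left ip_scaleC_left)
  then show "adjoint_pair E res res" unfolding adjoint_pair_def by (simp add: eq)
qed

lemma graph_eq_res: "graph_eq (res \<cdot> z) z"
  by (simp add: app_res graph_eq_resolvent)

lemma res_dom: "res \<cdot> z \<in> dom D" "val (res \<cdot> z) \<in> dom Dadj" "the (Dadj (val (res \<cdot> z))) = (1 - res) \<cdot> z"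
  using graph_eq_res[of z] by (auto simp: graph_eq_iff algebra_simps)

lemma res_contraction: "bounded_by E 1 res" "bounded_by E 1 (1 - res)"
  using graph_eq_bounds[OF graph_eq_res] by (simp_all add: bounded_by_def)

lemma res_positive: "positive_endo E res" "positive_endo E (1 - res)"
  using res_contraction res_adjoint positive_endo_diff_bound[of res 1] positive_endo_diff_bound[of "1 - res" 1]
  by (auto intro: adjoint_pair_intros)

lemma ip_val_res:
  "x \<in> dom D \<Longrightarrow> ip E (val x) (val (res \<cdot> z)) = ip E x ((1 - res) \<cdot> z)"
  using Dadj_ip[OF res_dom(2)] res_dom(3) by simp

definition groot :: "'e endo" where
  "groot = (SOME g. positive_endo E g \<and> g * g = res \<and> (\<forall>A. bounded_endo E A \<longrightarrow> A * res = res * A \<longrightarrow> A * g = g * A))"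

lemma groot: "positive_endo E groot" "groot * groot = res"
  "\<And>A. bounded_endo E A \<Longrightarrow> A * res = res * A \<Longrightarrow> A * groot = groot * A"
proof -
  have "\<exists>g. positive_endo E g \<and> g * g = res \<and> (\<forall>A. bounded_endo E A \<longrightarrow> A * res = res * A \<longrightarrow> A * g = g * A)"
    using positive_endo_root[OF res_positive(1)] by metis
  from someI_ex[OF this] show "positive_endo E groot" "groot * groot = res"
    "\<And>A. bounded_endo E A \<Longrightarrow> A * res = res * A \<Longrightarrow> A * groot = groot * A"
    unfolding groot_def[symmetric] by blast+
qed

lemma groot_adjoint: "adjoint_pair E groot groot"
  using groot(1) by (rule positive_endo_adjoint)

lemma one_minus_groot_positive: "positive_endo E (1 - groot)"
proof -
  have "bounded_by E 1 groot"
    by (rule bounded_by_adjoint_square[OF groot_adjoint]) (simp_all add: groot(2) res_contraction)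
  then show ?thesis using positive_endo_diff_bound[OF groot_adjoint, of 1] by simp
qed

text \<open>Density of the range of \<open>res\<close> has to be derived from that of
  \<open>dom D\<close>. With \<open>Q = 1 - res\<close> and \<open>v = Q^(2n+1) y\<close>, the
  squared norm of \<open>Q^(n+1) y\<close> is that of \<open>ip E (val y) (val (res v))\<close>, and
  \<open>val (res v)\<close> has inner square \<open>ip E (res v) (Q v)\<close>, where
  \<open>res Q^(2n+1)\<close> decays.\<close>

lemma one_minus_res_power_tendsto_0:
  assumes y: "y \<in> dom D" shows "hlim E (\<lambda>n. (1 - res) ^ n \<cdot> y) 0"
proof -
  define Q where "Q = 1 - res"
  have Q: "adjoint_pair E Q Q" unfolding Q_def by (intro adjoint_pair_intros res_adjoint)
  have contr: "hnorm E (Q ^ n \<cdot> x) \<le> hnorm E x" for n x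
    using bounded_byD[OF bounded_by_power[OF _ res_contraction(2), of n], of x] by (simp add: Q_def)
  have le: "(hnorm E (Q ^ Suc n \<cdot> y))\<^sup>2 \<le> hnorm E (val y) * (hnorm E y / sqrt (real (Suc n)))" for n
  proof -
    define v where "v = Q ^ (n + Suc n) \<cdot> y"
    have "ip E (Q ^ Suc n \<cdot> y) (Q ^ Suc n \<cdot> y) = ip E y (Q ^ (Suc n + Suc n) \<cdot> y)"
      unfolding adjoint_pairD[OF adjoint_pair_power[OF Q]] power_add by simp
    also have "Q ^ (Suc n + Suc n) \<cdot> y = Q \<cdot> v" by (simp add: v_def)
    also have "ip E y (Q \<cdot> v) = ip E (val y) (val (res \<cdot> v))" using ip_val_res[OF y] by (simp add: Q_def)
    finally have "(hnorm E (Q ^ Suc n \<cdot> y))\<^sup>2 \<le> hnorm E (val y) * hnorm E (val (res \<cdot> v))"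
      unfolding hnorm_power2 using cauchy_schwarz[of "val y"] by simp
    moreover have "hnorm E (val (res \<cdot> v)) \<le> hnorm E y / sqrt (real (Suc n))"
    proof (rule hnorm_le_power2)
      have "norm (ip E (val (res \<cdot> v)) (val (res \<cdot> v))) \<le> hnorm E (res \<cdot> v) * hnorm E (Q \<cdot> v)"
        using ip_val_res[OF res_dom(1), of v v] cauchy_schwarz[of "res \<cdot> v" "Q \<cdot> v"] by (simp add: Q_def)
      also have "\<dots> \<le> (1 / real (Suc n) * hnorm E y) * hnorm E y"
      proof (rule mult_mono)
        have "hnorm E (res \<cdot> v) \<le> 1 / real (Suc (n + Suc n)) * hnorm E y"
          using bounded_byD[OF bounded_by_decay[OF res_positive, of "n + Suc n"], of y] by (simp add: v_def Q_def)
        also have "\<dots> \<le> 1 / real (Suc n) * hnorm E y"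
          by (intro mult_right_mono) (simp_all add: field_simps)
        finally show "hnorm E (res \<cdot> v) \<le> 1 / real (Suc n) * hnorm E y" .
        show "hnorm E (Q \<cdot> v) \<le> hnorm E y" using contr[of "Suc (n + Suc n)" y] by (simp add: v_def)
      qed simp_all
      finally show "norm (ip E (val (res \<cdot> v)) (val (res \<cdot> v))) \<le> (hnorm E y / sqrt (real (Suc n)))\<^sup>2"
        by (simp add: power_divide power2_eq_square)
    qed simp
    ultimately show ?thesis using mult_left_mono[OF _ hnorm_nonneg] order_trans by blast
  qed
  have lim: "(\<lambda>n. hnorm E (val y) * (hnorm E y / sqrt (real (Suc n)))) \<longlonglongrightarrow> 0"
    by (intro tendsto_mult_right_zero tendsto_divide_0[OF tendsto_const] filterlim_at_top_imp_at_infinity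
        filterlim_compose[OF sqrt_at_top] filterlim_compose[OF filterlim_real_sequentially filterlim_Suc])
  have "(\<lambda>n. (hnorm E (Q ^ Suc n \<cdot> y))\<^sup>2) \<longlonglongrightarrow> 0"
    by (rule tendsto_sandwich[OF _ _ tendsto_const lim]) (intro always_eventually allI le zero_le_power2)+
  then have "(\<lambda>n. sqrt ((hnorm E (Q ^ Suc n \<cdot> y))\<^sup>2)) \<longlonglongrightarrow> sqrt 0" by (rule tendsto_real_sqrt)
  then have "(\<lambda>n. hnorm E (Q ^ Suc n \<cdot> y)) \<longlonglongrightarrow> 0" by simp
  then show ?thesis unfolding hlim_def Q_def[symmetric] diff_0_right by (rule LIMSEQ_imp_Suc)
qed

text \<open>The geometric sum puts \<open>y - (1 - res)^n y\<close> into the range of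
  \<open>res\<close>, and the second term tends to 0 on \<open>dom D\<close>.\<close>

lemma groot_dense: "hdense E (range (app groot))"
  unfolding hdense_def
proof (intro allI impI)
  fix x and \<epsilon> :: real assume \<epsilon>: "0 < \<epsilon>"
  then have \<epsilon>2: "0 < \<epsilon> / 2" by simp
  obtain y where y: "y \<in> dom D" "hnorm E (x - y) < \<epsilon> / 2" using dom_dense \<epsilon>2 unfolding hdense_def by blast
  obtain n where n: "hnorm E ((1 - res) ^ n \<cdot> y) < \<epsilon> / 2"
    using LIMSEQ_D[OF one_minus_res_power_tendsto_0[OF y(1), unfolded hlim_def] \<epsilon>2] by auto
  obtain P where P: "1 - (1 - res) ^ n = res * P" using one_minus_power_eq by blast
  have eq: "y - (1 - res) ^ n \<cdot> y = groot \<cdot> groot \<cdot> P \<cdot> y"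
    using arg_cong[OF P, of "\<lambda>T. T \<cdot> y"] by (simp flip: groot(2))
  have "hnorm E (x - groot \<cdot> groot \<cdot> P \<cdot> y) < \<epsilon>"
    using hnorm_triangle[of "x - y" "(1 - res) ^ n \<cdot> y"] y(2) n unfolding eq[symmetric] by (simp add: algebra_simps)
  then show "\<exists>y\<in>range (app groot). hnorm E (x - y) < \<epsilon>" by blast
qed

text \<open>At a vector \<open>groot w\<close> the claim is about \<open>res w\<close>, and
  \<open>val (res w)\<close> has inner square \<open>ip E (groot w) ((1 - res) (groot w))\<close>,
  of norm at most \<open>||groot w||^2\<close>. The dense range of \<open>groot\<close> and
  closedness of \<open>D\<close> do the rest.\<close>

lemma groot_dom: "groot \<cdot> x \<in> dom D" and val_groot_le: "hnorm E (val (groot \<cdot> x)) \<le> hnorm E x"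
proof -
  have gQ: "groot * (1 - res) = (1 - res) * groot"
    by (simp add: left_diff_distrib right_diff_distrib mult.assoc flip: groot(2))
  have val_res: "hnorm E (val (res \<cdot> w)) \<le> hnorm E (groot \<cdot> w)" for w
  proof (rule hnorm_le_power2)
    have "ip E (val (res \<cdot> w)) (val (res \<cdot> w)) = ip E (groot \<cdot> groot \<cdot> w) ((1 - res) \<cdot> w)"
      using ip_val_res[OF res_dom(1), of w w] by (simp flip: groot(2))
    also have "\<dots> = ip E (groot \<cdot> w) ((groot * (1 - res)) \<cdot> w)" by (simp add: adjoint_pairD[OF groot_adjoint])
    also have "\<dots> = ip E (groot \<cdot> w) ((1 - res) \<cdot> groot \<cdot> w)" unfolding gQ by simp
    finally have "norm (ip E (val (res \<cdot> w)) (val (res \<cdot> w))) \<le> hnorm E (groot \<cdot> w) * hnorm E ((1 - res) \<cdot> groot \<cdot> w)"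
      using cauchy_schwarz by simp
    also have "\<dots> \<le> hnorm E (groot \<cdot> w) * hnorm E (groot \<cdot> w)"
      using bounded_byD[OF res_contraction(2), of "groot \<cdot> w"] by (intro mult_left_mono) simp_all
    finally show "norm (ip E (val (res \<cdot> w)) (val (res \<cdot> w))) \<le> (hnorm E (groot \<cdot> w))\<^sup>2" by (simp add: power2_eq_square)
  qed simp
  obtain s where s: "\<And>n. s n \<in> range (app groot)" "hlim E s x" using hdense_seq[OF groot_dense] by blast
  have "\<exists>u. s n = groot \<cdot> u" for n using s(1)[of n] by blast
  then obtain w where w: "\<And>n. s n = groot \<cdot> w n" by metis
  have gs: "groot \<cdot> s n = res \<cdot> w n" for n by (simp add: w flip: groot(2))
  obtain z where z: "hlim E (\<lambda>n. val (groot \<cdot> s n)) z"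
  proof (rule hlim_Cauchy[OF _ hlim_imp_Cauchy[OF s(2)]])
    show "hnorm E (val (groot \<cdot> s m) - val (groot \<cdot> s n)) \<le> hnorm E (s m - s n)" for m n
      using val_res[of "w m - w n"] res_dom(1) by (simp only: gs) (simp add: w val_diff)
  qed
  have "D (groot \<cdot> x) = Some z"
    by (rule closed[OF _ hlim_app[OF positive_endo_bounded[OF groot(1)] s(2)] z]) (simp add: gs res_dom)
  moreover have "hnorm E z \<le> 1 * hnorm E x"
    by (rule hlim_hnorm_mono[OF z s(2)]) (simp only: gs, simp add: w val_res)
  ultimately show "groot \<cdot> x \<in> dom D" "hnorm E (val (groot \<cdot> x)) \<le> hnorm E x" by auto
qed

section \<open>The bounded transform and its adjoint\<close>

definition btr :: "'e endo" where "btr = Endo (\<lambda>x. val (groot \<cdot> x))"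

lemma btr_app: "btr \<cdot> x = val (groot \<cdot> x)"
  unfolding btr_def by (subst app_Endo) (simp_all add: val_add val_scaleC groot_dom)

lemma bounded_transform_eq: "bounded_transform E D = app btr"
  using sqrt_op_app[OF groot(1)] unfolding groot(2) app_res
  by (simp add: fun_eq_iff bounded_transform_def btr_app)

lemma btr_contraction: "bounded_by E 1 btr"
  using val_groot_le by (simp add: bounded_by_def btr_app)

definition btra :: "'e endo" where "btra = (SOME T. adjoint_pair E btr T)"

text \<open>For \<open>y\<close> in the dense domain of \<open>Dadj\<close> the vector
  \<open>groot (Dadj y)\<close> solves the adjoint equation, and
  \<open>adjoint_pair_of_dense\<close> extends this to all \<open>y\<close>.\<close>

lemma btr_adjoint: "adjoint_pair E btr btra"
proof -
  have "\<exists>z. \<forall>x. ip E (btr \<cdot> x) y = ip E x z" if "y \<in> dom Dadj" for y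
    using that Dadj_ip[OF that groot_dom] adjoint_pairD[OF groot_adjoint]
    by (intro exI[of _ "groot \<cdot> the (Dadj y)"]) (simp add: btr_app)
  then obtain T where "adjoint_pair E btr T" using adjoint_pair_of_dense[OF btr_contraction dom_adj_dense] by metis
  then show ?thesis unfolding btra_def by (rule someI)
qed

lemma groot_Dadj: "y \<in> dom Dadj \<Longrightarrow> groot \<cdot> the (Dadj y) = btra \<cdot> y"
  by (rule ip_nondegenerate)
    (simp add: Dadj_ip groot_dom btr_app flip: adjoint_pairD[OF btr_adjoint] adjoint_pairD[OF groot_adjoint])

lemma endo_eq_of_dense:
  assumes "A * g = B * g" "hdense E (range (app g))" "bounded_endo E A" "bounded_endo E B" shows "A = B"
proof (rule endo_eqI)
  fix x
  obtain s where s: "\<And>n. s n \<in> range (app g)" "hlim E s x" using hdense_seq[OF assms(2)] by blast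
  have "A \<cdot> s n = B \<cdot> s n" for n
  proof -
    obtain w where "s n = g \<cdot> w" using s(1)[of n] by blast
    then show ?thesis using arg_cong[OF assms(1), of "\<lambda>T. T \<cdot> w"] by simp
  qed
  then show "A \<cdot> x = B \<cdot> x"
    using hlim_unique[OF hlim_app[OF assms(3) s(2)]] hlim_app[OF assms(4) s(2)] by simp
qed

lemma btra_mult_btr: "btra * btr = 1 - res"
proof (rule endo_eq_of_dense[OF _ groot_dense])
  have gQ: "groot * (1 - res) = (1 - res) * groot"
    by (simp add: left_diff_distrib right_diff_distrib mult.assoc flip: groot(2))
  show "btra * btr * groot = (1 - res) * groot"
  proof (rule endo_eqI, rule ip_nondegenerate)
    fix v x
    have "ip E x ((btra * btr * groot) \<cdot> v) = ip E (val (groot \<cdot> x)) (val (res \<cdot> v))"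
      by (simp add: btr_app flip: adjoint_pairD[OF btr_adjoint] groot(2))
    also have "\<dots> = ip E x ((groot * (1 - res)) \<cdot> v)"
      using ip_val_res[OF groot_dom, of x v] adjoint_pairD[OF groot_adjoint] by simp
    finally show "ip E x ((btra * btr * groot) \<cdot> v) = ip E x (((1 - res) * groot) \<cdot> v)" unfolding gQ .
  qed
  have btr: "bounded_endo E btr" using btr_contraction by (rule bounded_byI_endo)
  show "bounded_endo E (btra * btr)" by (intro bounded_endo_mult btr bounded_endo_adjoint[OF btr_adjoint btr])
  show "bounded_endo E (1 - res)" using res_contraction(2) by (rule bounded_byI_endo)
qed

lemma transform_triple_btr: "transform_triple E btr btra groot"
  unfolding transform_triple_def
  using btr_adjoint groot one_minus_groot_positive groot_dense by (simp add: btra_mult_btr)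

text \<open>The preimage of \<open>x\<close> under \<open>groot\<close> is read off from
  \<open>1 = groot^2 + btra btr\<close>. So the range of \<open>groot\<close> is all of
  \<open>dom D\<close>, and statements about \<open>D\<close> become statements about
  \<open>groot\<close> and \<open>btr\<close>.\<close>

lemma dom_eq_groot:
  assumes x: "x \<in> dom D"
  shows "groot \<cdot> (groot \<cdot> x + btra \<cdot> val x) = x" "btr \<cdot> (groot \<cdot> x + btra \<cdot> val x) = val x"
proof -
  have "groot \<cdot> btra \<cdot> val x = (1 - res) \<cdot> x"
  proof (rule ip_nondegenerate_left)
    fix w
    have "ip E (groot \<cdot> btra \<cdot> val x) w = ip E (val x) (val (res \<cdot> w))"
      by (simp add: adjoint_pairD[OF groot_adjoint] adjoint_pairD[OF adjoint_pair_sym[OF btr_adjoint]] btr_app flip: groot(2))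
    also have "\<dots> = ip E x ((1 - res) \<cdot> w)" by (rule ip_val_res[OF x])
    also have "\<dots> = ip E ((1 - res) \<cdot> x) w"
      by (rule adjoint_pairD[symmetric]) (intro adjoint_pair_intros res_adjoint)
    finally show "ip E (groot \<cdot> btra \<cdot> val x) w = ip E ((1 - res) \<cdot> x) w" .
  qed
  then show "groot \<cdot> (groot \<cdot> x + btra \<cdot> val x) = x" by (simp add: algebra_simps flip: groot(2))
  then show "btr \<cdot> (groot \<cdot> x + btra \<cdot> val x) = val x" by (simp only: btr_app)
qed

definition coroot :: "'e endo" where
  "coroot = (SOME h. positive_endo E h \<and> h * h = 1 - btr * btra \<and>
    (\<forall>A. bounded_endo E A \<longrightarrow> A * (1 - btr * btra) = (1 - btr * btra) * A \<longrightarrow> A * h = h * A))"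

text \<open>\<open>1 - btr btra\<close> is the bounded form of the inverse of
  \<open>1 + D Dadj\<close>; through it \<open>Dadj\<close> is treated by means of the bounded
  transform of \<open>D\<close>.\<close>

lemma btr_btra_positive: "positive_endo E (btr * btra)" "positive_endo E (1 - btr * btra)"
proof -
  have adj: "adjoint_pair E btra btr" using adjoint_pair_sym[OF btr_adjoint] .
  have b: "bounded_by E 1 btra" using bounded_by_adjoint[OF btr_adjoint btr_contraction] by simp
  show "positive_endo E (btr * btra)" using positive_endo_adjoint_mult[OF adj bounded_byI_endo[OF b]] .
  then show "positive_endo E (1 - btr * btra)"
    using positive_endo_diff_bound[of "btr * btra" 1] bounded_by_mult[OF _ btr_contraction b] positive_endo_adjoint by simp
qed

lemma coroot: "positive_endo E coroot" "coroot * coroot = 1 - btr * btra"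
  "\<And>A. bounded_endo E A \<Longrightarrow> A * (1 - btr * btra) = (1 - btr * btra) * A \<Longrightarrow> A * coroot = coroot * A"
proof -
  have "\<exists>h. positive_endo E h \<and> h * h = 1 - btr * btra \<and>
    (\<forall>A. bounded_endo E A \<longrightarrow> A * (1 - btr * btra) = (1 - btr * btra) * A \<longrightarrow> A * h = h * A)"
    using positive_endo_root[OF btr_btra_positive(2)] by metis
  from someI_ex[OF this] show "positive_endo E coroot" "coroot * coroot = 1 - btr * btra"
    "\<And>A. bounded_endo E A \<Longrightarrow> A * (1 - btr * btra) = (1 - btr * btra) * A \<Longrightarrow> A * coroot = coroot * A"
    unfolding coroot_def[symmetric] by blast+
qed

lemma coroot_adjoint: "adjoint_pair E coroot coroot"
  using coroot(1) by (rule positive_endo_adjoint)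

text \<open>In place of functional calculus: the difference \<open>P\<close> of both sides satisfies
  \<open>coroot P + P groot = btr groot^2 - coroot^2 btr = 0\<close>, and this Sylvester equation
  has only the zero solution.\<close>

lemma btr_groot: "btr * groot = coroot * btr"
proof -
  define P where "P = btr * groot - coroot * btr"
  have bd: "bounded_endo E btr" "bounded_endo E groot" "bounded_endo E coroot"
    using bounded_byI_endo[OF btr_contraction] positive_endo_bounded groot(1) coroot(1) by auto
  have "coroot * P + P * groot = btr * (groot * groot) - (coroot * coroot) * btr"
    by (simp add: P_def left_diff_distrib right_diff_distrib mult.assoc)
  also have "\<dots> = 0"
    unfolding coroot(2) groot(2) using btra_mult_btr by (simp add: left_diff_distrib right_diff_distrib mult.assoc)
  finally have eq: "coroot * P + P * groot = 0" .
  have "adjoint_pair E P (groot * btra - btra * coroot)"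
    unfolding P_def by (intro adjoint_pair_diff adjoint_pair_mult btr_adjoint groot_adjoint coroot_adjoint)
  then have "P = 0"
    by (rule positive_endo_sylvester_zero[OF coroot(1) groot(1) groot_dense _ _ eq])
      (unfold P_def, intro bounded_endo_diff bounded_endo_mult bd)
  then show ?thesis by (simp add: P_def)
qed

lemma coroot_dom: "Dadj (coroot \<cdot> x) = Some (btra \<cdot> x)"
proof (rule Dadj_eqI)
  fix u assume u: "u \<in> dom D"
  define z where "z = groot \<cdot> u + btra \<cdot> val u"
  have z: "u = groot \<cdot> z" "val u = btr \<cdot> z" using dom_eq_groot[OF u] by (simp_all add: z_def)
  have "ip E (btr \<cdot> z) (coroot \<cdot> x) = ip E ((coroot * btr) \<cdot> z) x" by (simp add: adjoint_pairD[OF coroot_adjoint])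
  also have "\<dots> = ip E (groot \<cdot> z) (btra \<cdot> x)" unfolding btr_groot[symmetric] by (simp add: adjoint_pairD[OF btr_adjoint])
  finally show "ip E (val u) (coroot \<cdot> x) = ip E u (btra \<cdot> x)" using z by simp
qed

lemma transform_triple_btra: "transform_triple E btra btr coroot"
proof -
  have "bounded_by E 1 (1 - btr * btra)"
    using positive_endo_bounded_by[OF btr_btra_positive(2), of 1] btr_btra_positive(1) by simp
  then have "bounded_by E 1 coroot"
    by (intro bounded_by_adjoint_square[OF coroot_adjoint]) (simp_all add: coroot(2))
  then have pos: "positive_endo E (1 - coroot)" using positive_endo_diff_bound[OF coroot_adjoint, of 1] by simp
  have "hdense E (range (app coroot))"
  proof -
    \<comment> \<open>The counterpart of \<open>dom_eq_groot\<close> for the adjoint, from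
      \<open>btr groot (Dadj y) = btr btra y = y - coroot^2 y\<close>.\<close>
    have "y \<in> range (app coroot)" if y: "y \<in> dom Dadj" for y
    proof -
      have "coroot \<cdot> btr \<cdot> the (Dadj y) = (btr * groot) \<cdot> the (Dadj y)" by (simp add: btr_groot)
      also have "\<dots> = (btr * btra) \<cdot> y" by (simp add: groot_Dadj[OF y])
      also have "\<dots> = y - (coroot * coroot) \<cdot> y" by (simp add: coroot(2) del: endo_app(6))
      finally have "y = coroot \<cdot> (coroot \<cdot> y + btr \<cdot> the (Dadj y))" by simp
      then show ?thesis by blast
    qed
    then show ?thesis using dom_adj_dense unfolding hdense_def by blast
  qed
  then show ?thesis
    unfolding transform_triple_def using adjoint_pair_sym[OF btr_adjoint] coroot pos by simp
qed

text \<open>\<open>M\<close> is the preimage under \<open>groot\<close> that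
  \<open>dom_eq_groot\<close> provides for \<open>S g2 z\<close>, with the value of \<open>D\<close>
  replaced by the bounded expression assumed for it. This makes the adjoint of \<open>M\<close>
  explicit.\<close>

lemma bounded_commutator_btr:
  assumes S: "adjoint_pair E S Sa" "bounded_endo E S" and S': "adjoint_pair E S' Sa'" "bounded_endo E S'"
    and X: "adjoint_pair E X Xa" "bounded_endo E X" and g: "bounded_endo E g2" "adjoint_pair E g2 g2"
    and f: "bounded_endo E f2" "adjoint_pair E f2 f2'"
    and dom: "\<And>z. S \<cdot> g2 \<cdot> z \<in> dom D" and val: "\<And>z. val (S \<cdot> g2 \<cdot> z) = S' \<cdot> f2 \<cdot> z + X \<cdot> g2 \<cdot> z"
  shows "bounded_commutator E btr groot f2 g2 S S'"
proof -
  define M where "M = groot * S * g2 + btra * (S' * f2 + X * g2)"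
  note bd = transform_triple_bounded[OF transform_triple_btr]
  have M: "M \<cdot> z = groot \<cdot> (S \<cdot> g2 \<cdot> z) + btra \<cdot> val (S \<cdot> g2 \<cdot> z)" for z
    by (simp add: M_def val)
  have "adjoint_pair E M (g2 * (Sa * groot) + (f2' * Sa' + g2 * Xa) * btr)"
    unfolding M_def by (intro adjoint_pair_add adjoint_pair_mult S S' X g f groot_adjoint adjoint_pair_sym[OF btr_adjoint])
  moreover have "bounded_endo E M"
    unfolding M_def by (intro bounded_endo_add bounded_endo_mult S S' X g f bd)
  moreover have "S * g2 = groot * M"
    using dom_eq_groot(1)[OF dom] by (intro endo_eqI) (simp only: M endo_app)
  moreover have "btr * M = S' * f2 + X * g2"
    using dom_eq_groot(2)[OF dom] by (intro endo_eqI) (simp only: M endo_app val)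
  ultimately show ?thesis unfolding bounded_commutator_def using X by blast
qed

end

section \<open>Graded commutators\<close>

locale graded_regular_operator = regular_operator E D
  for E :: "('e::complex_vector, 'b::graded_cstar_algebra) hmodule" and D :: "'e \<rightharpoonup> 'e" +
  assumes gr_add: "gr E (x + y) = gr E x + gr E y"
    and gr_scaleC: "gr E (c *\<^sub>C x) = c *\<^sub>C gr E x"
    and gr_act: "gr E (act E x b) = act E (gr E x) (grade b)"
    and gr_ip: "ip E (gr E x) (gr E y) = grade (ip E x y)"
    and gr_gr: "gr E (gr E x) = x"
    and symmetric: "symmetric_op E D"
    and odd: "odd_op E D"
begin

definition \<gamma> :: "'e endo" where "\<gamma> = Endo (gr E)"

lemma app_\<gamma> [simp]: "\<gamma> \<cdot> x = gr E x"
  unfolding \<gamma>_def by (subst app_Endo) (simp_all add: gr_add gr_scaleC)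

lemma gr_minus [simp]: "gr E (- x) = - gr E x" and gr_diff: "gr E (x - y) = gr E x - gr E y"
  and gr_zero [simp]: "gr E 0 = 0" and gr_scaleR [simp]: "gr E (r *\<^sub>R x) = r *\<^sub>R gr E x"
  by (simp_all flip: app_\<gamma>)

lemma \<gamma>_\<gamma>: "\<gamma> * \<gamma> = 1" "\<gamma> * (\<gamma> * T) = T"
proof -
  show "\<gamma> * \<gamma> = 1" by (rule endo_eqI) (simp add: gr_gr)
  then show "\<gamma> * (\<gamma> * T) = T" by (simp add: mult.assoc[symmetric])
qed

lemma ip_gr_left: "ip E (gr E x) y = grade (ip E x (gr E y))"
  using gr_ip[of x "gr E y"] by (simp add: gr_gr)

lemma ip_gr_right: "ip E x (gr E y) = grade (ip E (gr E x) y)"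
  using gr_ip[of "gr E x" y] by (simp add: gr_gr)

lemma hnorm_gr [simp]: "hnorm E (gr E x) = hnorm E x"
  by (simp add: hnorm_def gr_ip)

lemma \<gamma>_bounded: "bounded_endo E \<gamma>"
  by (rule bounded_byI_endo[of 1]) (simp add: bounded_by_def)

text \<open>This is \<open>T\<close> for even and \<open>-T\<close> for odd \<open>T\<close>, so
  that for odd \<open>F\<close> the graded commutator is \<open>F T - gr_conj T F\<close> without
  splitting \<open>T\<close> into degrees.\<close>

definition gr_conj :: "'e endo \<Rightarrow> 'e endo" where "gr_conj T = \<gamma> * T * \<gamma>"

lemma app_gr_conj [simp]: "gr_conj T \<cdot> x = gr E (T \<cdot> gr E x)"
  by (simp add: gr_conj_def)

lemma gr_conj_mult: "gr_conj (S * T) = gr_conj S * gr_conj T"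
  by (rule endo_eqI) (simp add: gr_gr)

lemma adjoint_pair_gr_conj: "adjoint_pair E S T \<Longrightarrow> adjoint_pair E (gr_conj S) (gr_conj T)"
  unfolding adjoint_pair_def by (simp add: ip_gr_left) (metis ip_gr_right grade_grade gr_gr)

lemma bounded_endo_gr_conj: "bounded_endo E T \<Longrightarrow> bounded_endo E (gr_conj T)"
  unfolding gr_conj_def by (intro bounded_endo_mult \<gamma>_bounded)

text \<open>The grading operator is only twisted linear over the algebra, so the ideal property of
  compact operators does not apply to it. Finite rank operators are conjugated by hand:
  \<open>x i\<close> and \<open>y i\<close> turn into \<open>gr E (x i)\<close> and
  \<open>gr E (y i)\<close>.\<close>

lemma compact_endo_gr_conj:
  assumes "compact_endo T" shows "compact_endo (gr_conj T)"
  unfolding compact_op_endo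
proof (intro conjI allI impI)
  show "\<exists>T'. adjoint_pair E (gr_conj T) T'" using assms adjoint_pair_gr_conj unfolding compact_op_endo by blast
  fix \<epsilon> :: real assume "0 < \<epsilon>"
  then obtain S S' where S: "adjoint_pair E S S'" "finite_rank_endo S" "bounded_by E \<epsilon> (T - S)"
    using assms unfolding compact_op_endo by meson
  obtain n :: nat and x y where xy: "app S = (\<lambda>z. \<Sum>i<n. act E (x i) (ip E (y i) z))"
    using S(2) unfolding finite_rank_endo_def finite_rank_ops_def by blast
  have "app (gr_conj S) = (\<lambda>z. \<Sum>i<n. act E (gr E (x i)) (ip E (gr E (y i)) z))"
  proof
    fix z
    have "app (gr_conj S) z = \<gamma> \<cdot> (\<Sum>i<n. act E (x i) (ip E (y i) (gr E z)))" by (simp add: xy)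
    then show "app (gr_conj S) z = (\<Sum>i<n. act E (gr E (x i)) (ip E (gr E (y i)) z))"
      by (simp only: app_sum app_\<gamma> gr_act ip_gr_left)
  qed
  then have "finite_rank_endo (gr_conj S)" unfolding finite_rank_endo_def by (rule finite_rank_opsI)
  moreover have "bounded_by E \<epsilon> (gr_conj T - gr_conj S)"
    unfolding bounded_by_def
  proof
    fix x
    have "(gr_conj T - gr_conj S) \<cdot> x = gr E ((T - S) \<cdot> gr E x)" by (simp add: gr_diff)
    then show "hnorm E ((gr_conj T - gr_conj S) \<cdot> x) \<le> \<epsilon> * hnorm E x"
      using bounded_byD[OF S(3), of "gr E x"] by simp
  qed
  ultimately show "\<exists>R R'. adjoint_pair E R R' \<and> finite_rank_endo R \<and> bounded_by E \<epsilon> (gr_conj T - R)"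
    using adjoint_pair_gr_conj[OF S(1)] by blast
qed

text \<open>The even part of \<open>\<Phi>\<close> vanishes on \<open>S\<close>, which leaves
  \<open>\<Phi> T0 - T0 \<Phi> + \<Phi> T1 + T1 \<Phi>\<close> for the parts \<open>T0\<close>,
  \<open>T1\<close> of \<open>T\<close>, and \<open>T0 - T1\<close> is \<open>gr_conj T\<close>. The
  graded subspace \<open>S\<close> lets \<open>\<Phi>\<close> be an unbounded operator on its domain
  as well as a bounded transform.\<close>

lemma graded_commutator_odd:
  assumes S: "csubspace S" "\<And>y. y \<in> S \<Longrightarrow> gr E y \<in> S"
    and \<Phi>: "\<And>y z. y \<in> S \<Longrightarrow> z \<in> S \<Longrightarrow> \<Phi> (y + z) = \<Phi> y + \<Phi> z" "\<And>c y. y \<in> S \<Longrightarrow> \<Phi> (c *\<^sub>C y) = c *\<^sub>C \<Phi> y"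
      "\<And>y. y \<in> S \<Longrightarrow> \<Phi> (gr E y) = - gr E (\<Phi> y)"
    and T: "\<And>y. y \<in> S \<Longrightarrow> T \<cdot> y \<in> S" and x: "x \<in> S"
  shows "graded_commutator E \<Phi> (app T) x = \<Phi> (T \<cdot> x) - gr_conj T \<cdot> \<Phi> x"
proof -
  have half: "r *\<^sub>R y \<in> S" "\<Phi> (r *\<^sub>R y) = r *\<^sub>R \<Phi> y" if "y \<in> S" for r y
    using csubspace_scale[OF S(1) that] \<Phi>(2)[OF that] by (simp_all add: scaleR_scaleC)
  have h0: "homogeneous_part E 0 \<Phi> y = 0" "homogeneous_part E (Suc 0) \<Phi> y = \<Phi> y" if "y \<in> S" for y
    using \<Phi>(3)[OF that] \<Phi>(3)[OF S(2)[OF that]]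
    by (simp_all add: homogeneous_part_def gr_gr)
  define u v where "u = T \<cdot> x" and "v = gr_conj T \<cdot> x"
  have uv: "u \<in> S" "v \<in> S" using T S x by (auto simp: u_def v_def)
  have T0: "homogeneous_part E 0 (app T) y = (1/2) *\<^sub>R (T \<cdot> y + gr_conj T \<cdot> y)"
    and T1: "homogeneous_part E (Suc 0) (app T) y = (1/2) *\<^sub>R (T \<cdot> y + (-1) *\<^sub>R gr_conj T \<cdot> y)" for y
    by (simp_all add: homogeneous_part_def)
  have uvS: "u + v \<in> S" "(-1) *\<^sub>R v \<in> S" "u + (-1) *\<^sub>R v \<in> S"
    using csubspace_add[OF S(1)] half(1) uv by blast+
  have TS: "homogeneous_part E 0 (app T) x \<in> S" "homogeneous_part E (Suc 0) (app T) x \<in> S"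
    unfolding T0 T1 u_def[symmetric] v_def[symmetric] by (intro half uvS)+
  have \<Phi>T: "\<Phi> (homogeneous_part E 0 (app T) x) = (1/2) *\<^sub>R (\<Phi> u + \<Phi> v)"
    "\<Phi> (homogeneous_part E (Suc 0) (app T) x) = (1/2) *\<^sub>R (\<Phi> u + (-1) *\<^sub>R \<Phi> v)"
    unfolding T0 T1 u_def[symmetric] v_def[symmetric]
    by (simp_all only: half(2)[OF uvS(1)] half(2)[OF uvS(3)] half(2)[OF uv(2)] \<Phi>(1)[OF uv] \<Phi>(1)[OF uv(1) uvS(2)])
  have "graded_commutator E \<Phi> (app T) x =
     (1/2) *\<^sub>R (\<Phi> u + \<Phi> v) - homogeneous_part E 0 (app T) (\<Phi> x) +
     ((1/2) *\<^sub>R (\<Phi> u + (-1) *\<^sub>R \<Phi> v) + homogeneous_part E (Suc 0) (app T) (\<Phi> x))"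
    unfolding graded_commutator_def
    by (simp add: numeral_2_eq_2 h0[OF TS(1)] h0[OF TS(2)] h0[OF x] \<Phi>T) (simp add: T0 T1)
  also have "\<dots> = ((1/2) *\<^sub>R \<Phi> u + (1/2) *\<^sub>R \<Phi> u) - ((1/2) *\<^sub>R (gr_conj T \<cdot> \<Phi> x) + (1/2) *\<^sub>R (gr_conj T \<cdot> \<Phi> x))"
    unfolding T0 T1 by (simp add: algebra_simps)
  also have "\<dots> = \<Phi> u - gr_conj T \<cdot> \<Phi> x" by (simp only: scaleR_half_double[symmetric] scaleR_right_distrib[symmetric] scaleR_2[symmetric]) simp
  finally show ?thesis by (simp add: u_def)
qed

lemma dom_gr: "x \<in> dom D \<Longrightarrow> gr E x \<in> dom D" and val_gr: "x \<in> dom D \<Longrightarrow> val (gr E x) = - gr E (val x)"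
  using odd unfolding odd_op_def by auto

lemma val_symmetric: "x \<in> dom D \<Longrightarrow> y \<in> dom D \<Longrightarrow> ip E (val x) y = ip E x (val y)"
  using symmetric unfolding symmetric_op_def by blast

lemma Dadj_gr: "y \<in> dom Dadj \<Longrightarrow> Dadj (gr E y) = Some (- gr E (the (Dadj y)))"
proof (rule Dadj_eqI)
  fix x assume y: "y \<in> dom Dadj" and x: "x \<in> dom D"
  have "ip E (val x) (gr E y) = grade (ip E (gr E (val x)) y)" by (rule ip_gr_right)
  also have "\<dots> = - grade (ip E (val (gr E x)) y)"
    using val_gr[OF x] grade_scaleC[of "-1" "ip E (gr E (val x)) y"] by (simp add: scaleC_one)
  also have "\<dots> = ip E x (- gr E (the (Dadj y)))"
    using Dadj_ip[OF y dom_gr[OF x]] by (simp add: ip_gr_left grade_grade)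
  finally show "ip E (val x) (gr E y) = ip E x (- gr E (the (Dadj y)))" .
qed

lemma res_gr: "\<gamma> * res = res * \<gamma>"
proof (rule endo_eqI)
  fix z
  have "graph_eq (gr E (res \<cdot> z)) (gr E z)"
  proof -
    have r: "res \<cdot> z \<in> dom D" "val (res \<cdot> z) \<in> dom Dadj" "z = res \<cdot> z + the (Dadj (val (res \<cdot> z)))"
      using graph_eq_res[of z] unfolding graph_eq_iff by blast+
    have d: "gr E (val (res \<cdot> z)) \<in> dom Dadj" by (rule domI, rule Dadj_gr[OF r(2)])
    have e: "Dadj (- gr E (val (res \<cdot> z))) = Some (gr E (the (Dadj (val (res \<cdot> z)))))"
      using Dadj_scaleC[OF d, of "-1"] Dadj_gr[OF r(2)] by (simp add: scaleC_one)
    have "gr E z = gr E (res \<cdot> z) + gr E (the (Dadj (val (res \<cdot> z))))"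
      using arg_cong[OF r(3), of "gr E"] unfolding gr_add .
    moreover have "- gr E (val (res \<cdot> z)) \<in> dom Dadj" by (rule domI, rule e)
    ultimately show ?thesis unfolding graph_eq_iff val_gr[OF r(1)] e option.sel using dom_gr[OF r(1)] by blast
  qed
  then show "(\<gamma> * res) \<cdot> z = (res * \<gamma>) \<cdot> z" using graph_eq_inj[OF _ graph_eq_res[of "gr E z"]] by simp
qed

lemma groot_gr: "\<gamma> * groot = groot * \<gamma>"
  by (rule groot(3)[OF \<gamma>_bounded res_gr])

lemma btr_gr: "btr * \<gamma> = - (\<gamma> * btr)"
proof (rule endo_eqI)
  fix x
  have "groot \<cdot> gr E x = gr E (groot \<cdot> x)" using arg_cong[OF groot_gr, of "\<lambda>T. T \<cdot> x"] by simp
  then show "(btr * \<gamma>) \<cdot> x = (- (\<gamma> * btr)) \<cdot> x" by (simp add: btr_app val_gr groot_dom)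
qed

lemma btra_gr: "btra * \<gamma> = - (\<gamma> * btra)"
proof -
  have "gr_conj btr = - btr" unfolding gr_conj_def by (simp add: mult.assoc btr_gr \<gamma>_\<gamma>)
  then have "adjoint_pair E (- btr) (gr_conj btra)" using adjoint_pair_gr_conj[OF btr_adjoint] by simp
  then have "gr_conj btra = - btra" using adjoint_pair_unique adjoint_pair_minus[OF btr_adjoint] by blast
  then have "\<gamma> * (\<gamma> * btra * \<gamma>) = - (\<gamma> * btra)" by (simp add: gr_conj_def)
  then show ?thesis by (simp add: mult.assoc \<gamma>_\<gamma>)
qed

lemma coroot_gr: "\<gamma> * coroot = coroot * \<gamma>"
proof (rule coroot(3)[OF \<gamma>_bounded])
  have "btr * btra * \<gamma> = \<gamma> * (btr * btra)"
    by (simp add: mult.assoc btra_gr) (simp add: mult.assoc[symmetric] btr_gr)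
  then show "\<gamma> * (1 - btr * btra) = (1 - btr * btra) * \<gamma>" by (simp add: left_diff_distrib right_diff_distrib)
qed

lemma graded_commutator_bounded_transform:
  "graded_commutator E (bounded_transform E D) (app T) = app (btr * T - gr_conj T * btr)"
proof
  fix x
  have "btr \<cdot> gr E y = - gr E (btr \<cdot> y)" for y using arg_cong[OF btr_gr, of "\<lambda>T. T \<cdot> y"] by simp
  then show "graded_commutator E (bounded_transform E D) (app T) x = (btr * T - gr_conj T * btr) \<cdot> x"
    unfolding bounded_transform_eq
    by (subst graded_commutator_odd[of UNIV]) (simp_all add: csubspaceI)
qed

definition lipschitz :: "'e endo \<Rightarrow> bool" where
  "lipschitz T \<longleftrightarrow> (\<forall>x\<in>dom D. T \<cdot> x \<in> dom D) \<and>
    (\<exists>K. \<forall>x\<in>dom D. hnorm E (val (T \<cdot> x) - gr_conj T \<cdot> val x) \<le> K * hnorm E x)"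

lemma Lip_iff_lipschitz: "app T \<in> Lip E D \<longleftrightarrow> adjointable E E (app T) \<and> lipschitz T"
proof -
  have dom: "app T ` dom D \<subseteq> dom D \<longleftrightarrow> (\<forall>x\<in>dom D. T \<cdot> x \<in> dom D)" by auto
  show ?thesis
  proof (cases "\<forall>x\<in>dom D. T \<cdot> x \<in> dom D")
    case True
    have eq: "graded_commutator E val (app T) x = val (T \<cdot> x) - gr_conj T \<cdot> val x" if "x \<in> dom D" for x
      by (rule graded_commutator_odd[OF dom_csubspace]) (use True that dom_gr val_add val_scaleC val_gr in auto)
    show ?thesis
      unfolding Lip_def lipschitz_def mem_Collect_eq dom using True by (simp add: eq cong: ball_cong del: app_gr_conj)
  next
    case False
    then show ?thesis unfolding Lip_def lipschitz_def mem_Collect_eq dom by blast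
  qed
qed

lemma lipschitz_gr_conj_dom: "lipschitz T \<Longrightarrow> x \<in> dom D \<Longrightarrow> gr_conj T \<cdot> x \<in> dom D"
  unfolding lipschitz_def by (simp add: dom_gr)

text \<open>Since \<open>Ta\<close> preserves \<open>dom D\<close> too,
  \<open>Ta D - D (gr_conj Ta)\<close> is a formal adjoint of the commutator on a dense domain, and
  this makes the bounded closure of the commutator adjointable.\<close>

lemma bounded_commutator_lipschitz:
  assumes T: "adjoint_pair E T Ta" "bounded_endo E T" and l: "lipschitz T" "lipschitz Ta"
  shows "bounded_commutator E btr groot btr groot T (gr_conj T)"
proof -
  obtain K where K: "\<And>x. x \<in> dom D \<Longrightarrow> hnorm E (val (T \<cdot> x) - gr_conj T \<cdot> val x) \<le> K * hnorm E x"
    and dom: "\<And>x. x \<in> dom D \<Longrightarrow> T \<cdot> x \<in> dom D" using l(1) unfolding lipschitz_def by blast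
  have doma: "\<And>x. x \<in> dom D \<Longrightarrow> Ta \<cdot> x \<in> dom D" using l(2) unfolding lipschitz_def by blast
  note Tc = adjoint_pair_gr_conj[OF T(1)]
  obtain X X' where X: "adjoint_pair E X X'" "bounded_endo E X" "\<And>x. x \<in> dom D \<Longrightarrow> X \<cdot> x = val (T \<cdot> x) - gr_conj T \<cdot> val x"
  proof (rule extend_densely_defined[OF dom_csubspace dom_dense _ _ K dom_dense])
    show "val (T \<cdot> (x + y)) - gr_conj T \<cdot> val (x + y) = val (T \<cdot> x) - gr_conj T \<cdot> val x + (val (T \<cdot> y) - gr_conj T \<cdot> val y)"
      if "x \<in> dom D" "y \<in> dom D" for x y
      using that by (simp add: val_add dom gr_add)
    show "val (T \<cdot> (c *\<^sub>C x)) - gr_conj T \<cdot> val (c *\<^sub>C x) = c *\<^sub>C (val (T \<cdot> x) - gr_conj T \<cdot> val x)" if "x \<in> dom D" for c x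
      using that by (simp add: val_scaleC dom gr_scaleC scaleC_diff_right)
    show "ip E (val (T \<cdot> x) - gr_conj T \<cdot> val x) y = ip E x (Ta \<cdot> val y - val (gr_conj Ta \<cdot> y))" if "x \<in> dom D" "y \<in> dom D" for x y
      using that lipschitz_gr_conj_dom[OF l(2)]
      by (simp add: ip_diff_left ip_diff_right val_symmetric dom adjoint_pairD[OF T(1)] adjoint_pairD[OF Tc] del: app_gr_conj)
  qed (assumption | rule that)+
  have "val (T \<cdot> groot \<cdot> z) = gr_conj T \<cdot> btr \<cdot> z + X \<cdot> groot \<cdot> z" for z
    using X(3)[OF groot_dom[of z]] by (simp add: btr_app del: app_gr_conj)
  then show ?thesis
    using transform_triple_bounded[OF transform_triple_btr]
    by (intro bounded_commutator_btr[OF T Tc bounded_endo_gr_conj[OF T(2)] X(1,2) _ groot_adjoint _ btr_adjoint] dom groot_dom)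
qed

text \<open>For \<open>T\<close> in \<open>Lip\<^sup>*\<close>, the operator \<open>D T - T' D\<^sup>*\<close> is defined and bounded on \<open>Dom D\<^sup>*\<close>.\<close>

lemma bounded_commutator_lipschitz_adjoint:
  assumes T: "adjoint_pair E T Ta" "bounded_endo E T" and l: "lipschitz Ta"
    and dom: "\<And>y. y \<in> dom Dadj \<Longrightarrow> T \<cdot> y \<in> dom D"
  shows "bounded_commutator E btr groot btra coroot T (gr_conj T)"
proof -
  obtain K where K: "\<And>x. x \<in> dom D \<Longrightarrow> hnorm E (val (Ta \<cdot> x) - gr_conj Ta \<cdot> val x) \<le> K * hnorm E x"
    and doma: "\<And>x. x \<in> dom D \<Longrightarrow> Ta \<cdot> x \<in> dom D" using l unfolding lipschitz_def by blast
  note Tc = adjoint_pair_gr_conj[OF T(1)]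
  define f where "f y = val (T \<cdot> y) - gr_conj T \<cdot> the (Dadj y)" for y
  define g where "g x = Ta \<cdot> val x - val (gr_conj Ta \<cdot> x)" for x
  have fg: "ip E (f y) x = ip E y (g x)" if "y \<in> dom Dadj" "x \<in> dom D" for x y
    using that lipschitz_gr_conj_dom[OF l]
    by (simp add: f_def g_def ip_diff_left ip_diff_right val_symmetric dom adjoint_pairD[OF T(1)] adjoint_pairD[OF Tc]
        Dadj_ip' del: app_gr_conj)
  have g_le: "hnorm E (g x) \<le> \<bar>K\<bar> * hnorm E x" if x: "x \<in> dom D" for x
  proof -
    \<comment> \<open>Up to the grading, \<open>g\<close> is the twisted commutator of
      \<open>D\<close> with \<open>Ta\<close>, whose bound is known.\<close>
    have "g x = gr E (val (Ta \<cdot> gr E x) - gr_conj Ta \<cdot> val (gr E x))"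
      using val_gr[OF x] val_gr[OF doma[OF dom_gr[OF x]]] by (simp add: g_def gr_diff gr_add gr_gr)
    then have "hnorm E (g x) \<le> K * hnorm E x" using K[OF dom_gr[OF x]] by simp
    also have "\<dots> \<le> \<bar>K\<bar> * hnorm E x" by (intro mult_right_mono) simp_all
    finally show ?thesis .
  qed
  \<comment> \<open>The bound on \<open>f\<close> is that of its formal adjoint \<open>g\<close>,
    transferred by pairing with the dense \<open>dom D\<close>.\<close>
  have f_le: "hnorm E (f y) \<le> \<bar>K\<bar> * hnorm E y" if y: "y \<in> dom Dadj" for y
  proof (rule hnorm_le_of_dense[OF dom_dense])
    fix x assume x: "x \<in> dom D"
    have "norm (ip E (f y) x) \<le> hnorm E y * hnorm E (g x)" using fg[OF y x] cauchy_schwarz by simp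
    also have "\<dots> \<le> hnorm E y * (\<bar>K\<bar> * hnorm E x)" by (intro mult_left_mono g_le x) simp
    finally show "norm (ip E (f y) x) \<le> \<bar>K\<bar> * hnorm E y * hnorm E x" by (simp add: mult_ac)
  qed simp
  obtain X X' where X: "adjoint_pair E X X'" "bounded_endo E X" "\<And>y. y \<in> dom Dadj \<Longrightarrow> X \<cdot> y = f y"
  proof (rule extend_densely_defined[OF Dadj_csubspace dom_adj_dense _ _ f_le dom_dense fg])
    show "f (x + y) = f x + f y" if "x \<in> dom Dadj" "y \<in> dom Dadj" for x y
      using that by (simp add: f_def val_add dom gr_add Dadj_add)
    show "f (c *\<^sub>C x) = c *\<^sub>C f x" if "x \<in> dom Dadj" for c x
      using that by (simp add: f_def val_scaleC dom gr_scaleC scaleC_diff_right Dadj_scaleC)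
  qed (assumption | rule that)+
  have cd: "coroot \<cdot> z \<in> dom Dadj" for z using coroot_dom by blast
  have "val (T \<cdot> coroot \<cdot> z) = gr_conj T \<cdot> btra \<cdot> z + X \<cdot> coroot \<cdot> z" for z
    using X(3)[OF cd[of z]] by (simp add: f_def coroot_dom del: app_gr_conj)
  then show ?thesis
    using transform_triple_bounded[OF transform_triple_btr] transform_triple_bounded[OF transform_triple_btra]
    by (intro bounded_commutator_btr[OF T Tc bounded_endo_gr_conj[OF T(2)] X(1,2) _ coroot_adjoint _ adjoint_pair_sym[OF btr_adjoint]]
        dom cd)
qed

text \<open>The two factors have different tasks: \<open>a2\<close> maps \<open>dom Dadj\<close>
  into \<open>dom D\<close>, so that \<open>a2 coroot = groot M\<close>, and \<open>a1\<close> then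
  meets \<open>groot\<close>, where \<open>a1 groot\<close> is compact.\<close>

theorem graded_commutator_compact:
  assumes a1: "adjoint_pair E a1 a1'" "bounded_endo E a1" and a2: "adjoint_pair E a2 a2'" "bounded_endo E a2"
    and T: "adjoint_pair E T T" "bounded_endo E T" "lipschitz T"
    and m: "lipschitz (a1 * a2)" "lipschitz (a2' * a1')" and l2: "lipschitz a2" "lipschitz a2'"
    and star: "\<And>y. y \<in> dom Dadj \<Longrightarrow> a2 \<cdot> y \<in> dom D"
    and compact: "compact_endo (a1 * res)"
  shows "compact_op E (graded_commutator E (bounded_transform E D) (app (a1 * a2 * T * (a2' * a1'))))"
proof -
  note t = transform_triple_btr transform_triple_btra
  define m ma where "m = a1 * a2" and "ma = a2' * a1'"
  have m_adj: "adjoint_pair E m ma" "bounded_endo E m"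
    unfolding m_def ma_def by (intro adjoint_pair_mult bounded_endo_mult a1 a2)+
  have ml: "lipschitz m" "lipschitz ma" using m by (simp_all add: m_def ma_def)
  have c1: "compact_endo (a1 * groot)"
    by (rule compact_endo_mult_root[OF t(1) a1]) (simp add: groot(2) compact)
  have mG: "compact_endo (m * groot)"
  proof -
    obtain M M' where M: "adjoint_pair E M M'" "bounded_endo E M" "a2 * groot = groot * M"
      using bounded_commutator_lipschitz[OF a2 l2] unfolding bounded_commutator_def by blast
    then have "m * groot = a1 * groot * M" by (simp add: m_def mult.assoc)
    then show ?thesis using compact_endo_mult_right[OF M(1,2) c1] by simp
  qed
  have mH: "compact_endo (m * coroot)"
  proof -
    obtain M M' where M: "adjoint_pair E M M'" "bounded_endo E M" "a2 * coroot = groot * M"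
      using bounded_commutator_lipschitz_adjoint[OF a2 l2(2) star] unfolding bounded_commutator_def by blast
    then have "m * coroot = a1 * groot * M" by (simp add: m_def mult.assoc)
    then show ?thesis using compact_endo_mult_right[OF M(1,2) c1] by simp
  qed
  have "gr_conj coroot = coroot" unfolding gr_conj_def by (simp add: coroot_gr mult.assoc \<gamma>_\<gamma>)
  then have cmH: "compact_endo (gr_conj m * coroot)" using compact_endo_gr_conj[OF mH] by (simp add: gr_conj_mult)
  have "compact_endo (btr * (m * T * ma) - (gr_conj m * gr_conj T * gr_conj ma) * btr)"
    by (rule product_commutator_compact[OF t btr_groot m_adj adjoint_pair_gr_conj[OF m_adj(1)] bounded_endo_gr_conj[OF m_adj(2)]
        T(1,2) adjoint_pair_gr_conj[OF T(1)] bounded_endo_gr_conj[OF T(2)]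
        bounded_commutator_lipschitz[OF m_adj ml]
        bounded_commutator_lipschitz[OF adjoint_pair_sym[OF m_adj(1)] bounded_endo_adjoint[OF m_adj] ml(2,1)]
        bounded_commutator_lipschitz[OF T T(3)] mG cmH])
  then show ?thesis
    unfolding graded_commutator_bounded_transform m_def ma_def by (simp add: gr_conj_mult)
qed

end

section \<open>Direct sums of regular operators\<close>

definition pair_endo :: "'e::complex_vector endo \<Rightarrow> 'f::complex_vector endo \<Rightarrow> ('e \<times> 'f) endo"
  where "pair_endo A B = Endo (map_prod (app A) (app B))"

lemma app_pair_endo [simp]: "pair_endo A B \<cdot> (x, y) = (A \<cdot> x, B \<cdot> y)"
  unfolding pair_endo_def by (subst app_Endo) (auto simp: scaleC_prod_def)

lemma pair_endo_eqI: "(\<And>x y. S \<cdot> (x, y) = T \<cdot> (x, y)) \<Longrightarrow> S = T"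
  by (rule endo_eqI) (metis surj_pair)

lemma pair_endo_mult: "pair_endo A B * pair_endo A' B' = pair_endo (A * A') (B * B')"
  by (rule pair_endo_eqI) simp

lemma dom_dsum_op [simp]: "dom (dsum_op D D') = dom D \<times> dom D'"
  by (auto simp: dsum_op_def split: if_splits prod.splits)

lemma dsum_op_app [simp]: "x \<in> dom D \<Longrightarrow> y \<in> dom D' \<Longrightarrow> dsum_op D D' (x, y) = Some (the (D x), the (D' y))"
  by (simp add: dsum_op_def)

locale graded_regular_operator_pair =
  E: graded_regular_operator E D + F: graded_regular_operator F D'
  for E :: "('e::complex_vector, 'b::graded_cstar_algebra) hmodule" and D
    and F :: "('f::complex_vector, 'b) hmodule" and D'
begin

abbreviation X :: "('e \<times> 'f, 'b) hmodule" where "X \<equiv> dsum_module E F"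
abbreviation DX :: "'e \<times> 'f \<rightharpoonup> 'e \<times> 'f" where "DX \<equiv> dsum_op D D'"

lemma hilbert: "hilbert_module E" "hilbert_module F"
  by (rule E.hilbert_module_axioms F.hilbert_module_axioms)+

sublocale X: hilbert_module "dsum_module E F"
  by (rule hilbert_module_dsum[OF hilbert])

lemma dom_dsumE:
  assumes "p \<in> dom DX" obtains x y where "p = (x, y)" "x \<in> dom D" "y \<in> dom D'"
  using assms unfolding dom_dsum_op by blast

lemma adj_dsum:
  assumes "x \<in> dom E.Dadj" "y \<in> dom F.Dadj"
  shows "adj_op X X DX (x, y) = Some (the (E.Dadj x), the (F.Dadj y))"
proof (rule X.adj_op_eqI)
  show "hdense X (dom DX)" by (simp add: hdense_dsum[OF hilbert] E.dom_dense F.dom_dense)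
  fix q assume "q \<in> dom DX"
  then obtain a b where "q = (a, b)" "a \<in> dom D" "b \<in> dom D'" unfolding dom_dsum_op by blast
  then show "ip X (the (DX q)) (x, y) = ip X q (the (E.Dadj x), the (F.Dadj y))"
    by (simp add: E.Dadj_ip[OF assms(1)] F.Dadj_ip[OF assms(2)])
qed

lemma dom_adj_dsum: "dom (adj_op X X DX) = dom E.Dadj \<times> dom F.Dadj"
proof (intro equalityI subsetI)
  fix p assume "p \<in> dom (adj_op X X DX)"
  then have "adj_op X X DX p \<noteq> None" by blast
  then have "\<exists>z. \<forall>q\<in>dom DX. ip X (the (DX q)) p = ip X q z"
    unfolding adj_op_def[of X X] by meson
  then obtain z where z: "\<And>q. q \<in> dom DX \<Longrightarrow> ip X (the (DX q)) p = ip X q z" by blast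
  obtain x y z1 z2 where p: "p = (x, y)" "z = (z1, z2)" by (cases p, cases z)
  \<comment> \<open>Pairs with one zero entry test the two components separately.\<close>
  have 0: "0 \<in> dom D" "E.val 0 = 0" "0 \<in> dom D'" "F.val 0 = 0"
    using csubspace_0[OF E.dom_csubspace] csubspace_0[OF F.dom_csubspace] E.val_scaleC[of 0 0] F.val_scaleC[of 0 0]
    by simp_all
  have "E.Dadj x = Some z1"
  proof (rule E.Dadj_eqI)
    show "ip E (E.val a) x = ip E a z1" if "a \<in> dom D" for a
      using z[of "(a, 0)"] that 0 by (simp add: p)
  qed
  moreover have "F.Dadj y = Some z2"
  proof (rule F.Dadj_eqI)
    show "ip F (F.val b) y = ip F b z2" if "b \<in> dom D'" for b
      using z[of "(0, b)"] that 0 by (simp add: p)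
  qed
  ultimately show "p \<in> dom E.Dadj \<times> dom F.Dadj" using p by (simp add: domI)
next
  fix p assume "p \<in> dom E.Dadj \<times> dom F.Dadj"
  then obtain x y where "p = (x, y)" "x \<in> dom E.Dadj" "y \<in> dom F.Dadj" by blast
  then show "p \<in> dom (adj_op X X DX)" using domI[of "adj_op X X DX", OF adj_dsum] by blast
qed

lemma one_plus_dsum:
  assumes "E.graph_eq x z" "F.graph_eq y w" shows "one_plus_adj_comp X DX (x, y) = Some (z, w)"
proof -
  have x: "x \<in> dom D" "E.val x \<in> dom E.Dadj" "z = x + the (E.Dadj (E.val x))"
    and y: "y \<in> dom D'" "F.val y \<in> dom F.Dadj" "w = y + the (F.Dadj (F.val y))"
    using assms unfolding E.graph_eq_iff F.graph_eq_iff by blast+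
  have "(E.val x, F.val y) \<in> dom (adj_op X X DX)" unfolding dom_adj_dsum using x y by simp
  then show ?thesis
    unfolding one_plus_adj_comp_def using x(1,2) y(1,2)
    by (simp add: adj_dsum) (simp flip: x(3) y(3))
qed

lemma regular_dsum: "regular_op X DX"
  unfolding regular_op_def
proof (intro conjI)
  have act: "act E x b \<in> dom D" "E.val (act E x b) = act E (E.val x) b" if "x \<in> dom D" for x b
    using that E.regular unfolding regular_op_def linear_op_def by blast+
  have act': "act F y b \<in> dom D'" "F.val (act F y b) = act F (F.val y) b" if "y \<in> dom D'" for y b
    using that F.regular unfolding regular_op_def linear_op_def by blast+
  note mem = csubspace_add[OF E.dom_csubspace] csubspace_scale[OF E.dom_csubspace]
    csubspace_add[OF F.dom_csubspace] csubspace_scale[OF F.dom_csubspace]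
  have "csubspace (dom DX)" unfolding dom_dsum_op
    by (rule csubspaceI) (auto simp only: mem_Times_iff fst_zero snd_zero fst_add snd_add scaleC_prod_def fst_conv snd_conv
        csubspace_0[OF E.dom_csubspace] csubspace_0[OF F.dom_csubspace] mem)
  then show "linear_op X X DX"
    unfolding linear_op_def
  proof (intro conjI ballI allI)
    fix p assume "p \<in> dom DX"
    then obtain x y where p: "p = (x, y)" "x \<in> dom D" "y \<in> dom D'" by (rule dom_dsumE)
    show "act X p b \<in> dom DX" "the (DX (act X p b)) = act X (the (DX p)) b" for b
      using p by (simp_all add: act act')
    show "the (DX (c *\<^sub>C p)) = c *\<^sub>C the (DX p)" for c
      using p by (simp add: mem E.val_scaleC F.val_scaleC)
    fix q assume "q \<in> dom DX"
    then obtain x' y' where q: "q = (x', y')" "x' \<in> dom D" "y' \<in> dom D'" by (rule dom_dsumE)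
    show "the (DX (p + q)) = the (DX p) + the (DX q)"
      using p q by (simp add: mem E.val_add F.val_add)
  qed
  show "hdense X (dom DX)" by (simp add: hdense_dsum[OF hilbert] E.dom_dense F.dom_dense)
  show "hdense X (dom (adj_op X X DX))"
    unfolding dom_adj_dsum by (simp add: hdense_dsum[OF hilbert] E.dom_adj_dense F.dom_adj_dense)
  show "closed_op X X DX"
    unfolding closed_op_def
  proof (intro allI impI)
    fix s p q
    assume *: "(\<forall>n. s n \<in> dom DX) \<and> hlim X s p \<and> hlim X (\<lambda>n. the (DX (s n))) q"
    have s: "fst (s n) \<in> dom D" "snd (s n) \<in> dom D'" for n
      using * by (simp_all add: mem_Times_iff)
    have v: "the (DX (s n)) = (E.val (fst (s n)), F.val (snd (s n)))" for n
      using dsum_op_app[OF s, of n n] by simp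
    have l: "hlim E (\<lambda>n. fst (s n)) (fst p)" "hlim E (\<lambda>n. E.val (fst (s n))) (fst q)"
      "hlim F (\<lambda>n. snd (s n)) (snd p)" "hlim F (\<lambda>n. F.val (snd (s n))) (snd q)"
      using * unfolding hlim_dsum[OF hilbert] v by simp_all
    have "D (fst p) = Some (fst q)" "D' (snd p) = Some (snd q)"
      by (rule E.closed[of "\<lambda>n. fst (s n)", OF s(1) l(1,2)], rule F.closed[of "\<lambda>n. snd (s n)", OF s(2) l(3,4)])
    then show "DX p = Some q" using dsum_op_app[of "fst p" D "snd p" D'] by (simp add: domI)
  qed
  have "p \<in> ran (one_plus_adj_comp X DX)" for p
  proof -
    obtain x y where "E.graph_eq x (fst p)" "F.graph_eq y (snd p)" using E.graph_eq_surj F.graph_eq_surj by blast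
    from one_plus_dsum[OF this] show ?thesis by (auto simp: ran_def)
  qed
  then show "hdense X (ran (one_plus_adj_comp X DX))"
    unfolding hdense_def by (metis diff_self X.hnorm_zero)
qed

sublocale X: graded_regular_operator "dsum_module E F" "dsum_op D D'"
proof unfold_locales
  show "regular_op X DX" by (rule regular_dsum)
  show "symmetric_op X DX" unfolding symmetric_op_def
  proof (intro ballI)
    fix p q assume "p \<in> dom DX" "q \<in> dom DX"
    then show "ip X (the (DX p)) q = ip X p (the (DX q))"
      by (elim dom_dsumE) (simp add: E.val_symmetric F.val_symmetric)
  qed
  show "odd_op X DX" unfolding odd_op_def
  proof (intro ballI)
    fix p assume "p \<in> dom DX"
    then show "gr X p \<in> dom DX \<and> the (DX (gr X p)) = - gr X (the (DX p))"
      by (elim dom_dsumE) (simp add: E.dom_gr F.dom_gr E.val_gr F.val_gr)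
  qed
qed (auto simp: dsum_module_def E.gr_add F.gr_add E.gr_scaleC F.gr_scaleC E.gr_act F.gr_act E.gr_ip F.gr_ip
    E.gr_gr F.gr_gr grade_add scaleC_prod_def)

lemma pair_adjoint: "adjoint_pair E A A' \<Longrightarrow> adjoint_pair F B B' \<Longrightarrow> adjoint_pair X (pair_endo A B) (pair_endo A' B')"
  unfolding adjoint_pair_def by auto

lemma pair_bounded_by:
  assumes "bounded_by E K A" "bounded_by F L B" "0 \<le> K" "0 \<le> L" shows "bounded_by X (K + L) (pair_endo A B)"
  unfolding bounded_by_def
proof
  fix p :: "'e \<times> 'f" obtain x y where p: "p = (x, y)" by (cases p)
  have "hnorm X (pair_endo A B \<cdot> p) \<le> hnorm E (A \<cdot> x) + hnorm F (B \<cdot> y)"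
    unfolding p app_pair_endo by (rule hnorm_dsum_ge[OF hilbert])
  also have "\<dots> \<le> K * hnorm X p + L * hnorm X p"
    using order_trans[OF bounded_byD[OF assms(1)] mult_left_mono[OF hnorm_dsum_le(1)[OF hilbert] assms(3)]]
      order_trans[OF bounded_byD[OF assms(2)] mult_left_mono[OF hnorm_dsum_le(2)[OF hilbert] assms(4)]]
    by (auto simp: p intro: add_mono)
  finally show "hnorm X (pair_endo A B \<cdot> p) \<le> (K + L) * hnorm X p" by (simp add: distrib_right)
qed

lemma pair_bounded: "bounded_endo E A \<Longrightarrow> bounded_endo F B \<Longrightarrow> bounded_endo X (pair_endo A B)"
  by (meson E.bounded_endoE F.bounded_endoE X.bounded_byI_endo pair_bounded_by)

text \<open>The norm criterion would need the larger of the two bounds, while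
  \<open>pair_bounded_by\<close> gives their sum. Writing both operators as squares avoids the
  loss.\<close>

lemma pair_positive:
  assumes "positive_endo E A" "positive_endo F B" shows "positive_endo X (pair_endo A B)"
proof -
  obtain a where a: "positive_endo E a" "a * a = A" using E.positive_endo_root[OF assms(1)] by metis
  obtain b where b: "positive_endo F b" "b * b = B" using F.positive_endo_root[OF assms(2)] by metis
  have "positive_endo X (pair_endo a b * pair_endo a b)"
    by (intro X.positive_endo_square pair_adjoint pair_bounded E.positive_endo_adjoint F.positive_endo_adjoint
        E.positive_endo_bounded F.positive_endo_bounded a b)
  then show ?thesis by (simp add: pair_endo_mult a b)
qed

lemma pair_finite_rank:
  assumes "E.finite_rank_endo A" "F.finite_rank_endo B" shows "X.finite_rank_endo (pair_endo A B)"
proof -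
  obtain m n :: nat and x y x' y' where A: "app A = (\<lambda>z. \<Sum>i<m. act E (x i) (ip E (y i) z))"
    and B: "app B = (\<lambda>z. \<Sum>i<n. act F (x' i) (ip F (y' i) z))"
    using assms unfolding E.finite_rank_endo_def F.finite_rank_endo_def finite_rank_ops_def by blast
  have pair_sum: "(\<Sum>i\<in>I. (f i, g i)) = (sum f I, sum g I)" for I :: "nat set" and f :: "nat \<Rightarrow> 'e" and g :: "nat \<Rightarrow> 'f"
    by (induction I rule: infinite_finite_induct) (auto simp: zero_prod_def)
  have "app (pair_endo A 0) = (\<lambda>z. \<Sum>i<m. act X (x i, 0) (ip X (y i, 0) z))"
    by (auto simp: fun_eq_iff A pair_sum)
  then have "X.finite_rank_endo (pair_endo A 0)" unfolding X.finite_rank_endo_def by (rule finite_rank_opsI)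
  moreover have "app (pair_endo 0 B) = (\<lambda>z. \<Sum>i<n. act X (0, x' i) (ip X (0, y' i) z))"
    by (auto simp: fun_eq_iff B pair_sum)
  then have "X.finite_rank_endo (pair_endo 0 B)" unfolding X.finite_rank_endo_def by (rule finite_rank_opsI)
  moreover have "pair_endo A 0 + pair_endo 0 B = pair_endo A B" by (rule pair_endo_eqI) simp
  ultimately show ?thesis using X.finite_rank_endo_add by metis
qed

lemma pair_compact:
  assumes "E.compact_endo A" "F.compact_endo B" shows "X.compact_endo (pair_endo A B)"
  unfolding X.compact_op_endo
proof (intro conjI allI impI)
  show "\<exists>T'. adjoint_pair X (pair_endo A B) T'"
    using assms pair_adjoint unfolding E.compact_op_endo F.compact_op_endo by blast
  fix \<epsilon> :: real assume "0 < \<epsilon>"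
  then have \<epsilon>2: "0 < \<epsilon> / 2" by simp
  obtain S S' where S: "adjoint_pair E S S'" "E.finite_rank_endo S" "bounded_by E (\<epsilon> / 2) (A - S)"
    using assms(1) \<epsilon>2 unfolding E.compact_op_endo by meson
  obtain T T' where T: "adjoint_pair F T T'" "F.finite_rank_endo T" "bounded_by F (\<epsilon> / 2) (B - T)"
    using assms(2) \<epsilon>2 unfolding F.compact_op_endo by meson
  have "pair_endo A B - pair_endo S T = pair_endo (A - S) (B - T)" by (rule pair_endo_eqI) simp
  then have "bounded_by X \<epsilon> (pair_endo A B - pair_endo S T)"
    using pair_bounded_by[OF S(3) T(3)] \<epsilon>2 by simp
  then show "\<exists>S S'. adjoint_pair X S S' \<and> X.finite_rank_endo S \<and> bounded_by X \<epsilon> (pair_endo A B - S)"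
    using pair_adjoint[OF S(1) T(1)] pair_finite_rank[OF S(2) T(2)] by blast
qed

lemma pair_lipschitz:
  assumes "E.lipschitz A" "F.lipschitz B" shows "X.lipschitz (pair_endo A B)"
proof -
  obtain K where K: "\<And>x. x \<in> dom D \<Longrightarrow> hnorm E (E.val (A \<cdot> x) - E.gr_conj A \<cdot> E.val x) \<le> K * hnorm E x"
    and A: "\<And>x. x \<in> dom D \<Longrightarrow> A \<cdot> x \<in> dom D" using assms(1) unfolding E.lipschitz_def by blast
  obtain L where L: "\<And>y. y \<in> dom D' \<Longrightarrow> hnorm F (F.val (B \<cdot> y) - F.gr_conj B \<cdot> F.val y) \<le> L * hnorm F y"
    and B: "\<And>y. y \<in> dom D' \<Longrightarrow> B \<cdot> y \<in> dom D'" using assms(2) unfolding F.lipschitz_def by blast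
  have "hnorm X (X.val (pair_endo A B \<cdot> p) - X.gr_conj (pair_endo A B) \<cdot> X.val p) \<le> (\<bar>K\<bar> + \<bar>L\<bar>) * hnorm X p"
    if p: "p \<in> dom DX" for p
  proof -
    obtain x y where xy: "p = (x, y)" "x \<in> dom D" "y \<in> dom D'" using p by (rule dom_dsumE)
    have "X.val (pair_endo A B \<cdot> p) - X.gr_conj (pair_endo A B) \<cdot> X.val p =
      (E.val (A \<cdot> x) - E.gr_conj A \<cdot> E.val x, F.val (B \<cdot> y) - F.gr_conj B \<cdot> F.val y)"
      using xy by (simp add: A B)
    then have "hnorm X (X.val (pair_endo A B \<cdot> p) - X.gr_conj (pair_endo A B) \<cdot> X.val p) \<le>
      hnorm E (E.val (A \<cdot> x) - E.gr_conj A \<cdot> E.val x) + hnorm F (F.val (B \<cdot> y) - F.gr_conj B \<cdot> F.val y)"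
      using hnorm_dsum_ge[OF hilbert] by metis
    also have "\<dots> \<le> K * hnorm E x + L * hnorm F y" by (intro add_mono K L xy)
    also have "\<dots> \<le> \<bar>K\<bar> * hnorm X p + \<bar>L\<bar> * hnorm X p"
      unfolding xy(1) by (intro add_mono mult_mono hnorm_dsum_le[OF hilbert]) simp_all
    finally show ?thesis by (simp add: distrib_right)
  qed
  moreover have "pair_endo A B \<cdot> p \<in> dom DX" if "p \<in> dom DX" for p
    using that by (elim dom_dsumE) (simp add: A B)
  ultimately show ?thesis unfolding X.lipschitz_def by blast
qed

lemma res_dsum: "X.res = pair_endo E.res F.res"
proof (rule pair_endo_eqI)
  fix x y
  have "X.graph_eq (E.res \<cdot> x, F.res \<cdot> y) (x, y)"
    unfolding X.graph_eq_def by (rule one_plus_dsum[OF E.graph_eq_res F.graph_eq_res])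
  then show "X.res \<cdot> (x, y) = pair_endo E.res F.res \<cdot> (x, y)"
    using X.graph_eq_inj[OF X.graph_eq_res] by simp
qed

text \<open>The pair of roots is positive and squares to the resolvent of the sum, so it is the root
  selected by \<open>sqrt_op\<close>.\<close>

lemma bounded_transform_dsum: "bounded_transform X DX = map_prod (bounded_transform E D) (bounded_transform F D')"
proof -
  have g: "positive_endo X (pair_endo E.groot F.groot)" by (rule pair_positive[OF E.groot(1) F.groot(1)])
  have "pair_endo E.groot F.groot * pair_endo E.groot F.groot = X.res"
    by (simp add: pair_endo_mult E.groot(2) F.groot(2) res_dsum)
  then have "sqrt_op X (resolvent_op X DX) = app (pair_endo E.groot F.groot)"
    using X.sqrt_op_app[OF g] by (simp add: X.app_res)
  then show ?thesis
    unfolding E.bounded_transform_eq F.bounded_transform_eq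
    by (auto simp: fun_eq_iff bounded_transform_def E.btr_app F.btr_app E.groot_dom F.groot_dom)
qed

end

section \<open>Half-closed modules\<close>

context half_closed_module
begin

lemma graded_regular_operator: "graded_regular_operator E D"
proof -
  interpret hilbert_module E by (rule hilbert_module)
  show ?thesis
    by unfold_locales (fact regular gr_add gr_scaleC gr_act gr_ip gr_gr symmetric odd)+
qed

end

definition rep :: "('a \<Rightarrow> 'e::complex_vector \<Rightarrow> 'e) \<Rightarrow> 'a \<Rightarrow> 'e endo"
  where "rep \<pi> a = Endo (\<pi> a)"

context
  fixes E :: "('e::complex_vector, 'b::graded_cstar_algebra) hmodule" and \<pi> :: "'a::graded_cstar_algebra \<Rightarrow> 'e \<Rightarrow> 'e"
  assumes E: "hilbert_module E" and rep: "graded_representation E \<pi>"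
begin

interpretation hilbert_module E by (rule E)

lemma app_rep: "app (rep \<pi> a) = \<pi> a"
proof -
  have "adjointable E E (\<pi> a)" using rep unfolding graded_representation_def by blast
  then obtain S T where "\<pi> a = app S" using adjointable_endoE by metis
  then show ?thesis by (simp add: rep_def app_inverse)
qed

lemma rep_adjoint: "adjoint_pair E (rep \<pi> a) (rep \<pi> (star a))"
proof -
  have a: "adjointable E E (\<pi> a)" "\<pi> (star a) = adj E E (\<pi> a)" using rep unfolding graded_representation_def by blast+
  then obtain S T where "\<pi> a = app S" "adjoint_pair E S T" "adj E E (\<pi> a) = app T" using adjointable_endoE by metis
  then show ?thesis by (simp add: rep_def a app_inverse)
qed

lemma rep_add: "rep \<pi> (a + b) = rep \<pi> a + rep \<pi> b"
  and rep_scaleC: "rep \<pi> (c *\<^sub>C a) = c *\<^sub>C rep \<pi> a"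
  and rep_mult: "rep \<pi> (a * b) = rep \<pi> a * rep \<pi> b"
  using rep unfolding graded_representation_def by (auto intro!: endo_eqI simp: app_rep)

lemma rep_bounded_by: "bounded_by E (norm a) (rep \<pi> a)"
  by (rule representation_contractive) (auto simp: rep_add rep_scaleC rep_mult rep_adjoint scaleR_scaleC)

lemma rep_bounded: "bounded_endo E (rep \<pi> a)"
  using rep_bounded_by bounded_byI_endo by blast

lemma rep_diff: "rep \<pi> (a - b) = rep \<pi> a - rep \<pi> b"
  using rep_add[of "a - b" b] by simp

end

section \<open>Approximate units\<close>

text \<open>An approximate unit writes \<open>a\<close> as a limit of products, whose factors are
  then moved into \<open>S\<close>. This serves to pass from products of two elements of a dense
  subalgebra, where compactness is shown first, to arbitrary elements.\<close>

lemma sigma_unital_product_dense: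
  fixes S :: "'a::cstar_algebra set"
  assumes "sigma_unital TYPE('a)" "closure S = UNIV" "0 < \<epsilon>"
  obtains x y where "x \<in> S" "y \<in> S" "norm (a - x * y) < \<epsilon>"
proof -
  obtain u :: "nat \<Rightarrow> 'a" where u: "\<And>a. (\<lambda>n. a * u n) \<longlonglongrightarrow> a"
    using assms(1) unfolding sigma_unital_def by blast
  define W where "W = {x * y | x y. x \<in> S \<and> y \<in> S}"
  have W: "x * y \<in> closure W" for x y
  proof -
    have "x \<in> closure S" "y \<in> closure S" using assms(2) by auto
    then obtain s t where "\<And>n. s n \<in> S" "s \<longlonglongrightarrow> x" "\<And>n. t n \<in> S" "t \<longlonglongrightarrow> y"
      unfolding closure_sequential by blast
    then show ?thesis unfolding closure_sequential
      by (intro exI[of _ "\<lambda>n. s n * t n"]) (auto simp: W_def intro: tendsto_mult)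
  qed
  have "a \<in> closure (closure W)"
    unfolding closure_sequential[of a "closure W"] by (intro exI[of _ "\<lambda>n. a * u n"] conjI allI W u)
  then have "a \<in> closure W" by simp
  then obtain w where "w \<in> W" "dist w a < \<epsilon>" using assms(3) closure_approachable by blast
  then show ?thesis using that unfolding W_def by (auto simp: dist_norm norm_minus_commute)
qed

text \<open>An approximate unit of the algebra also works on the module: with
  \<open>h = ip E x x\<close> the inner square of \<open>x - x u\<close> is
  \<open>(h - h u) - star u (h - h u)\<close>.\<close>

lemma (in hilbert_module) act_product_dense:
  assumes u: "sigma_unital TYPE('b)" and S: "closure S = UNIV" and \<epsilon>: "0 < \<epsilon>"
  obtains b c where "b \<in> S" "c \<in> S" "hnorm E (x - act E x (b * c)) < \<epsilon>"
proof -
  obtain u :: "nat \<Rightarrow> 'b" where un: "\<And>n. norm (u n) \<le> 1" and u: "\<And>a. (\<lambda>n. a * u n) \<longlonglongrightarrow> a"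
    using u unfolding sigma_unital_def by blast
  have \<epsilon>2: "0 < \<epsilon> / 2" using \<epsilon> by simp
  define h where "h = ip E x x"
  have "(\<lambda>n. h - h * u n) \<longlonglongrightarrow> h - h" by (intro tendsto_diff tendsto_const u)
  then have lim: "(\<lambda>n. h - h * u n) \<longlonglongrightarrow> 0" by simp
  \<comment> \<open>Two terms of norm at most that of \<open>h - h u\<close> occur, hence the half;
    the square is there because an inner square is estimated.\<close>
  have pos: "0 < (\<epsilon> / 4)\<^sup>2 / 2" using \<epsilon> by simp
  obtain n where "\<And>m. m \<ge> n \<Longrightarrow> norm (h - h * u m - 0) < (\<epsilon> / 4)\<^sup>2 / 2"
    using LIMSEQ_D[OF lim pos] by blast
  from this[of n] have n: "norm (h - h * u n) < (\<epsilon> / 4)\<^sup>2 / 2" by simp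
  have "hnorm E (x - act E x (u n)) \<le> \<epsilon> / 4"
  proof (rule hnorm_le_power2)
    have "ip E (x - act E x (u n)) (x - act E x (u n)) = (h - h * u n) - star (u n) * (h - h * u n)"
      by (simp add: h_def ip_diff_left ip_diff_right ip_act_left ip_act_right algebra_simps)
    also have "norm \<dots> \<le> norm (h - h * u n) + norm (u n) * norm (h - h * u n)"
      by (rule order_trans[OF norm_triangle_ineq4]) (use norm_mult_ineq[of "star (u n)" "h - h * u n"] in simp)
    also have "\<dots> \<le> norm (h - h * u n) + 1 * norm (h - h * u n)"
      by (intro add_left_mono mult_right_mono un) simp
    finally show "norm (ip E (x - act E x (u n)) (x - act E x (u n))) \<le> (\<epsilon> / 4)\<^sup>2" using n by simp
  qed (use \<epsilon> in simp)
  moreover have "0 < \<epsilon> / 2 / (hnorm E x + 1)" using \<epsilon> by (simp add: add_nonneg_pos)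
  then obtain b c where bc: "b \<in> S" "c \<in> S" "norm (u n - b * c) < \<epsilon> / 2 / (hnorm E x + 1)"
    using sigma_unital_product_dense[OF assms(1) S] by blast
  have "hnorm E (act E x (u n - b * c)) \<le> \<epsilon> / 2"
  proof -
    have "hnorm E (act E x (u n - b * c)) \<le> (hnorm E x + 1) * norm (u n - b * c)"
      by (rule order_trans[OF hnorm_act_le]) (simp add: mult_right_mono)
    also have "\<dots> \<le> \<epsilon> / 2" using bc(3) add_nonneg_pos[OF hnorm_nonneg[of x] zero_less_one]
      by (simp only: pos_less_divide_eq) (simp add: mult.commute)
    finally show ?thesis .
  qed
  ultimately have "hnorm E (x - act E x (b * c)) < \<epsilon>"
    using hnorm_triangle[of "x - act E x (u n)" "act E x (u n - b * c)"] \<epsilon> by (simp add: act_diff_right)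
  then show ?thesis using that bc by blast
qed

section \<open>Creation operators\<close>

lemma adj_eqI:
  assumes "hilbert_module E" "\<And>x y. ip F (T x) y = ip E x (S y)" shows "adj E F T = S"
proof -
  interpret hilbert_module E by (rule assms(1))
  show ?thesis unfolding adj_def
  proof (rule the_equality)
    fix S' assume "\<forall>x y. ip F (T x) y = ip E x (S' y)"
    then show "S' = S" using assms(2) by (intro ext ip_nondegenerate) metis
  qed (simp add: assms(2))
qed

lemma ip_adj:
  assumes "hilbert_module E" "adjointable E F T" shows "ip F (T x) y = ip E x (adj E F T y)"
proof -
  obtain S where "\<And>x y. ip F (T x) y = ip E x (S y)" using assms(2) unfolding adjointable_def by blast
  then show ?thesis using adj_eqI[OF assms(1)] by metis
qed

locale creation_setup =
  T: graded_internal_tensor_product E1 \<pi>2 E2 tens E + E1: graded_hilbert_module E1 +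
  P: graded_regular_operator_pair E D E2 D2
  for E1 :: "('e1::complex_vector, 'b::graded_cstar_algebra) hmodule"
    and \<pi>2 :: "'b \<Rightarrow> 'e2::complex_vector \<Rightarrow> 'e2"
    and E2 :: "('e2, 'c::graded_cstar_algebra) hmodule"
    and tens :: "'e1 \<Rightarrow> 'e2 \<Rightarrow> 'e::complex_vector"
    and E :: "('e, 'c) hmodule" and D :: "'e \<rightharpoonup> 'e" and D2 :: "'e2 \<rightharpoonup> 'e2" +
  assumes rep2: "graded_representation E2 \<pi>2"
begin

sublocale E1: hilbert_module E1 by (rule E1.hilbert_module)

lemma hnorm_tens_le: "hnorm E (tens \<psi> \<eta>) \<le> hnorm E1 \<psi> * hnorm E2 \<eta>"
proof (rule P.E.hnorm_le_power2)
  have "norm (ip E2 \<eta> (\<pi>2 (ip E1 \<psi> \<psi>) \<eta>)) \<le> hnorm E2 \<eta> * hnorm E2 (\<pi>2 (ip E1 \<psi> \<psi>) \<eta>)"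
    by (rule P.F.cauchy_schwarz)
  also have "\<dots> \<le> hnorm E2 \<eta> * (norm (ip E1 \<psi> \<psi>) * hnorm E2 \<eta>)"
    using bounded_byD[OF rep_bounded_by[OF P.hilbert(2) rep2, of "ip E1 \<psi> \<psi>"], of \<eta>]
    by (intro mult_left_mono) (simp_all add: app_rep[OF P.hilbert(2) rep2])
  finally show "norm (ip E (tens \<psi> \<eta>) (tens \<psi> \<eta>)) \<le> (hnorm E1 \<psi> * hnorm E2 \<eta>)\<^sup>2"
    by (simp add: T.tens_ip power_mult_distrib E1.hnorm_power2) (simp add: power2_eq_square mult_ac)
qed simp

text \<open>On an elementary tensor of \<open>\<xi>\<close> and \<open>\<eta>\<close> the adjoint is
  \<open>\<pi>2 (ip E1 \<psi> \<xi>) \<eta>\<close>, and the span of these tensors is dense in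
  \<open>E\<close>.\<close>

lemma adjointable_tens: "adjointable E2 E (tens \<psi>)"
proof (rule P.F.adjointable_of_dense[OF P.hilbert(1) hnorm_tens_le T.tens_dense])
  fix y assume "y \<in> cspan {tens \<psi> \<eta> | \<psi> \<eta>. True}"
  then show "\<exists>z. \<forall>x. ip E (tens \<psi> x) y = ip E2 x z"
  proof (induction rule: cspan_induct)
    case base
    show ?case by (intro exI[of _ 0]) simp
  next
    case (step c u y)
    then obtain \<xi> \<eta> z where "u = tens \<xi> \<eta>" "\<forall>x. ip E (tens \<psi> x) y = ip E2 x z" by blast
    then show ?case
      by (intro exI[of _ "c *\<^sub>C \<pi>2 (ip E1 \<psi> \<xi>) \<eta> + z"])
        (simp add: P.E.ip_add_right P.E.ip_scaleC_right P.F.ip_add_right P.F.ip_scaleC_right T.tens_ip)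
  qed
qed

abbreviation annih :: "'e1 \<Rightarrow> 'e \<Rightarrow> 'e2" where "annih \<psi> \<equiv> adj E2 E (tens \<psi>)"

lemma ip_tens: "ip E (tens \<psi> \<eta>) \<xi> = ip E2 \<eta> (annih \<psi> \<xi>)"
  by (rule ip_adj[OF P.hilbert(2) adjointable_tens])

lemma ip_tens': "ip E \<xi> (tens \<psi> \<eta>) = ip E2 (annih \<psi> \<xi>) \<eta>"
  using ip_tens by (metis P.E.ip_star P.F.ip_star)

lemma annih_linear: "annih \<psi> (\<xi> + \<xi>') = annih \<psi> \<xi> + annih \<psi> \<xi>'" "annih \<psi> (c *\<^sub>C \<xi>) = c *\<^sub>C annih \<psi> \<xi>"
  by (rule P.F.ip_nondegenerate; simp add: P.E.ip_add_right P.E.ip_scaleC_right P.F.ip_add_right P.F.ip_scaleC_right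
      flip: ip_tens)+

lemma annih_add: "annih (\<psi> + \<psi>') \<xi> = annih \<psi> \<xi> + annih \<psi>' \<xi>"
  by (rule P.F.ip_nondegenerate) (simp add: P.F.ip_add_right T.tens_add_left P.E.ip_add_left flip: ip_tens)

lemma hnorm_annih_le: "hnorm E2 (annih \<psi> \<xi>) \<le> hnorm E1 \<psi> * hnorm E \<xi>"
proof (rule P.F.hnorm_le_of_dense[of UNIV])
  show "hdense E2 UNIV" unfolding hdense_def by (metis UNIV_I diff_self P.F.hnorm_zero)
  fix y
  have "norm (ip E2 (annih \<psi> \<xi>) y) \<le> hnorm E \<xi> * hnorm E (tens \<psi> y)"
    unfolding ip_tens'[symmetric] by (rule P.E.cauchy_schwarz)
  also have "\<dots> \<le> hnorm E \<xi> * (hnorm E1 \<psi> * hnorm E2 y)" by (intro mult_left_mono hnorm_tens_le) simp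
  finally show "norm (ip E2 (annih \<psi> \<xi>) y) \<le> hnorm E1 \<psi> * hnorm E \<xi> * hnorm E2 y" by (simp add: mult_ac)
qed simp

definition crea :: "'e1 \<Rightarrow> ('e \<times> 'e2) endo"
  where "crea \<psi> = Endo (creation_annihilation E2 tens E \<psi>)"

lemma app_crea: "app (crea \<psi>) = creation_annihilation E2 tens E \<psi>"
  unfolding crea_def creation_annihilation_def
  by (rule app_Endo) (auto simp: T.tens_add_right T.tens_scaleC_right annih_linear scaleC_prod_def)

lemma crea_app [simp]: "crea \<psi> \<cdot> (\<xi>, \<eta>) = (tens \<psi> \<eta>, annih \<psi> \<xi>)"
  by (simp add: app_crea creation_annihilation_def)

lemma crea_adjoint: "adjoint_pair P.X (crea \<psi>) (crea \<psi>)"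
  unfolding adjoint_pair_def by (auto simp: ip_tens ip_tens' add.commute)

lemma crea_bounded_by: "bounded_by P.X (2 * hnorm E1 \<psi>) (crea \<psi>)"
  unfolding bounded_by_def
proof
  fix p :: "'e \<times> 'e2" obtain \<xi> \<eta> where p: "p = (\<xi>, \<eta>)" by (cases p)
  have "hnorm P.X (crea \<psi> \<cdot> p) \<le> hnorm E (tens \<psi> \<eta>) + hnorm E2 (annih \<psi> \<xi>)"
    unfolding p crea_app by (rule hnorm_dsum_ge[OF P.hilbert])
  also have "\<dots> \<le> hnorm E1 \<psi> * hnorm E2 \<eta> + hnorm E1 \<psi> * hnorm E \<xi>"
    by (intro add_mono hnorm_tens_le hnorm_annih_le)
  also have "\<dots> \<le> hnorm E1 \<psi> * hnorm P.X p + hnorm E1 \<psi> * hnorm P.X p"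
    unfolding p by (intro add_mono mult_left_mono hnorm_dsum_le[OF P.hilbert]) simp_all
  finally show "hnorm P.X (crea \<psi> \<cdot> p) \<le> 2 * hnorm E1 \<psi> * hnorm P.X p" by simp
qed

lemma crea_add: "crea (\<psi> + \<psi>') = crea \<psi> + crea \<psi>'"
  by (rule pair_endo_eqI) (simp add: T.tens_add_left annih_add)

definition comm :: "'e1 \<Rightarrow> ('e \<times> 'e2) endo"
  where "comm \<psi> = P.X.btr * crea \<psi> - P.X.gr_conj (crea \<psi>) * P.X.btr"

lemma graded_commutator_crea:
  "graded_commutator P.X (map_prod (bounded_transform E D) (bounded_transform E2 D2)) (creation_annihilation E2 tens E \<psi>)
    = app (comm \<psi>)"
  unfolding P.bounded_transform_dsum[symmetric] app_crea[symmetric] comm_def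
  by (rule P.X.graded_commutator_bounded_transform)

lemma comm_add: "comm (\<psi> + \<psi>') = comm \<psi> + comm \<psi>'"
  by (simp add: comm_def crea_add P.X.gr_conj_def algebra_simps)

lemma comm_zero: "comm 0 = 0"
  using comm_add[of 0 0] by simp

lemma comm_diff: "comm (\<psi> - \<psi>') = comm \<psi> - comm \<psi>'"
  using comm_add[of "\<psi> - \<psi>'" \<psi>'] by simp

lemma comm_bounded_by: "bounded_by P.X (4 * hnorm E1 \<psi>) (comm \<psi>)"
proof -
  have "bounded_by P.X (2 * hnorm E1 \<psi>) (P.X.gr_conj (crea \<psi>))"
    unfolding bounded_by_def
  proof
    show "hnorm P.X (P.X.gr_conj (crea \<psi>) \<cdot> p) \<le> 2 * hnorm E1 \<psi> * hnorm P.X p" for p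
      using bounded_byD[OF crea_bounded_by, of \<psi> "gr P.X p"] by simp
  qed
  from P.X.bounded_by_diff[OF P.X.bounded_by_mult[OF _ P.X.btr_contraction crea_bounded_by[of \<psi>]]
      P.X.bounded_by_mult[OF _ this P.X.btr_contraction]]
  show ?thesis by (simp add: comm_def)
qed

lemma comm_adjoint: "\<exists>S. adjoint_pair P.X (comm \<psi>) S"
  unfolding comm_def
  by (rule exI) (rule P.X.adjoint_pair_diff P.X.adjoint_pair_mult P.X.btr_adjoint crea_adjoint P.X.adjoint_pair_gr_conj)+

text \<open>The commutator is additive in \<open>\<psi>\<close> and bounded by four times its norm,
  so the vectors with compact commutator form a closed set.\<close>

lemma compact_comm_closed:
  assumes "\<And>\<epsilon>. 0 < \<epsilon> \<Longrightarrow> \<exists>\<psi>'. P.X.compact_endo (comm \<psi>') \<and> hnorm E1 (\<psi> - \<psi>') < \<epsilon>"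
  shows "P.X.compact_endo (comm \<psi>)"
proof -
  obtain S where S: "adjoint_pair P.X (comm \<psi>) S" using comm_adjoint by blast
  show ?thesis
  proof (rule P.X.compact_endo_closed[OF S])
    fix \<epsilon> :: real assume "0 < \<epsilon>"
    then obtain \<psi>' where \<psi>': "P.X.compact_endo (comm \<psi>')" "hnorm E1 (\<psi> - \<psi>') < \<epsilon> / 4"
      using assms[of "\<epsilon> / 4"] by auto
    have "bounded_by P.X \<epsilon> (comm \<psi> - comm \<psi>')"
      using P.X.bounded_by_mono[OF comm_bounded_by[of "\<psi> - \<psi>'"], of \<epsilon>] \<psi>'(2) by (simp add: comm_diff)
    then show "\<exists>S. P.X.compact_endo S \<and> bounded_by P.X \<epsilon> (comm \<psi> - S)" using \<psi>'(1) by blast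
  qed
qed

text \<open>The creation operator of \<open>\<pi>1(a) \<psi> b\<close> is
  \<open>\<pi>(a) T \<pi>2(b)\<close>, as tensors are balanced. The second entry of the off-diagonal
  matrix is the adjoint of the first, so the outer factors are adjoint to each other and
  \<open>star b\<close> appears beside \<open>a\<close>.\<close>

lemma crea_act:
  assumes rep: "graded_representation E \<pi>" and \<pi>1: "\<And>a \<psi> \<eta>. \<pi> a (tens \<psi> \<eta>) = tens (\<pi>1 a \<psi>) \<eta>"
  shows "crea (\<pi>1 a (act E1 \<psi> b)) =
    pair_endo (rep \<pi> a) (rep \<pi>2 (star b)) * crea \<psi> * pair_endo (rep \<pi> (star a)) (rep \<pi>2 b)"
proof -
  note r = app_rep[OF P.hilbert(1) rep] app_rep[OF P.hilbert(2) rep2]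
  have t: "tens (\<pi>1 a (act E1 \<psi> b)) \<eta> = \<pi> a (tens \<psi> (\<pi>2 b \<eta>))" for \<eta>
    by (simp add: T.tens_balanced flip: \<pi>1)
  have "annih (\<pi>1 a (act E1 \<psi> b)) = (\<lambda>\<xi>. \<pi>2 (star b) (annih \<psi> (\<pi> (star a) \<xi>)))"
  proof (rule adj_eqI[OF P.hilbert(2)])
    fix \<eta> \<xi>
    have "ip E (\<pi> a (tens \<psi> (\<pi>2 b \<eta>))) \<xi> = ip E (tens \<psi> (\<pi>2 b \<eta>)) (\<pi> (star a) \<xi>)"
      using adjoint_pairD[OF rep_adjoint[OF P.hilbert(1) rep]] by (simp add: r)
    also have "\<dots> = ip E2 \<eta> (\<pi>2 (star b) (annih \<psi> (\<pi> (star a) \<xi>)))"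
      using adjoint_pairD[OF rep_adjoint[OF P.hilbert(2) rep2]] by (simp add: r ip_tens)
    finally show "ip E (tens (\<pi>1 a (act E1 \<psi> b)) \<eta>) \<xi> = ip E2 \<eta> (\<pi>2 (star b) (annih \<psi> (\<pi> (star a) \<xi>)))"
      by (simp add: t)
  qed
  then show ?thesis by (intro pair_endo_eqI) (simp add: r t)
qed

end

section \<open>Half-closed modules and the approximation argument\<close>

lemma (in half_closed_module) rep_lipschitz:
  assumes "a \<in> \<A>"
  shows "graded_regular_operator.lipschitz E D (rep \<pi> a)"
    and "graded_regular_operator.lipschitz E D (rep \<pi> (star a))"
    and "\<And>y. y \<in> dom (adj_op E E D) \<Longrightarrow> rep \<pi> a \<cdot> y \<in> dom D"
proof -
  interpret G: graded_regular_operator E D by (rule graded_regular_operator)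
  note r = app_rep[OF hilbert_module representation]
  have "star a \<in> \<A>" using assms dense_subalgebra unfolding dense_star_subalgebra_def by blast
  then have "\<pi> a \<in> Lip_star E D" "\<pi> (star a) \<in> Lip_star E D" using assms lipschitz by blast+
  then have L: "app (rep \<pi> a) \<in> Lip E D" "app (rep \<pi> (star a)) \<in> Lip E D" and
    d: "\<pi> a ` dom (adj_op E E D) \<subseteq> dom D" unfolding Lip_star_def r by simp_all
  then show "G.lipschitz (rep \<pi> a)" "G.lipschitz (rep \<pi> (star a))" unfolding G.Lip_iff_lipschitz by simp_all
  show "rep \<pi> a \<cdot> y \<in> dom D" if "y \<in> dom (adj_op E E D)" for y using d that unfolding r by blast
qed

lemma (in half_closed_module) rep_res_compact:
  "compact_op E (app (rep \<pi> a * regular_operator.res E D))"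
proof -
  interpret G: graded_regular_operator E D by (rule graded_regular_operator)
  have "app (rep \<pi> a * G.res) = \<pi> a \<circ> resolvent_op E D"
    by (simp add: fun_eq_iff app_rep[OF hilbert_module representation] G.app_res)
  then show ?thesis using locally_compact by simp
qed

theorem proposition2p11:
  fixes \<A> :: "'a::graded_cstar_algebra set"
    and \<B> :: "'b::graded_cstar_algebra set"
    and E1 :: "('e1::complex_vector, 'b) hmodule"
    and E2 :: "('e2::complex_vector, 'c::graded_cstar_algebra) hmodule"
    and E :: "('e::complex_vector, 'c) hmodule"
    and \<pi>1 :: "'a \<Rightarrow> 'e1 \<Rightarrow> 'e1" and \<pi>2 :: "'b \<Rightarrow> 'e2 \<Rightarrow> 'e2"
    and \<pi> :: "'a \<Rightarrow> 'e \<Rightarrow> 'e"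
    and D1 :: "'e1 \<rightharpoonup> 'e1" and D2 :: "'e2 \<rightharpoonup> 'e2" and D :: "'e \<rightharpoonup> 'e"
    and tens :: "'e1 \<Rightarrow> 'e2 \<Rightarrow> 'e"
    and \<E>1 :: "'e1 set"
  assumes "sigma_unital TYPE('a)" and "sigma_unital TYPE('b)" and "sigma_unital TYPE('c)"
    and "half_closed_module \<A> \<pi>1 E1 D1"
    and "half_closed_module \<B> \<pi>2 E2 D2"
    and "half_closed_module \<A> \<pi> E D"
    and "graded_internal_tensor_product E1 \<pi>2 E2 tens E"
    and "\<And>a \<psi> \<eta>. \<pi> a (tens \<psi> \<eta>) = tens (\<pi>1 a \<psi>) \<eta>"
    and "essential E1 \<pi>1"
    and "csubspace \<E>1" and "\<E>1 \<subseteq> dom D1" and "hdense E1 \<E>1"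
    and "\<And>\<psi>. \<psi> \<in> \<E>1 \<Longrightarrow>
      creation_annihilation E2 tens E \<psi> \<in> Lip (dsum_module E E2) (dsum_op D D2)"
    and "\<psi> \<in> range_span \<pi>1"
  shows "compact_op (dsum_module E E2)
    (graded_commutator (dsum_module E E2)
      (map_prod (bounded_transform E D) (bounded_transform E2 D2))
      (creation_annihilation E2 tens E \<psi>))"
proof -
  interpret H1: half_closed_module \<A> \<pi>1 E1 D1 by fact
  interpret H2: half_closed_module \<B> \<pi>2 E2 D2 by fact
  interpret H: half_closed_module \<A> \<pi> E D by fact
  interpret GE: graded_regular_operator E D by (rule H.graded_regular_operator)
  interpret GE2: graded_regular_operator E2 D2 by (rule H2.graded_regular_operator)
  interpret T: graded_internal_tensor_product E1 \<pi>2 E2 tens E by fact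
  interpret C: creation_setup E1 \<pi>2 E2 tens E D D2
    by unfold_locales (rule H2.representation)
  note h = GE.hilbert_module_axioms GE2.hilbert_module_axioms
  note rep1 = H1.hilbert_module H1.representation
  have sub: "x * y \<in> \<A>" "star x \<in> \<A>" if "x \<in> \<A>" "y \<in> \<A>" for x y
    using H.dense_subalgebra that unfolding dense_star_subalgebra_def by blast+
  have sub2: "x * y \<in> \<B>" "star x \<in> \<B>" if "x \<in> \<B>" "y \<in> \<B>" for x y
    using H2.dense_subalgebra that unfolding dense_star_subalgebra_def by blast+
  have dense: "closure \<A> = UNIV" "closure \<B> = UNIV"
    using H.dense_subalgebra H2.dense_subalgebra unfolding dense_star_subalgebra_def by blast+
  have core: "C.P.X.compact_endo (C.comm (\<pi>1 (a1 * a2) (act E1 \<phi> (b1 * b2))))"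
    if a: "a1 \<in> \<A>" "a2 \<in> \<A>" and b: "b1 \<in> \<B>" "b2 \<in> \<B>" and \<phi>: "\<phi> \<in> \<E>1" for a1 a2 b1 b2 \<phi>
  proof -
    \<comment> \<open>As \<open>star\<close> reverses products, \<open>star b2\<close> goes with
      \<open>a1\<close> and \<open>star b1\<close> with \<open>a2\<close>.\<close>
    let ?m1 = "pair_endo (rep \<pi> a1) (rep \<pi>2 (star b2))" and ?m1' = "pair_endo (rep \<pi> (star a1)) (rep \<pi>2 b2)"
    let ?m2 = "pair_endo (rep \<pi> a2) (rep \<pi>2 (star b1))" and ?m2' = "pair_endo (rep \<pi> (star a2)) (rep \<pi>2 b1)"
    have adj: "adjoint_pair C.P.X (pair_endo (rep \<pi> x) (rep \<pi>2 (star y))) (pair_endo (rep \<pi> (star x)) (rep \<pi>2 y))" for x y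
      using C.P.pair_adjoint[OF rep_adjoint[OF h(1) H.representation, of x] rep_adjoint[OF h(2) H2.representation, of "star y"]]
      by (simp add: star_star)
    have bd: "bounded_endo C.P.X (pair_endo (rep \<pi> x) (rep \<pi>2 y))" for x y
      by (intro C.P.pair_bounded rep_bounded h H.representation H2.representation)
    have l: "C.P.X.lipschitz (pair_endo (rep \<pi> x) (rep \<pi>2 (star y)))"
      "C.P.X.lipschitz (pair_endo (rep \<pi> (star x)) (rep \<pi>2 y))" if "x \<in> \<A>" "y \<in> \<B>" for x y
      using C.P.pair_lipschitz H.rep_lipschitz(1,2)[OF that(1)] H2.rep_lipschitz(1,2)[OF that(2)] by blast+
    have mult: "?m1 * ?m2 = pair_endo (rep \<pi> (a1 * a2)) (rep \<pi>2 (star (b1 * b2)))"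
      "?m2' * ?m1' = pair_endo (rep \<pi> (star (a1 * a2))) (rep \<pi>2 (b1 * b2))"
      by (simp_all add: pair_endo_mult star_mult rep_mult[OF h(1) H.representation] rep_mult[OF h(2) H2.representation])
    have crea: "C.P.X.lipschitz (C.crea \<phi>)"
      using assms(13)[OF \<phi>] C.P.X.Lip_iff_lipschitz by (simp flip: C.app_crea)
    have res: "C.P.X.compact_endo (?m1 * C.P.X.res)"
      unfolding C.P.res_dsum pair_endo_mult by (intro C.P.pair_compact H.rep_res_compact H2.rep_res_compact)
    have star: "?m2 \<cdot> p \<in> dom (dsum_op D D2)" if "p \<in> dom (adj_op C.P.X C.P.X (dsum_op D D2))" for p
      using that H.rep_lipschitz(3)[OF a(2)] H2.rep_lipschitz(3)[OF sub2(2)[OF b(1) b(1)]]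
      unfolding C.P.dom_adj_dsum by (elim SigmaE) simp
    have "compact_op C.P.X (graded_commutator C.P.X (bounded_transform C.P.X (dsum_op D D2))
      (app (?m1 * ?m2 * C.crea \<phi> * (?m2' * ?m1'))))"
      using l[OF a(2) b(1)] l[OF sub(1)[OF a] sub2(1)[OF b]]
      by (intro C.P.X.graded_commutator_compact adj bd C.crea_adjoint crea res star
          C.P.X.bounded_byI_endo[OF C.crea_bounded_by]) (simp_all only: mult)
    then show ?thesis
      unfolding mult C.crea_act[OF H.representation assms(8), symmetric] C.P.bounded_transform_dsum C.app_crea
        C.graded_commutator_crea .
  qed
  \<comment> \<open>The right factor is removed: suitable products \<open>b1 b2\<close> act almost
    like the identity on \<open>\<phi>\<close>.\<close>
  have 1: "C.P.X.compact_endo (C.comm (\<pi>1 a \<phi>))" if "a \<in> {x * y | x y. x \<in> \<A> \<and> y \<in> \<A>}" "\<phi> \<in> \<E>1" for a \<phi>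
  proof (rule C.compact_comm_closed)
    fix \<epsilon> :: real assume \<epsilon>: "0 < \<epsilon>"
    obtain K where K: "0 \<le> K" "bounded_by E1 K (rep \<pi>1 a)"
      using rep_bounded_by[OF rep1] norm_ge_zero by blast
    obtain b1 b2 where b: "b1 \<in> \<B>" "b2 \<in> \<B>" "hnorm E1 (\<phi> - act E1 \<phi> (b1 * b2)) < \<epsilon> / (K + 1)"
      using C.E1.act_product_dense[OF assms(2) dense(2), of "\<epsilon> / (K + 1)" \<phi>] \<epsilon> K by auto
    have "hnorm E1 (\<pi>1 a \<phi> - \<pi>1 a (act E1 \<phi> (b1 * b2))) < \<epsilon>"
    proof -
      have "hnorm E1 (\<pi>1 a \<phi> - \<pi>1 a (act E1 \<phi> (b1 * b2))) = hnorm E1 (rep \<pi>1 a \<cdot> (\<phi> - act E1 \<phi> (b1 * b2)))"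
        by (simp only: app_diff) (simp only: app_rep[OF rep1])
      also have "\<dots> \<le> K * hnorm E1 (\<phi> - act E1 \<phi> (b1 * b2))" using K(2) by (rule bounded_byD)
      also have "\<dots> \<le> (K + 1) * hnorm E1 (\<phi> - act E1 \<phi> (b1 * b2))" by (simp add: mult_right_mono)
      also have "\<dots> < \<epsilon>" using b(3) K(1) by (simp add: pos_less_divide_eq mult.commute)
      finally show ?thesis .
    qed
    then show "\<exists>\<psi>'. C.P.X.compact_endo (C.comm \<psi>') \<and> hnorm E1 (\<pi>1 a \<phi> - \<psi>') < \<epsilon>"
      using core that b by blast
  qed
  \<comment> \<open>\<open>\<E>1\<close> is dense and \<open>\<pi>1 a\<close> is bounded, so
    \<open>\<phi>\<close> may be replaced by any vector.\<close>
  have 2: "C.P.X.compact_endo (C.comm (\<pi>1 a \<xi>))" if "a \<in> {x * y | x y. x \<in> \<A> \<and> y \<in> \<A>}" for a \<xi>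
  proof (rule C.compact_comm_closed)
    fix \<epsilon> :: real assume \<epsilon>: "0 < \<epsilon>"
    obtain K where K: "0 \<le> K" "bounded_by E1 K (rep \<pi>1 a)"
      using rep_bounded_by[OF rep1] norm_ge_zero by blast
    obtain \<phi> where \<phi>: "\<phi> \<in> \<E>1" "hnorm E1 (\<xi> - \<phi>) < \<epsilon> / (K + 1)"
      using assms(12) \<epsilon> K unfolding hdense_def by (metis add_nonneg_pos divide_pos_pos zero_less_one)
    have "hnorm E1 (\<pi>1 a \<xi> - \<pi>1 a \<phi>) < \<epsilon>"
    proof -
      have "hnorm E1 (\<pi>1 a \<xi> - \<pi>1 a \<phi>) = hnorm E1 (rep \<pi>1 a \<cdot> (\<xi> - \<phi>))"
        by (simp only: app_diff) (simp only: app_rep[OF rep1])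
      also have "\<dots> \<le> K * hnorm E1 (\<xi> - \<phi>)" using K(2) by (rule bounded_byD)
      also have "\<dots> \<le> (K + 1) * hnorm E1 (\<xi> - \<phi>)" by (simp add: mult_right_mono)
      also have "\<dots> < \<epsilon>" using \<phi>(2) K(1) by (simp add: pos_less_divide_eq mult.commute)
      finally show ?thesis .
    qed
    then show "\<exists>\<psi>'. C.P.X.compact_endo (C.comm \<psi>') \<and> hnorm E1 (\<pi>1 a \<xi> - \<psi>') < \<epsilon>"
      using 1[OF that \<phi>(1)] by blast
  qed
  \<comment> \<open>Products of two elements of \<open>\<A>\<close> are dense in the algebra, and
    \<open>\<pi>1\<close> is contractive.\<close>
  have 3: "C.P.X.compact_endo (C.comm (\<pi>1 a \<xi>))" for a \<xi>
  proof (rule C.compact_comm_closed)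
    fix \<epsilon> :: real assume \<epsilon>: "0 < \<epsilon>"
    have "0 < \<epsilon> / (hnorm E1 \<xi> + 1)" using \<epsilon> by (simp add: add_nonneg_pos)
    then obtain x y where xy: "x \<in> \<A>" "y \<in> \<A>" "norm (a - x * y) < \<epsilon> / (hnorm E1 \<xi> + 1)"
      using sigma_unital_product_dense[OF assms(1) dense(1)] by blast
    have "hnorm E1 (\<pi>1 a \<xi> - \<pi>1 (x * y) \<xi>) < \<epsilon>"
    proof -
      have "hnorm E1 (\<pi>1 a \<xi> - \<pi>1 (x * y) \<xi>) = hnorm E1 (rep \<pi>1 (a - x * y) \<cdot> \<xi>)"
        by (simp add: rep_diff[OF rep1] app_rep[OF rep1])
      also have "\<dots> \<le> norm (a - x * y) * hnorm E1 \<xi>" using rep_bounded_by[OF rep1] by (rule bounded_byD)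
      also have "\<dots> \<le> norm (a - x * y) * (hnorm E1 \<xi> + 1)" by (simp add: mult_left_mono)
      also have "\<dots> < \<epsilon>" using xy(3) by (simp add: pos_less_divide_eq add_nonneg_pos)
      finally show ?thesis .
    qed
    then show "\<exists>\<psi>'. C.P.X.compact_endo (C.comm \<psi>') \<and> hnorm E1 (\<pi>1 a \<xi> - \<psi>') < \<epsilon>"
      using 2[of "x * y" \<xi>] xy by blast
  qed
  have "C.P.X.compact_endo (C.comm \<psi>)"
    using assms(14) unfolding range_span_def
  proof (induction rule: cspan_induct)
    case base
    show ?case unfolding C.comm_zero by (rule C.P.X.compact_endo_0)
  next
    case (step c u v)
    then obtain a \<xi> where "u = \<pi>1 a \<xi>" by blast
    \<comment> \<open>The scalar is absorbed into the algebra element, so each step of the span adds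
      a vector already covered.\<close>
    then have eq: "c *\<^sub>C u = \<pi>1 (c *\<^sub>C a) \<xi>" using H1.representation unfolding graded_representation_def by simp
    show ?case unfolding eq C.comm_add by (rule C.P.X.compact_endo_add[OF 3 step(2)])
  qed
  then show ?thesis unfolding C.graded_commutator_crea .
qed

end
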